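(* Let $(\mathcal{X}_1\times\mathcal{X}_2,p(y|x_1,x_2),\mathcal{Y})$ be any discrete MAC, and let $\mathbf{C}_\mathrm{in}^*=(C_\mathrm{in}^{*1},C_\mathrm{in}^{*2})$ be such that $\min\{C_\mathrm{in}^{*1},C_\mathrm{in}^{*2}\}>\max_{p(x_1,x_2)}I(X_1,X_2;Y)$. Then the mapping $$\mathbf{C}_\mathrm{out}\mapsto C_\mathrm{sum,avg}(\mathbf{C}_\mathrm{in}^*,\mathbf{C}_\mathrm{out}),$$ defined on $\mathbb{R}^2_{\geq 0}$, is continuous.
   Context: A discrete MAC (multiple access channel) is a triple $(\mathcal{X}_1\times\mathcal{X}_2,p(y|x_1,x_2),\mathcal{Y})$ with $\mathcal{X}_1,\mathcal{X}_2,\mathcal{Y}$ finite sets and $p(y|x_1,x_2)$ a conditional probability mass function; it is used memorylessly: $p(y^n|x_1^n,x_2^n)=\prod_{t=1}^n p(y_t|x_{1t},x_{2t})$. Logarithms (and mutual information) are base 2. For $x\ge 1$, $[x]=\{1,\dots,\lfloor x\rfloor\}$. Let $\mathbf{C}_\mathrm{in}=(C_\mathrm{in}^1,C_\mathrm{in}^2)$ and $\mathbf{C}_\mathrm{out}=(C_\mathrm{out}^1,C_\mathrm{out}^2)$ be in $\mathbb{R}^2_{\ge0}$ (the input and output link capacities of a cooperation facilitator, CF). A $(2^{nR_1},2^{nR_2},n)$-code ($n\ge1$ an integer, $R_1,R_2\ge0$) for the MAC with a $(\mathbf{C}_\mathrm{in},\mathbf{C}_\mathrm{out})$-CF consists of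 mappings, for $i\in\{1,2\}$, $\varphi_i\colon[2^{nR_i}]\to[2^{nC_\mathrm{in}^i}]$, $\psi_i\colon[2^{nC_\mathrm{in}^1}]\times[2^{nC_\mathrm{in}^2}]\to[2^{nC_\mathrm{out}^i}]$, $f_i\colon[2^{nR_i}]\times[2^{nC_\mathrm{out}^i}]\to\mathcal{X}_i^n$, and a decoder $g\colon\mathcal{Y}^n\to[2^{nR_1}]\times[2^{nR_2}]$. For a message pair $(w_1,w_2)$ put $z_i=\psi_i(\varphi_1(w_1),\varphi_2(w_2))$ and $$\lambda_n(w_1,w_2)=\sum_{y^n\colon g(y^n)\ne(w_1,w_2)}p(y^n|f_1(w_1,z_1),f_2(w_2,z_2)).$$ The average error probability is $P^{(n)}_{e,\mathrm{avg}}=2^{-n(R_1+R_2)}\sum_{w_1,w_2}\lambda_n(w_1,w_2)$. A rate pair $(R_1,R_2)$ is achievable (average error) if there is a sequence of $(2^{nR_1},2^{nR_2},n)$-codes with $P^{(n)}_{e,\mathrm{avg}}\to0$ as $n\to\infty$. The average-error capacity region $\mathscr{C}_\mathrm{avg}(\mathbf{C}_\mathrm{in},\mathbf{C}_\mathrm{out})$ is the closure of the set of achievable rate pairs, and $C_\mathrm{sum,avg}(\mathbf{C}_\mathrm{in},\mathbf{C}_\mathrm{out})=\max_{(R_1,R_2)\in\mathscr{C}_\mathrm{avg}(\mathbf{C}_\mathrm{in},\mathbf{C}_\mathrm{out})}(R_1+R_2)$. The condition on $\mathbf{C}_\mathrm{in}^*$ expresses that the CF has full knowledge of both messages. The maximum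 of $I(X_1,X_2;Y)$ is over all joint input distributions on $\mathcal{X}_1\times\mathcal{X}_2$. *)

theory Defs
  imports "HOL-Probability.Probability"
begin

text \<open>
  A discrete MAC is a function \<open>W :: 'a \<Rightarrow> 'b \<Rightarrow> 'c pmf\<close> on types of class \<open>finite\<close>, where \<open>W x1 x2\<close>
  is the distribution \<open>p(y | x1, x2)\<close>.  Sequences of length \<open>n\<close> over an alphabet are the
  extensional functions on \<open>{1..n}\<close>.  Rate pairs and capacity pairs are elements of
  \<open>real \<times> real\<close>.
\<close>

definition index_set :: "real \<Rightarrow> nat set" where
  "index_set x = {1..nat \<lfloor>x\<rfloor>}"

definition seqs :: "nat \<Rightarrow> (nat \<Rightarrow> 'a) set" where
  "seqs n = {1..n} \<rightarrow>\<^sub>E UNIV"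

definition memoryless :: "('a \<Rightarrow> 'b \<Rightarrow> 'c pmf) \<Rightarrow> nat \<Rightarrow> (nat \<Rightarrow> 'a) \<Rightarrow> (nat \<Rightarrow> 'b) \<Rightarrow> (nat \<Rightarrow> 'c) \<Rightarrow> real"
  where "memoryless W n x1 x2 y = (\<Prod>t=1..n. pmf (W (x1 t) (x2 t)) (y t))"

record ('a, 'b, 'c) cf_code =
  cf_in1 :: "nat \<Rightarrow> nat"
  cf_in2 :: "nat \<Rightarrow> nat"
  cf_out1 :: "nat \<times> nat \<Rightarrow> nat"
  cf_out2 :: "nat \<times> nat \<Rightarrow> nat"
  enc1 :: "nat \<times> nat \<Rightarrow> nat \<Rightarrow> 'a"
  enc2 :: "nat \<times> nat \<Rightarrow> nat \<Rightarrow> 'b"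
  dec :: "(nat \<Rightarrow> 'c) \<Rightarrow> nat \<times> nat"

definition is_cf_code ::
  "real \<times> real \<Rightarrow> real \<times> real \<Rightarrow> real \<times> real \<Rightarrow> nat \<Rightarrow> ('a, 'b, 'c) cf_code \<Rightarrow> bool" where
  "is_cf_code Cin Cout R n c \<longleftrightarrow>
     (let M1 = index_set (2 powr (real n * fst R));
          M2 = index_set (2 powr (real n * snd R));
          I1 = index_set (2 powr (real n * fst Cin));
          I2 = index_set (2 powr (real n * snd Cin));
          O1 = index_set (2 powr (real n * fst Cout));
          O2 = index_set (2 powr (real n * snd Cout))
      in cf_in1 c \<in> M1 \<rightarrow> I1 \<and> cf_in2 c \<in> M2 \<rightarrow> I2 \<and>
         cf_out1 c \<in> I1 \<times> I2 \<rightarrow> O1 \<and> cf_out2 c \<in> I1 \<times> I2 \<rightarrow> O2 \<and>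
         enc1 c \<in> M1 \<times> O1 \<rightarrow> seqs n \<and> enc2 c \<in> M2 \<times> O2 \<rightarrow> seqs n \<and>
         dec c \<in> seqs n \<rightarrow> M1 \<times> M2)"

definition error_prob ::
  "('a \<Rightarrow> 'b \<Rightarrow> 'c pmf) \<Rightarrow> nat \<Rightarrow> ('a, 'b, 'c) cf_code \<Rightarrow> nat \<Rightarrow> nat \<Rightarrow> real" where
  "error_prob W n c w1 w2 =
     (let v1 = cf_in1 c w1;
          v2 = cf_in2 c w2;
          z1 = cf_out1 c (v1, v2);
          z2 = cf_out2 c (v1, v2)
      in \<Sum>y \<in> {y \<in> seqs n. dec c y \<noteq> (w1, w2)}.
           memoryless W n (enc1 c (w1, z1)) (enc2 c (w2, z2)) y)"

definition avg_error_prob ::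
  "('a \<Rightarrow> 'b \<Rightarrow> 'c pmf) \<Rightarrow> real \<times> real \<Rightarrow> nat \<Rightarrow> ('a, 'b, 'c) cf_code \<Rightarrow> real" where
  "avg_error_prob W R n c =
     2 powr (- (real n * (fst R + snd R))) *
       (\<Sum>w1 \<in> index_set (2 powr (real n * fst R)).
        \<Sum>w2 \<in> index_set (2 powr (real n * snd R)). error_prob W n c w1 w2)"

definition achievable_avg ::
  "('a \<Rightarrow> 'b \<Rightarrow> 'c pmf) \<Rightarrow> real \<times> real \<Rightarrow> real \<times> real \<Rightarrow> real \<times> real \<Rightarrow> bool" where
  "achievable_avg W Cin Cout R \<longleftrightarrow>
     fst R \<ge> 0 \<and> snd R \<ge> 0 \<and>
     (\<exists>c :: nat \<Rightarrow> ('a, 'b, 'c) cf_code.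
        (\<forall>n\<ge>1. is_cf_code Cin Cout R n (c n)) \<and>
        (\<lambda>n. avg_error_prob W R n (c n)) \<longlonglongrightarrow> 0)"

definition capacity_region_avg ::
  "('a \<Rightarrow> 'b \<Rightarrow> 'c pmf) \<Rightarrow> real \<times> real \<Rightarrow> real \<times> real \<Rightarrow> (real \<times> real) set" where
  "capacity_region_avg W Cin Cout = closure {R. achievable_avg W Cin Cout R}"

text \<open>
  For finite alphabets and nonnegative link capacities the region is nonempty and compact, so the
  supremum is attained.
\<close>

definition sum_capacity_avg ::
  "('a \<Rightarrow> 'b \<Rightarrow> 'c pmf) \<Rightarrow> real \<times> real \<Rightarrow> real \<times> real \<Rightarrow> real" where
  "sum_capacity_avg W Cin Cout = (SUP R \<in> capacity_region_avg W Cin Cout. fst R + snd R)"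

definition mac_joint :: "('a \<Rightarrow> 'b \<Rightarrow> 'c pmf) \<Rightarrow> ('a \<times> 'b) pmf \<Rightarrow> (('a \<times> 'b) \<times> 'c) pmf" where
  "mac_joint W q = bind_pmf q (\<lambda>x. map_pmf (Pair x) (W (fst x) (snd x)))"

definition mac_mutual_information :: "('a \<Rightarrow> 'b \<Rightarrow> 'c pmf) \<Rightarrow> ('a \<times> 'b) pmf \<Rightarrow> real" where
  "mac_mutual_information W q =
     prob_space.mutual_information (measure_pmf (mac_joint W q)) 2
       (count_space UNIV) (count_space UNIV) fst snd"

text \<open>
  For finite alphabets the mutual information is a continuous function of \<open>q\<close> on the compact
  probability simplex, so the supremum over all joint input distributions is attained.
\<close>

definition max_mutual_information :: "('a \<Rightarrow> 'b \<Rightarrow> 'c pmf) \<Rightarrow> real" where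
  "max_mutual_information W = (SUP q. mac_mutual_information W q)"

end

theory Submission
  imports Defs "HOL-Real_Asymp.Real_Asymp"
begin

text \<open>
  Since the input capacities exceed every achievable sum rate, the facilitator may be assumed to
  know both messages.  Write \<open>f(a,b)\<close> for the sum capacity with output capacities \<open>(a,b)\<close>; it is
  monotone in both arguments.  Leaving channel uses idle gives \<open>f(l a, l b) \<le> l f(a, b)\<close> for
  \<open>l \<ge> 1\<close>, hence continuity where both capacities are positive.  On an axis it suffices that
  \<open>f(a, d) \<le> f(a + 2 d, 0) + 4 d\<close>: freeze, for every message \<open>w2\<close>, the most popular codeword of the
  second encoder, group the messages of the first encoder into bins of size about \<open>2 ^ (n d)\<close>, each
  of which contains for every \<open>w2\<close> a message compatible with that codeword, and let the
  facilitator tell the first encoder which element of its bin to use.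

  At the origin the bound is single-letter.  The codeword pairs that a facilitator with output
  capacities \<open>(a, b)\<close> can induce form a subset of density about \<open>2 ^ (- n (a + b))\<close> in a product
  of two codebooks.
  Ahlswede's wringing technique conditions on a few coordinates so that in every position the pair
  of input letters becomes almost independent, at a negligible cost in rate.  A relative entropy
  converse then bounds the sum rate by the mutual information of independent inputs, which is
  achievable without any cooperation by random coding.
\<close>

section \<open>A relative entropy converse\<close>

text \<open>The condition on \<open>Cin\<close> enters once: each achievable rate is at most the sum
  rate, which no cooperation lifts above the maximal mutual information, so each encoder can hand
  its whole message to the facilitator. Away from the origin no formula for the sum capacity is
  used: scaling turns a small relative change of a positive capacity into a small change of
  \<open>f\<close>, and a capacity near zero is traded for a small increase of the positive one. At
  (0, 0) there is nothing to scale or to trade into, hence a converse. The obstacle there is that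
  even a facilitator of tiny rate correlates the two codewords, so an ordinary converse only yields
  the maximum over joint inputs. Wringing costs \<open>s * (a + b)\<close> in rate, where
  \<open>s\<close> depends only on tolerances that are fixed before the capacities tend to zero.
  Afterwards each position has its own product input, and one bound valid for all products serves
  every position.\<close>

definition kl_div :: "'y pmf \<Rightarrow> 'y pmf \<Rightarrow> real" where
  "kl_div p q = measure_pmf.expectation p (\<lambda>y. log 2 (pmf p y / pmf q y))"

definition channel_output :: "('x \<Rightarrow> 'y pmf) \<Rightarrow> nat \<Rightarrow> (nat \<Rightarrow> 'x) \<Rightarrow> (nat \<Rightarrow> 'y) pmf" where
  "channel_output V n u = Pi_pmf {1..n} undefined (\<lambda>t. V (u t))"

lemma finite_set_Pi_pmfI:
  assumes "finite A" "\<And>t. t \<in> A \<Longrightarrow> finite (set_pmf (p t))"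
  shows "finite (set_pmf (Pi_pmf A d p))"
  by (rule finite_subset[OF set_Pi_pmf_subset']) (use assms in auto)

lemma finite_set_Pi_pmf [simp]:
  fixes p :: "'i \<Rightarrow> 'y::finite pmf"
  shows "finite A \<Longrightarrow> finite (set_pmf (Pi_pmf A d p))"
  by (rule finite_set_Pi_pmfI) auto

lemma finite_set_channel_output [simp]:
  "finite (set_pmf (channel_output (V :: 'x \<Rightarrow> 'y::finite pmf) n u))"
  by (simp add: channel_output_def)

text \<open>
  This is the inequality \<open>E_p (ln r) + 1 - E_q r \<le> D(p, q)\<close> (in nats) for the test function \<open>r\<close> that is
  \<open>M\<close> on \<open>D\<close> and \<open>1\<close> elsewhere.
\<close>
lemma kl_div_event_bound:
  assumes fin: "finite (set_pmf p)" and ac: "set_pmf p \<subseteq> set_pmf q" and M: "M \<ge> (1::real)"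
  shows "measure_pmf.prob p D * log 2 M - M * measure_pmf.prob q D / ln 2 \<le> kl_div p q"
proof -
  let ?S = "set_pmf p"
  define r where "r y = (if y \<in> D then M else 1)" for y
  have r: "r y > 0" for y using M by (simp add: r_def)
  have kl: "kl_div p q = (\<Sum>y\<in>?S. pmf p y * log 2 (pmf p y / pmf q y))"
    unfolding kl_div_def by (subst integral_measure_pmf[OF fin]) auto
  have "pmf p y * ln (r y) - (pmf q y * r y - pmf p y) \<le> pmf p y * ln (pmf p y / pmf q y)"
    if "y \<in> ?S" for y
  proof -
    have p: "pmf p y > 0" using that by (simp add: pmf_positive)
    have q: "pmf q y > 0" using that ac by (auto simp: pmf_positive)
    have "ln (r y * pmf q y / pmf p y) \<le> r y * pmf q y / pmf p y - 1"
      using p q r[of y] by (intro ln_le_minus_one) simp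
    then have "pmf p y * ln (r y * pmf q y / pmf p y) \<le> pmf p y * (r y * pmf q y / pmf p y - 1)"
      using p by simp
    also have "\<dots> = pmf q y * r y - pmf p y" using p by (simp add: field_simps)
    finally show ?thesis using p q r[of y] by (simp add: ln_mult ln_div algebra_simps)
  qed
  then have "(\<Sum>y\<in>?S. pmf p y * ln (r y)) - ((\<Sum>y\<in>?S. pmf q y * r y) - (\<Sum>y\<in>?S. pmf p y))
      \<le> (\<Sum>y\<in>?S. pmf p y * ln (pmf p y / pmf q y))"
    by (simp add: sum_subtractf[symmetric] sum_mono)
  moreover have "(\<Sum>y\<in>?S. pmf p y * ln (r y)) = measure_pmf.prob p D * ln M"
  proof -
    have "(\<Sum>y\<in>?S. pmf p y * ln (r y)) = (\<Sum>y\<in>?S \<inter> D. pmf p y * ln M)"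
      using fin by (simp add: sum.inter_restrict) (auto simp: r_def intro!: sum.cong)
    also have "\<dots> = measure_pmf.prob p (?S \<inter> D) * ln M"
      using fin by (simp add: measure_measure_pmf_finite sum_distrib_right)
    also have "measure_pmf.prob p (?S \<inter> D) = measure_pmf.prob p D"
      by (metis Int_commute measure_Int_set_pmf)
    finally show ?thesis .
  qed
  moreover have "(\<Sum>y\<in>?S. pmf q y * r y) \<le> M * measure_pmf.prob q D + 1"
  proof -
    have "(\<Sum>y\<in>?S. pmf q y * r y) \<le> (\<Sum>y\<in>?S. pmf q y * (M * indicator D y) + pmf q y)"
      using M by (intro sum_mono) (auto simp: r_def indicator_def algebra_simps)
    also have "\<dots> = M * (\<Sum>y\<in>?S \<inter> D. pmf q y) + (\<Sum>y\<in>?S. pmf q y)"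
      using fin by (simp add: sum.distrib sum_distrib_left sum.inter_restrict)
        (auto simp: indicator_def intro!: sum.cong)
    also have "\<dots> \<le> M * measure_pmf.prob q D + 1"
      using fin M by (simp add: measure_measure_pmf_finite[symmetric] add_mono mult_left_mono
          measure_pmf.finite_measure_mono)
    finally show ?thesis .
  qed
  moreover have "(\<Sum>y\<in>?S. pmf p y) = 1"
    using fin by (simp add: sum_pmf_eq_1)
  moreover have "ln 2 * kl_div p q = (\<Sum>y\<in>?S. pmf p y * ln (pmf p y / pmf q y))"
    unfolding kl by (simp add: sum_distrib_left log_def)
  ultimately have "measure_pmf.prob p D * ln M - M * measure_pmf.prob q D \<le> ln 2 * kl_div p q"
    by linarith
  then show ?thesis by (simp add: log_def field_simps)
qed

text \<open>Relative entropy is additive over independent coordinates. Support inclusion makes every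
  factor of the likelihood ratio positive on the support of the first law; without it the total
  division in \<open>kl_div\<close> would give a finite value where the divergence is
  infinite.\<close>

lemma kl_div_Pi_pmf:
  fixes p q :: "'i \<Rightarrow> 'y::finite pmf"
  assumes fin: "finite A" and ac: "\<And>t. t \<in> A \<Longrightarrow> set_pmf (p t) \<subseteq> set_pmf (q t)"
  shows "kl_div (Pi_pmf A d p) (Pi_pmf A d q) = (\<Sum>t\<in>A. kl_div (p t) (q t))"
proof -
  let ?P = "Pi_pmf A d p"
  have "kl_div ?P (Pi_pmf A d q) =
      measure_pmf.expectation ?P (\<lambda>y. \<Sum>t\<in>A. log 2 (pmf (p t) (y t) / pmf (q t) (y t)))"
    unfolding kl_div_def
  proof (intro integral_cong_AE AE_pmfI)
    fix y assume "y \<in> set_pmf ?P"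
    then have y: "\<And>t. t \<notin> A \<Longrightarrow> y t = d" and s: "\<And>t. t \<in> A \<Longrightarrow> y t \<in> set_pmf (p t)"
      using fin by (auto simp: set_Pi_pmf PiE_dflt_def)
    have "pmf ?P y / pmf (Pi_pmf A d q) y = (\<Prod>t\<in>A. pmf (p t) (y t) / pmf (q t) (y t))"
      using fin y by (simp add: pmf_Pi' prod_dividef)
    moreover have "pmf (p t) (y t) / pmf (q t) (y t) > 0" if "t \<in> A" for t
      using s[OF that] ac[OF that] by (auto intro!: divide_pos_pos pmf_positive)
    note this[THEN less_imp_neq, THEN not_sym]
    then have "ln (\<Prod>t\<in>A. pmf (p t) (y t) / pmf (q t) (y t)) = (\<Sum>t\<in>A. ln (pmf (p t) (y t) / pmf (q t) (y t)))"
      by (intro ln_prod[OF fin])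
    ultimately show "log 2 (pmf ?P y / pmf (Pi_pmf A d q) y) =
        (\<Sum>t\<in>A. log 2 (pmf (p t) (y t) / pmf (q t) (y t)))"
      by (simp add: log_def sum_divide_distrib)
  qed auto
  also have "\<dots> = (\<Sum>t\<in>A. measure_pmf.expectation ?P (\<lambda>y. log 2 (pmf (p t) (y t) / pmf (q t) (y t))))"
    using fin by (intro Bochner_Integration.integral_sum integrable_measure_pmf_finite) simp
  also have "\<dots> = (\<Sum>t\<in>A. kl_div (p t) (q t))"
  proof (intro sum.cong refl)
    fix t assume t: "t \<in> A"
    have "map_pmf (\<lambda>y. y t) ?P = p t" using fin t by (simp add: Pi_pmf_component)
    then have "kl_div (p t) (q t) = measure_pmf.expectation (map_pmf (\<lambda>y. y t) ?P)
        (\<lambda>z. log 2 (pmf (p t) z / pmf (q t) z))"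
      by (simp only: kl_div_def)
    then show "measure_pmf.expectation ?P (\<lambda>y. log 2 (pmf (p t) (y t) / pmf (q t) (y t))) = kl_div (p t) (q t)"
      by (simp only: integral_map_pmf)
  qed
  finally show ?thesis .
qed

lemma set_Pi_pmf_mono:
  assumes "finite A" "\<And>t. t \<in> A \<Longrightarrow> set_pmf (p t) \<subseteq> set_pmf (q t)"
  shows "set_pmf (Pi_pmf A d p) \<subseteq> set_pmf (Pi_pmf A d q)"
  using assms by (auto simp: set_Pi_pmf PiE_dflt_def)

text \<open>A substitute for Fano's inequality: \<open>kl_div_event_bound\<close> is applied with
  \<open>M = card G\<close> to the event that \<open>i\<close> is decoded. The reference law is the
  same for all \<open>i\<close>, so the disjoint decoding events have total reference probability at
  most 1 and cost \<open>1 / ln 2\<close> per codeword on average. The choice of \<open>Q\<close> is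
  left open for the smoothed outputs of product inputs used later.\<close>

lemma converse_bound:
  fixes V :: "'x \<Rightarrow> 'y::finite pmf"
  assumes G: "finite G" "G \<noteq> {}"
    and err: "\<And>i. i \<in> G \<Longrightarrow> measure_pmf.prob (channel_output V n (u i)) {y. g y \<noteq> i} \<le> e"
    and ac: "\<And>i t. i \<in> G \<Longrightarrow> t \<in> {1..n} \<Longrightarrow> set_pmf (V (u i t)) \<subseteq> set_pmf (Q t)"
  shows "card G * ((1 - e) * log 2 (card G) - 1 / ln 2)
    \<le> (\<Sum>i\<in>G. \<Sum>t=1..n. kl_div (V (u i t)) (Q t))"
proof -
  let ?M = "real (card G)" and ?q = "Pi_pmf {1..n} undefined Q"
  have M: "?M \<ge> 1" using G by (simp add: Suc_leI card_gt_0_iff)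
  have "(1 - e) * log 2 ?M - ?M * measure_pmf.prob ?q {y. g y = i} / ln 2
      \<le> (\<Sum>t=1..n. kl_div (V (u i t)) (Q t))" if i: "i \<in> G" for i
  proof -
    let ?p = "channel_output V n (u i)"
    have "measure_pmf.prob ?p {y. g y = i} = 1 - measure_pmf.prob ?p {y. g y \<noteq> i}"
      by (subst measure_pmf.prob_compl[symmetric]) (auto intro!: arg_cong[where f = "measure_pmf.prob ?p"])
    then have "1 - e \<le> measure_pmf.prob ?p {y. g y = i}" using err[OF i] by simp
    then have "(1 - e) * log 2 ?M \<le> measure_pmf.prob ?p {y. g y = i} * log 2 ?M"
      using M by (intro mult_right_mono) auto
    moreover have "set_pmf ?p \<subseteq> set_pmf ?q"
      unfolding channel_output_def using ac[OF i] by (intro set_Pi_pmf_mono) auto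
    from kl_div_event_bound[OF _ this M, of "{y. g y = i}"]
    have "measure_pmf.prob ?p {y. g y = i} * log 2 ?M - ?M * measure_pmf.prob ?q {y. g y = i} / ln 2
      \<le> kl_div ?p ?q" by simp
    moreover have "kl_div ?p ?q = (\<Sum>t=1..n. kl_div (V (u i t)) (Q t))"
      unfolding channel_output_def using ac[OF i] by (intro kl_div_Pi_pmf) auto
    ultimately show ?thesis by linarith
  qed
  then have "(\<Sum>i\<in>G. (1 - e) * log 2 ?M - ?M * measure_pmf.prob ?q {y. g y = i} / ln 2)
      \<le> (\<Sum>i\<in>G. \<Sum>t=1..n. kl_div (V (u i t)) (Q t))"
    by (rule sum_mono)
  moreover have "(\<Sum>i\<in>G. measure_pmf.prob ?q {y. g y = i}) \<le> 1"
  proof -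
    have "(\<Sum>i\<in>G. measure_pmf.prob ?q {y. g y = i}) = measure_pmf.prob ?q (\<Union>i\<in>G. {y. g y = i})"
      using G by (intro measure_pmf.finite_measure_finite_Union[symmetric]) (auto simp: disjoint_family_on_def)
    then show ?thesis by simp
  qed
  then have "?M * (\<Sum>i\<in>G. measure_pmf.prob ?q {y. g y = i}) / ln 2 \<le> ?M / ln 2"
    by (intro divide_right_mono mult_left_le) auto
  moreover have "(\<Sum>i\<in>G. (1 - e) * log 2 ?M - ?M * measure_pmf.prob ?q {y. g y = i} / ln 2)
    = ?M * ((1 - e) * log 2 ?M) - ?M * (\<Sum>i\<in>G. measure_pmf.prob ?q {y. g y = i}) / ln 2"
    by (simp add: sum_subtractf sum_distrib_left sum_divide_distrib)
  ultimately show ?thesis by (simp add: algebra_simps)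
qed

section \<open>Codes for a fully informed facilitator\<close>

definition pair_output ::
  "('a \<Rightarrow> 'b \<Rightarrow> 'c pmf) \<Rightarrow> nat \<Rightarrow> (nat \<Rightarrow> 'a) \<Rightarrow> (nat \<Rightarrow> 'b) \<Rightarrow> (nat \<Rightarrow> 'c) pmf" where
  "pair_output W n u v = Pi_pmf {1..n} undefined (\<lambda>t. W (u t) (v t))"

text \<open>
  The links out of the facilitator are eliminated: that encoder 1 sees \<open>w1\<close> and one of \<open>k1\<close> values
  means that its codeword, as a function of both messages, takes at most \<open>k1\<close> values for fixed \<open>w1\<close>.
\<close>
definition coop_code ::
  "('a \<Rightarrow> 'b \<Rightarrow> 'c pmf) \<Rightarrow> nat \<Rightarrow> 'm set \<Rightarrow> 'k set \<Rightarrow> nat \<Rightarrow> nat \<Rightarrow> real \<Rightarrow> bool" where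
  "coop_code W n M1 M2 k1 k2 e \<longleftrightarrow> finite M1 \<and> finite M2 \<and>
    (\<exists>x1 x2 g. (\<forall>w1\<in>M1. card ((\<lambda>w2. x1 w1 w2) ` M2) \<le> k1) \<and>
               (\<forall>w2\<in>M2. card ((\<lambda>w1. x2 w1 w2) ` M1) \<le> k2) \<and>
       (\<Sum>w1\<in>M1. \<Sum>w2\<in>M2. measure_pmf.prob (pair_output W n (x1 w1 w2) (x2 w1 w2)) {y. g y \<noteq> (w1, w2)})
         \<le> e * card M1 * card M2)"

section \<open>Elementary operations on cooperative codes\<close>

lemma pair_output_cong:
  assumes "\<And>t. t \<in> {1..n} \<Longrightarrow> u t = u' t" "\<And>t. t \<in> {1..n} \<Longrightarrow> v t = v' t"
  shows "pair_output W n u v = pair_output W n u' v'"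
  unfolding pair_output_def using assms by (intro Pi_pmf_cong) auto

text \<open>Deleting an element where \<open>h\<close> is largest cannot raise the average, so
  elements are deleted until \<open>N\<close> are left.\<close>

lemma subset_below_average:
  fixes h :: "'m \<Rightarrow> real"
  assumes "finite A" "N \<le> card A"
  obtains B where "B \<subseteq> A" "card B = N" "sum h B * card A \<le> N * sum h A"
proof -
  have "\<exists>B\<subseteq>A. card B = N \<and> sum h B * card A \<le> N * sum h A"
    using assms
  proof (induction "card A" arbitrary: A)
    case 0
    then show ?case by (intro exI[of _ A]) auto
  next
    case (Suc c)
    show ?case
    proof (cases "N = Suc c")
      case True
      then show ?thesis using Suc by (intro exI[of _ A]) auto
    next
      case False
      have ne: "A \<noteq> {}" using Suc by auto
      have "Max (h ` A) \<in> h ` A" using Suc.prems ne by (intro Max_in) auto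
      then obtain a where a: "a \<in> A" and "h a = Max (h ` A)" by auto
      then have amax: "\<And>x. x \<in> A \<Longrightarrow> h x \<le> h a" using Suc.prems by simp
      have cA': "c = card (A - {a})" using Suc a by simp
      obtain B where B: "B \<subseteq> A - {a}" "card B = N" "sum h B * c \<le> N * sum h (A - {a})"
        using Suc.hyps(1)[OF cA'] Suc.prems Suc.hyps(2) False cA' by auto
      have rem: "sum h (A - {a}) = sum h A - h a" using Suc a by (simp add: sum_diff1)
      show ?thesis
      proof (cases "c = 0")
        case True
        then have "N = 0" using False Suc by simp
        then show ?thesis by (intro exI[of _ "{}"]) auto
      next
        case c: False
        have "sum h A \<le> (\<Sum>x\<in>A. h a)" using amax by (intro sum_mono) auto
        then have "sum h (A - {a}) * Suc c \<le> c * sum h A"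
          using Suc.hyps(2)[symmetric] unfolding rem by (simp add: algebra_simps)
        then have "real N * (sum h (A - {a}) * Suc c) \<le> N * (c * sum h A)"
          by (intro mult_left_mono) auto
        moreover have "(sum h B * c) * Suc c \<le> (N * sum h (A - {a})) * Suc c"
          using B by (intro mult_right_mono) auto
        moreover have "(sum h B * c) * Suc c = (sum h B * Suc c) * c"
          "(N * sum h (A - {a})) * Suc c = real N * (sum h (A - {a}) * Suc c)"
          "real N * (c * sum h A) = (N * sum h A) * c" by (simp_all only: ac_simps)
        ultimately have "(sum h B * Suc c) * c \<le> (N * sum h A) * c" by linarith
        then have "sum h B * Suc c \<le> N * sum h A"
          using c by (meson mult_right_le_imp_le of_nat_0_less_iff not_gr_zero)
        then show ?thesis using B Suc.hyps(2) by (intro exI[of _ B]) auto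
      qed
    qed
  qed
  then show ?thesis using that by auto
qed

text \<open>The average error survives because the kept messages are selected: a below-average
  subset of \<open>M1\<close> for the error summed over \<open>M2\<close>, then a below-average
  subset of \<open>M2\<close> for the error summed over the kept part of \<open>M1\<close>.
  Bijections rename the survivors, so the new message sets may have any type.\<close>

lemma coop_code_shrink:
  fixes N1 :: "'p set" and N2 :: "'q set"
  assumes c: "coop_code W n M1 M2 k1 k2 e"
    and N: "finite N1" "finite N2" "card N1 \<le> card M1" "card N2 \<le> card M2"
    and k: "k1 \<le> k1'" "k2 \<le> k2'"
  shows "coop_code W n N1 N2 k1' k2' e"
proof -
  from c obtain x1 x2 g where fin: "finite M1" "finite M2"
    and x1: "\<forall>w1\<in>M1. card ((\<lambda>w2. x1 w1 w2) ` M2) \<le> k1"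
    and x2: "\<forall>w2\<in>M2. card ((\<lambda>w1. x2 w1 w2) ` M1) \<le> k2"
    and s: "(\<Sum>w1\<in>M1. \<Sum>w2\<in>M2. measure_pmf.prob (pair_output W n (x1 w1 w2) (x2 w1 w2)) {y. g y \<noteq> (w1, w2)})
         \<le> e * card M1 * card M2" unfolding coop_code_def by blast
  define E where "E w1 w2 = measure_pmf.prob (pair_output W n (x1 w1 w2) (x2 w1 w2)) {y. g y \<noteq> (w1, w2)}" for w1 w2
  obtain B1 where B1: "B1 \<subseteq> M1" "card B1 = card N1"
      "(\<Sum>w1\<in>B1. \<Sum>w2\<in>M2. E w1 w2) * card M1 \<le> card N1 * (\<Sum>w1\<in>M1. \<Sum>w2\<in>M2. E w1 w2)"
    using subset_below_average[OF fin(1) N(3)] .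
  obtain B2 where B2: "B2 \<subseteq> M2" "card B2 = card N2"
      "(\<Sum>w2\<in>B2. \<Sum>w1\<in>B1. E w1 w2) * card M2 \<le> card N2 * (\<Sum>w2\<in>M2. \<Sum>w1\<in>B1. E w1 w2)"
    using subset_below_average[OF fin(2) N(4)] .
  have finB: "finite B1" "finite B2" using B1 B2 fin finite_subset by auto
  have tot: "(\<Sum>w1\<in>B1. \<Sum>w2\<in>B2. E w1 w2) \<le> e * card N1 * card N2"
  proof (cases "card N1 = 0 \<or> card N2 = 0")
    case True
    then have "B1 = {} \<or> B2 = {}" using B1 B2 finB by auto
    then show ?thesis using True by auto
  next
    case False
    then have pos: "real (card M1) > 0" "real (card M2) > 0" using N by auto
    have "(\<Sum>w1\<in>B1. \<Sum>w2\<in>M2. E w1 w2) * card M1 \<le> card N1 * (e * card M1 * card M2)"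
      by (rule order_trans[OF B1(3)]) (use s in \<open>simp add: E_def mult_left_mono\<close>)
    then have "(\<Sum>w1\<in>B1. \<Sum>w2\<in>M2. E w1 w2) * card M1 \<le> (card N1 * (e * card M2)) * card M1"
      by (simp add: ac_simps)
    then have 1: "(\<Sum>w1\<in>B1. \<Sum>w2\<in>M2. E w1 w2) \<le> card N1 * (e * card M2)"
      using pos by simp
    have "(\<Sum>w2\<in>M2. \<Sum>w1\<in>B1. E w1 w2) \<le> card N1 * (e * card M2)"
      using 1 by (subst sum.swap) simp
    then have "(\<Sum>w2\<in>B2. \<Sum>w1\<in>B1. E w1 w2) * card M2 \<le> card N2 * (card N1 * (e * card M2))"
      by (intro order_trans[OF B2(3)] mult_left_mono) auto
    then have "(\<Sum>w2\<in>B2. \<Sum>w1\<in>B1. E w1 w2) * card M2 \<le> (card N2 * (card N1 * e)) * card M2"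
      by (simp add: ac_simps)
    then have "(\<Sum>w2\<in>B2. \<Sum>w1\<in>B1. E w1 w2) \<le> card N2 * (card N1 * e)" using pos by simp
    then show ?thesis by (subst sum.swap) (simp add: ac_simps)
  qed
  obtain h1 where h1: "bij_betw h1 N1 B1" using B1(2) N(1) finB(1) finite_same_card_bij by metis
  obtain h2 where h2: "bij_betw h2 N2 B2" using B2(2) N(2) finB(2) finite_same_card_bij by metis
  define g' where "g' y = (inv_into N1 h1 (fst (g y)), inv_into N2 h2 (snd (g y)))" for y
  have mem: "h1 w \<in> M1" if "w \<in> N1" for w using that h1 B1 by (auto dest: bij_betwE)
  have mem2: "h2 w \<in> M2" if "w \<in> N2" for w using that h2 B2 by (auto dest: bij_betwE)
  show ?thesis unfolding coop_code_def
  proof (intro conjI exI[of _ "\<lambda>w1 w2. x1 (h1 w1) (h2 w2)"] exI[of _ "\<lambda>w1 w2. x2 (h1 w1) (h2 w2)"] exI[of _ g'] ballI)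
    fix w1 assume w: "w1 \<in> N1"
    have "card ((\<lambda>w2. x1 (h1 w1) (h2 w2)) ` N2) \<le> card (x1 (h1 w1) ` M2)"
      using mem2 fin by (intro card_mono) auto
    then show "card ((\<lambda>w2. x1 (h1 w1) (h2 w2)) ` N2) \<le> k1'" using x1 mem[OF w] k by fastforce
  next
    fix w2 assume w: "w2 \<in> N2"
    have "card ((\<lambda>w1. x2 (h1 w1) (h2 w2)) ` N1) \<le> card ((\<lambda>w1. x2 w1 (h2 w2)) ` M1)"
      using mem fin by (intro card_mono) auto
    then show "card ((\<lambda>w1. x2 (h1 w1) (h2 w2)) ` N1) \<le> k2'" using x2 mem2[OF w] k by fastforce
  next
    have "(\<Sum>w1\<in>N1. \<Sum>w2\<in>N2. measure_pmf.prob (pair_output W n (x1 (h1 w1) (h2 w2)) (x2 (h1 w1) (h2 w2))) {y. g' y \<noteq> (w1, w2)})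
      \<le> (\<Sum>w1\<in>N1. \<Sum>w2\<in>N2. E (h1 w1) (h2 w2))"
    proof (intro sum_mono)
      fix w1 w2 assume w: "w1 \<in> N1" "w2 \<in> N2"
      have "{y. g' y \<noteq> (w1, w2)} \<subseteq> {y. g y \<noteq> (h1 w1, h2 w2)}"
        using w h1 h2 by (auto simp: g'_def bij_betw_def)
      then show "measure_pmf.prob (pair_output W n (x1 (h1 w1) (h2 w2)) (x2 (h1 w1) (h2 w2))) {y. g' y \<noteq> (w1, w2)} \<le> E (h1 w1) (h2 w2)"
        unfolding E_def by (intro measure_pmf.finite_measure_mono) auto
    qed
    also have "\<dots> = (\<Sum>w1\<in>B1. \<Sum>w2\<in>B2. E w1 w2)"
      by (subst sum.reindex_bij_betw[OF h2, symmetric]) (rule sum.reindex_bij_betw[OF h1])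
    also note tot
    finally show "(\<Sum>w1\<in>N1. \<Sum>w2\<in>N2. measure_pmf.prob (pair_output W n (x1 (h1 w1) (h2 w2)) (x2 (h1 w1) (h2 w2))) {y. g' y \<noteq> (w1, w2)})
      \<le> e * card N1 * card N2" .
  qed (use N in auto)
qed

lemma coop_code_swap:
  assumes "coop_code W n M1 M2 k1 k2 e"
  shows "coop_code (\<lambda>b a. W a b) n M2 M1 k2 k1 e"
proof -
  from assms obtain x1 x2 g where fin: "finite M1" "finite M2"
    and x1: "\<forall>w1\<in>M1. card ((\<lambda>w2. x1 w1 w2) ` M2) \<le> k1"
    and x2: "\<forall>w2\<in>M2. card ((\<lambda>w1. x2 w1 w2) ` M1) \<le> k2"
    and s: "(\<Sum>w1\<in>M1. \<Sum>w2\<in>M2. measure_pmf.prob (pair_output W n (x1 w1 w2) (x2 w1 w2)) {y. g y \<noteq> (w1, w2)})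
         \<le> e * card M1 * card M2" unfolding coop_code_def by blast
  have eq: "prod.swap (g y) \<noteq> (w2, w1) \<longleftrightarrow> g y \<noteq> (w1, w2)" for y w1 w2 by (cases "g y") auto
  let ?E = "\<lambda>w1 w2. measure_pmf.prob (pair_output (\<lambda>b a. W a b) n (x2 w1 w2) (x1 w1 w2)) {y. prod.swap (g y) \<noteq> (w2, w1)}"
  have "(\<Sum>w2\<in>M2. \<Sum>w1\<in>M1. ?E w1 w2) = (\<Sum>w1\<in>M1. \<Sum>w2\<in>M2. measure_pmf.prob (pair_output W n (x1 w1 w2) (x2 w1 w2)) {y. g y \<noteq> (w1, w2)})"
    unfolding eq pair_output_def by (rule sum.swap)
  also have "\<dots> \<le> e * card M2 * card M1" using s by (simp only: mult.assoc mult.commute[of "real (card M1)"])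
  finally show ?thesis unfolding coop_code_def using fin x1 x2
    by (intro conjI exI[of _ "\<lambda>w2 w1. x2 w1 w2"] exI[of _ "\<lambda>w2 w1. x1 w1 w2"] exI[of _ "\<lambda>y. prod.swap (g y)"])
qed

text \<open>The additional channel uses are idle: the decoder forgets them, and forgetting
  coordinates of a product law leaves the product over the others.\<close>

lemma coop_code_pad:
  fixes W :: "'a \<Rightarrow> 'b \<Rightarrow> 'c::finite pmf"
  assumes "coop_code W m M1 M2 k1 k2 e" "m \<le> n"
  shows "coop_code W n M1 M2 k1 k2 e"
proof -
  from assms obtain x1 x2 g where fin: "finite M1" "finite M2"
    and x1: "\<forall>w1\<in>M1. card ((\<lambda>w2. x1 w1 w2) ` M2) \<le> k1"
    and x2: "\<forall>w2\<in>M2. card ((\<lambda>w1. x2 w1 w2) ` M1) \<le> k2"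
    and s: "(\<Sum>w1\<in>M1. \<Sum>w2\<in>M2. measure_pmf.prob (pair_output W m (x1 w1 w2) (x2 w1 w2)) {y. g y \<noteq> (w1, w2)})
         \<le> e * card M1 * card M2" unfolding coop_code_def by blast
  define cut where "cut y = (\<lambda>t. if t \<in> {1..m} then y t else (undefined :: 'c))" for y
  have "pair_output W m u v = map_pmf cut (pair_output W n u v)" for u v
    unfolding pair_output_def cut_def using assms(2) by (intro Pi_pmf_subset) auto
  then have "measure_pmf.prob (pair_output W n u v) {y. g (cut y) \<noteq> w} = measure_pmf.prob (pair_output W m u v) {y. g y \<noteq> w}" for u v w
    by (simp add: vimage_def)
  then show ?thesis unfolding coop_code_def
    using fin x1 x2 s by (intro conjI exI[of _ x1] exI[of _ x2] exI[of _ "\<lambda>y. g (cut y)"]) auto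
qed

lemma coop_code_error_mono:
  assumes "coop_code W n M1 M2 k1 k2 e" "e \<le> e'"
  shows "coop_code W n M1 M2 k1 k2 e'"
proof -
  have "e * real (card M1) * real (card M2) \<le> e' * real (card M1) * real (card M2)"
    using assms by (intro mult_right_mono) auto
  then show ?thesis using assms(1) unfolding coop_code_def by (meson order_trans)
qed

lemma coop_codeI:
  fixes e :: real
  assumes "finite M1" "finite M2"
    and "\<And>w1. w1 \<in> M1 \<Longrightarrow> card ((\<lambda>w2. x1 w1 w2) ` M2) \<le> k1"
    and "\<And>w2. w2 \<in> M2 \<Longrightarrow> card ((\<lambda>w1. x2 w1 w2) ` M1) \<le> k2"
    and "(\<Sum>w1\<in>M1. \<Sum>w2\<in>M2. measure_pmf.prob (pair_output W n (x1 w1 w2) (x2 w1 w2)) {y. g y \<noteq> (w1, w2)})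
         \<le> e * card M1 * card M2"
  shows "coop_code W n M1 M2 k1 k2 e"
  unfolding coop_code_def
  by (intro conjI assms(1,2), rule exI[of _ x1], rule exI[of _ x2], rule exI[of _ g])
    (intro conjI ballI assms(3-5))

text \<open>Supplies a legal code at the lengths where achievability promises nothing, so that a
  code exists for every \<open>n \<ge> 1\<close>.\<close>

lemma coop_code_trivial:
  assumes "finite M1" "finite M2" "k1 \<ge> 1" "k2 \<ge> 1"
  shows "coop_code W n M1 M2 k1 k2 1"
proof (rule coop_codeI[where g = "\<lambda>_. undefined"])
  have c: "card ((\<lambda>_. u) ` A) \<le> 1" for A :: "'y set" and u :: 'z
    using card_mono[of "{u}" "(\<lambda>_. u) ` A"] by auto
  show "card ((\<lambda>w2. undefined) ` M2) \<le> k1" "card ((\<lambda>w1. undefined) ` M1) \<le> k2"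
    by (rule order_trans[OF c assms(3)], rule order_trans[OF c assms(4)])
  have "(\<Sum>w1\<in>M1. \<Sum>w2\<in>M2. measure_pmf.prob (pair_output W n undefined undefined) {y. undefined \<noteq> (w1, w2)}) \<le> (\<Sum>w1\<in>M1. \<Sum>w2\<in>M2. 1)"
    by (intro sum_mono) auto
  then show "(\<Sum>w1\<in>M1. \<Sum>w2\<in>M2. measure_pmf.prob (pair_output W n undefined undefined) {y. undefined \<noteq> (w1, w2)}) \<le> 1 * real (card M1) * real (card M2)"
    by simp
qed fact+

text \<open>Every tolerance \<open>e\<close> may use its own codes;
  \<open>near_minimal_choice\<close> later merges them into one sequence. No input capacity appears
  because codewords are arbitrary functions of both messages, limited only by the number of values
  per message.\<close>

definition achievable_informed ::
  "('a \<Rightarrow> 'b \<Rightarrow> 'c pmf) \<Rightarrow> real \<times> real \<Rightarrow> real \<times> real \<Rightarrow> bool" where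
  "achievable_informed W C R \<longleftrightarrow> 0 \<le> fst R \<and> 0 \<le> snd R \<and> (\<forall>e>0. \<forall>\<^sub>F n in sequentially.
     coop_code W n (index_set (2 powr (real n * fst R))) (index_set (2 powr (real n * snd R)))
       (nat \<lfloor>2 powr (real n * fst C)\<rfloor>) (nat \<lfloor>2 powr (real n * snd C)\<rfloor>) e)"

lemma finite_index_set [simp]: "finite (index_set x)"
  and card_index_set [simp]: "card (index_set x) = nat \<lfloor>x\<rfloor>"
  by (simp_all add: index_set_def)

lemma two_powr_ge_1: "0 \<le> r \<Longrightarrow> 1 \<le> 2 powr (real n * r)"
  by (intro ge_one_powr_ge_zero) auto

lemma two_powr_minus:
  "2 powr (- (real n * (r + s))) = 1 / (2 powr (real n * r) * 2 powr (real n * s))"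
  by (simp only: distrib_left powr_add powr_minus inverse_eq_divide)

lemma nat_floor_le: "0 \<le> (x::real) \<Longrightarrow> real (nat \<lfloor>x\<rfloor>) \<le> x" by simp

text \<open>The average error of a facilitator code is normalised by powers of two, that of
  \<open>coop_code\<close> by the actual number of messages; the normalisations differ by at most
  this factor for each encoder.\<close>

lemma nat_floor_ge_half:
  assumes "1 \<le> (x::real)"
  shows "x \<le> 2 * real (nat \<lfloor>x\<rfloor>)"
proof -
  have "1 \<le> real_of_int \<lfloor>x\<rfloor>" using assms by simp
  moreover have "x < real_of_int \<lfloor>x\<rfloor> + 1" by linarith
  moreover have "real (nat \<lfloor>x\<rfloor>) = real_of_int \<lfloor>x\<rfloor>" using assms by simp
  ultimately show ?thesis by linarith
qed

lemma nat_floor_ge_1: "1 \<le> (x::real) \<Longrightarrow> 1 \<le> nat \<lfloor>x\<rfloor>"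
  by linarith

lemma achievable_informedI:
  assumes "0 \<le> R1" "0 \<le> R2"
    and "\<And>e. 0 < e \<Longrightarrow> \<forall>\<^sub>F n in sequentially. \<exists>m1 m2 k1 k2.
       coop_code W n {..<m1::nat} {..<m2::nat} k1 k2 e \<and>
       nat \<lfloor>2 powr (real n * R1)\<rfloor> \<le> m1 \<and> nat \<lfloor>2 powr (real n * R2)\<rfloor> \<le> m2 \<and>
       k1 \<le> nat \<lfloor>2 powr (real n * a)\<rfloor> \<and> k2 \<le> nat \<lfloor>2 powr (real n * b)\<rfloor>"
  shows "achievable_informed W (a, b) (R1, R2)"
  unfolding achievable_informed_def
proof (intro conjI allI impI)
  fix e :: real assume "e > 0"
  from assms(3)[OF this]
  show "\<forall>\<^sub>F n in sequentially. coop_code W n (index_set (2 powr (real n * fst (R1, R2)))) (index_set (2 powr (real n * snd (R1, R2))))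
       (nat \<lfloor>2 powr (real n * fst (a, b))\<rfloor>) (nat \<lfloor>2 powr (real n * snd (a, b))\<rfloor>) e"
    by eventually_elim (auto intro: coop_code_shrink)
qed (use assms in auto)

lemma achievable_informedD:
  assumes "achievable_informed W (a, b) (R1, R2)" "0 < e"
  shows "\<forall>\<^sub>F n in sequentially.
     coop_code W n {..<nat \<lfloor>2 powr (real n * R1)\<rfloor>} {..<nat \<lfloor>2 powr (real n * R2)\<rfloor>}
       (nat \<lfloor>2 powr (real n * a)\<rfloor>) (nat \<lfloor>2 powr (real n * b)\<rfloor>) e"
proof -
  have "\<forall>\<^sub>F n in sequentially.
     coop_code W n (index_set (2 powr (real n * R1))) (index_set (2 powr (real n * R2)))
       (nat \<lfloor>2 powr (real n * a)\<rfloor>) (nat \<lfloor>2 powr (real n * b)\<rfloor>) e"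
    using assms unfolding achievable_informed_def by auto
  then show ?thesis by eventually_elim (auto intro: coop_code_shrink)
qed

lemma achievable_informed_nonneg: "achievable_informed W C (R1, R2) \<Longrightarrow> 0 \<le> R1 \<and> 0 \<le> R2"
  by (simp add: achievable_informed_def)

lemma achievable_informed_mono:
  assumes "achievable_informed W (a, b) R" "a \<le> a'" "b \<le> b'"
  shows "achievable_informed W (a', b') R"
proof -
  have *: "nat \<lfloor>2 powr (real n * x)\<rfloor> \<le> nat \<lfloor>2 powr (real n * y)\<rfloor>" if "x \<le> y" for n x y
    using that by (intro nat_mono floor_mono powr_mono mult_left_mono) auto
  obtain R1 R2 where R: "R = (R1, R2)" by (cases R)
  show ?thesis unfolding R
  proof (rule achievable_informedI)
    fix e :: real assume "e > 0"
    from achievable_informedD[OF assms(1)[unfolded R] this]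
    show "\<forall>\<^sub>F n in sequentially. \<exists>m1 m2 k1 k2.
       coop_code W n {..<m1::nat} {..<m2::nat} k1 k2 e \<and>
       nat \<lfloor>2 powr (real n * R1)\<rfloor> \<le> m1 \<and> nat \<lfloor>2 powr (real n * R2)\<rfloor> \<le> m2 \<and>
       k1 \<le> nat \<lfloor>2 powr (real n * a')\<rfloor> \<and> k2 \<le> nat \<lfloor>2 powr (real n * b')\<rfloor>"
      by eventually_elim (use *[OF assms(2)] *[OF assms(3)] in blast)
  qed (use assms R in \<open>auto simp: achievable_informed_def\<close>)
qed

lemma achievable_informed_swap:
  assumes "achievable_informed W (a, b) (R1, R2)"
  shows "achievable_informed (\<lambda>y x. W x y) (b, a) (R2, R1)"
proof (rule achievable_informedI)
  fix e :: real assume "e > 0"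
  from achievable_informedD[OF assms this]
  show "\<forall>\<^sub>F n in sequentially. \<exists>m1 m2 k1 k2.
       coop_code (\<lambda>y x. W x y) n {..<m1::nat} {..<m2::nat} k1 k2 e \<and>
       nat \<lfloor>2 powr (real n * R2)\<rfloor> \<le> m1 \<and> nat \<lfloor>2 powr (real n * R1)\<rfloor> \<le> m2 \<and>
       k1 \<le> nat \<lfloor>2 powr (real n * b)\<rfloor> \<and> k2 \<le> nat \<lfloor>2 powr (real n * a)\<rfloor>"
    by eventually_elim (blast intro: coop_code_swap)
qed (use assms in \<open>auto simp: achievable_informed_def\<close>)

section \<open>From facilitator codes to cooperative codes and back\<close>

lemma sum_memoryless:
  fixes W :: "'a \<Rightarrow> 'b \<Rightarrow> 'c::finite pmf"
  shows "(\<Sum>y\<in>{y \<in> seqs n. P y}. memoryless W n u v y) = measure_pmf.prob (pair_output W n u v) {y. P y}"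
proof -
  have fin: "finite (seqs n :: (nat \<Rightarrow> 'c) set)" unfolding seqs_def by (intro finite_PiE) auto
  have sub: "set_pmf (pair_output W n u v) \<subseteq> seqs n"
    unfolding pair_output_def seqs_def by (auto dest!: set_Pi_pmf_subset[THEN subsetD, rotated] simp: PiE_def extensional_def)
  have "(\<Sum>y\<in>{y \<in> seqs n. P y}. memoryless W n u v y) = (\<Sum>y\<in>{y \<in> seqs n. P y}. pmf (pair_output W n u v) y)"
    unfolding memoryless_def pair_output_def seqs_def
    by (intro sum.cong refl pmf_Pi'[symmetric]) (auto simp: PiE_def extensional_def)
  also have "\<dots> = measure_pmf.prob (pair_output W n u v) {y \<in> seqs n. P y}"
    using fin by (simp add: measure_measure_pmf_finite)
  also have "\<dots> = measure_pmf.prob (pair_output W n u v) {y. P y}"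
    using sub by (intro measure_prob_cong_0) (auto simp: set_pmf_iff)
  finally show ?thesis .
qed

lemma avg_error_prob_nonneg:
  fixes W :: "'a \<Rightarrow> 'b \<Rightarrow> 'c::finite pmf"
  shows "0 \<le> avg_error_prob W R n c"
  unfolding avg_error_prob_def error_prob_def Let_def sum_memoryless by (simp add: sum_nonneg)

text \<open>For fixed \<open>w1\<close> the first codeword is determined by the value on the output
  link, which bounds the number of codewords. The 4 is a factor 2 for each of the two floors in the
  message counts.\<close>

lemma cf_code_imp_coop_code:
  fixes W :: "'a \<Rightarrow> 'b \<Rightarrow> 'c::finite pmf"
  assumes c: "is_cf_code Cin C R n c" and R: "0 \<le> fst R" "0 \<le> snd R"
  shows "coop_code W n (index_set (2 powr (real n * fst R))) (index_set (2 powr (real n * snd R)))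
       (nat \<lfloor>2 powr (real n * fst C)\<rfloor>) (nat \<lfloor>2 powr (real n * snd C)\<rfloor>) (4 * avg_error_prob W R n c)"
proof -
  let ?M1 = "index_set (2 powr (real n * fst R))" and ?M2 = "index_set (2 powr (real n * snd R))"
  let ?O1 = "index_set (2 powr (real n * fst C))" and ?O2 = "index_set (2 powr (real n * snd C))"
  define z1 where "z1 w1 w2 = cf_out1 c (cf_in1 c w1, cf_in2 c w2)" for w1 w2
  define z2 where "z2 w1 w2 = cf_out2 c (cf_in1 c w1, cf_in2 c w2)" for w1 w2
  have z1: "z1 w1 w2 \<in> ?O1" and z2: "z2 w1 w2 \<in> ?O2" if "w1 \<in> ?M1" "w2 \<in> ?M2" for w1 w2
    using c that unfolding is_cf_code_def Let_def z1_def z2_def by blast+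
  show ?thesis
  proof (rule coop_codeI[where ?x1.0 = "\<lambda>w1 w2. enc1 c (w1, z1 w1 w2)" and ?x2.0 = "\<lambda>w1 w2. enc2 c (w2, z2 w1 w2)" and g = "dec c"])
    fix w1 assume w: "w1 \<in> ?M1"
    have "card ((\<lambda>w2. enc1 c (w1, z1 w1 w2)) ` ?M2) \<le> card ((\<lambda>z. enc1 c (w1, z)) ` ?O1)"
      using z1[OF w] by (intro card_mono) auto
    also have "\<dots> \<le> card ?O1" by (rule card_image_le) simp
    finally show "card ((\<lambda>w2. enc1 c (w1, z1 w1 w2)) ` ?M2) \<le> nat \<lfloor>2 powr (real n * fst C)\<rfloor>" by simp
  next
    fix w2 assume w: "w2 \<in> ?M2"
    have "card ((\<lambda>w1. enc2 c (w2, z2 w1 w2)) ` ?M1) \<le> card ((\<lambda>z. enc2 c (w2, z)) ` ?O2)"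
      using z2[OF _ w] by (intro card_mono) auto
    also have "\<dots> \<le> card ?O2" by (rule card_image_le) simp
    finally show "card ((\<lambda>w1. enc2 c (w2, z2 w1 w2)) ` ?M1) \<le> nat \<lfloor>2 powr (real n * snd C)\<rfloor>" by simp
  next
    let ?S = "(\<Sum>w1\<in>?M1. \<Sum>w2\<in>?M2. measure_pmf.prob (pair_output W n (enc1 c (w1, z1 w1 w2)) (enc2 c (w2, z2 w1 w2))) {y. dec c y \<noteq> (w1, w2)})"
    have "avg_error_prob W R n c = 2 powr (- (real n * (fst R + snd R))) * ?S"
      unfolding avg_error_prob_def error_prob_def Let_def sum_memoryless z1_def z2_def ..
    then have "?S = avg_error_prob W R n c * (2 powr (real n * fst R) * 2 powr (real n * snd R))"
      by (simp only: two_powr_minus) (simp add: field_simps)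
    also have "\<dots> \<le> avg_error_prob W R n c * ((2 * real (card ?M1)) * (2 * real (card ?M2)))"
      unfolding card_index_set using R
      by (intro mult_left_mono mult_mono nat_floor_ge_half two_powr_ge_1 avg_error_prob_nonneg) auto
    finally show "?S \<le> 4 * avg_error_prob W R n c * real (card ?M1) * real (card ?M2)"
      by (simp add: ac_simps)
  qed auto
qed

lemma achievable_avg_imp_achievable_informed:
  fixes W :: "'a \<Rightarrow> 'b \<Rightarrow> 'c::finite pmf"
  assumes "achievable_avg W Cin C R"
  shows "achievable_informed W C R"
proof -
  from assms obtain c where R: "0 \<le> fst R" "0 \<le> snd R" and c: "\<And>n. n \<ge> 1 \<Longrightarrow> is_cf_code Cin C R n (c n)"
    and lim: "(\<lambda>n. avg_error_prob W R n (c n)) \<longlonglongrightarrow> 0" unfolding achievable_avg_def by blast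
  show ?thesis unfolding achievable_informed_def
  proof (intro conjI R allI impI)
    fix e :: real assume "e > 0"
    then have "\<forall>\<^sub>F n in sequentially. avg_error_prob W R n (c n) < e / 4"
      using order_tendstoD(2)[OF lim, of "e / 4"] by simp
    then show "\<forall>\<^sub>F n in sequentially. coop_code W n (index_set (2 powr (real n * fst R))) (index_set (2 powr (real n * snd R)))
       (nat \<lfloor>2 powr (real n * fst C)\<rfloor>) (nat \<lfloor>2 powr (real n * snd C)\<rfloor>) e"
      using eventually_ge_at_top[of 1]
      by eventually_elim (rule coop_code_error_mono[OF cf_code_imp_coop_code[OF c R]], auto)
  qed
qed

text \<open>Since the rates do not exceed the input capacities, both encoders send their messages
  unchanged. For fixed \<open>w1\<close> there are at most as many codewords as link values, so the
  facilitator transmits an injective index \<open>h1 w1\<close> of the codeword, and the encoder,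
  which knows \<open>w1\<close>, inverts it.\<close>

lemma coop_code_imp_cf_code:
  fixes W :: "'a \<Rightarrow> 'b \<Rightarrow> 'c::finite pmf"
  assumes R: "0 \<le> fst R" "0 \<le> snd R" and C: "0 \<le> fst C" "0 \<le> snd C"
    and Cin: "fst R \<le> fst Cin" "snd R \<le> snd Cin" and e: "0 \<le> e"
    and code: "coop_code W n (index_set (2 powr (real n * fst R))) (index_set (2 powr (real n * snd R)))
       (nat \<lfloor>2 powr (real n * fst C)\<rfloor>) (nat \<lfloor>2 powr (real n * snd C)\<rfloor>) e"
  shows "\<exists>c. is_cf_code Cin C R n c \<and> avg_error_prob W R n c \<le> e"
proof -
  define M1 where "M1 = index_set (2 powr (real n * fst R))"
  define M2 where "M2 = index_set (2 powr (real n * snd R))"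
  define O1 where "O1 = index_set (2 powr (real n * fst C))"
  define O2 where "O2 = index_set (2 powr (real n * snd C))"
  define I1 where "I1 = index_set (2 powr (real n * fst Cin))"
  define I2 where "I2 = index_set (2 powr (real n * snd Cin))"
  have fin: "finite M1" "finite M2" "finite O1" "finite O2" by (simp_all add: M1_def M2_def O1_def O2_def)
  have one: "1 \<in> M1" "1 \<in> M2" "1 \<in> O1" "1 \<in> O2"
    using R C nat_floor_ge_1[OF two_powr_ge_1, of _ n] by (auto simp: M1_def M2_def O1_def O2_def index_set_def)
  have sub: "M1 \<subseteq> I1" "M2 \<subseteq> I2"
    using Cin unfolding M1_def M2_def I1_def I2_def index_set_def
    by (auto intro!: atLeastatMost_subset_iff[THEN iffD2] nat_mono floor_mono powr_mono mult_left_mono disjI2)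
  from code obtain x1 x2 g where
        x1: "\<forall>w1\<in>M1. card ((\<lambda>w2. x1 w1 w2) ` M2) \<le> card O1"
    and x2: "\<forall>w2\<in>M2. card ((\<lambda>w1. x2 w1 w2) ` M1) \<le> card O2"
    and s: "(\<Sum>w1\<in>M1. \<Sum>w2\<in>M2. measure_pmf.prob (pair_output W n (x1 w1 w2) (x2 w1 w2)) {y. g y \<noteq> (w1, w2)})
         \<le> e * card M1 * card M2"
    unfolding coop_code_def M1_def M2_def O1_def O2_def card_index_set by blast
  \<comment> \<open>\<open>coop_code\<close> leaves codewords unconstrained outside
    \<open>{1..n}\<close>; restriction puts them into \<open>seqs n\<close> without changing the
    output law.\<close>
  define r1 where "r1 w1 w2 = restrict (x1 w1 w2) {1..n}" for w1 w2
  define r2 where "r2 w1 w2 = restrict (x2 w1 w2) {1..n}" for w1 w2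
  have "\<exists>h. h ` (r1 w1 ` M2) \<subseteq> O1 \<and> inj_on h (r1 w1 ` M2)" if w: "w1 \<in> M1" for w1
  proof (rule card_le_inj)
    have "r1 w1 ` M2 = (\<lambda>x. restrict x {1..n}) ` (x1 w1 ` M2)" unfolding r1_def by auto
    then have "card (r1 w1 ` M2) \<le> card (x1 w1 ` M2)" using fin by (simp add: card_image_le)
    then show "card (r1 w1 ` M2) \<le> card O1" using x1 w by fastforce
  qed (use fin in auto)
  then obtain h1 where h1: "\<And>w1. w1 \<in> M1 \<Longrightarrow> h1 w1 ` (r1 w1 ` M2) \<subseteq> O1 \<and> inj_on (h1 w1) (r1 w1 ` M2)"
    by metis
  have "\<exists>h. h ` ((\<lambda>w1. r2 w1 w2) ` M1) \<subseteq> O2 \<and> inj_on h ((\<lambda>w1. r2 w1 w2) ` M1)" if w: "w2 \<in> M2" for w2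
  proof (rule card_le_inj)
    have "(\<lambda>w1. r2 w1 w2) ` M1 = (\<lambda>x. restrict x {1..n}) ` ((\<lambda>w1. x2 w1 w2) ` M1)" unfolding r2_def by auto
    then have "card ((\<lambda>w1. r2 w1 w2) ` M1) \<le> card ((\<lambda>w1. x2 w1 w2) ` M1)" using fin by (simp add: card_image_le)
    then show "card ((\<lambda>w1. r2 w1 w2) ` M1) \<le> card O2" using x2 w by fastforce
  qed (use fin in auto)
  then obtain h2 where h2: "\<And>w2. w2 \<in> M2 \<Longrightarrow> h2 w2 ` ((\<lambda>w1. r2 w1 w2) ` M1) \<subseteq> O2 \<and> inj_on (h2 w2) ((\<lambda>w1. r2 w1 w2) ` M1)"
    by metis
  \<comment> \<open>The default values only ensure the required ranges. The decoder default (1, 1)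
    replaces pairs outside the message sets, so it never spoils a correct decision.\<close>
  define c :: "('a, 'b, 'c) cf_code" where "c = \<lparr>cf_in1 = id, cf_in2 = id,
     cf_out1 = (\<lambda>(v1, v2). if v1 \<in> M1 \<and> v2 \<in> M2 then h1 v1 (r1 v1 v2) else 1),
     cf_out2 = (\<lambda>(v1, v2). if v1 \<in> M1 \<and> v2 \<in> M2 then h2 v2 (r2 v1 v2) else 1),
     enc1 = (\<lambda>(w, z). if z \<in> h1 w ` (r1 w ` M2) then inv_into (r1 w ` M2) (h1 w) z else (\<lambda>_. undefined)),
     enc2 = (\<lambda>(w, z). if z \<in> h2 w ` ((\<lambda>w1. r2 w1 w) ` M1) then inv_into ((\<lambda>w1. r2 w1 w) ` M1) (h2 w) z else (\<lambda>_. undefined)),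
     dec = (\<lambda>y. if g y \<in> M1 \<times> M2 then g y else (1, 1))\<rparr>"
  have r1s: "r1 w1 w2 \<in> seqs n" for w1 w2 by (simp add: r1_def seqs_def)
  have r2s: "r2 w1 w2 \<in> seqs n" for w1 w2 by (simp add: r2_def seqs_def)
  have us: "(\<lambda>_. undefined) \<in> seqs n" by (auto simp: seqs_def)
  have e1: "enc1 c (w, z) \<in> seqs n" for w z
    using r1s us inv_into_into[of z "h1 w" "r1 w ` M2"] by (auto simp: c_def)
  have e2: "enc2 c (w, z) \<in> seqs n" for w z
    using r2s us inv_into_into[of z "h2 w" "(\<lambda>w1. r2 w1 w) ` M1"] by (auto simp: c_def)
  have "is_cf_code Cin C R n c"
    unfolding is_cf_code_def Let_def M1_def[symmetric] M2_def[symmetric] O1_def[symmetric] O2_def[symmetric] I1_def[symmetric] I2_def[symmetric]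
    using h1 h2 one sub e1 e2 by (auto simp: c_def image_subset_iff)
  moreover have "avg_error_prob W R n c \<le> e"
  proof -
    have err: "error_prob W n c w1 w2 \<le> measure_pmf.prob (pair_output W n (x1 w1 w2) (x2 w1 w2)) {y. g y \<noteq> (w1, w2)}"
      if w: "w1 \<in> M1" "w2 \<in> M2" for w1 w2
    proof -
      have 1: "enc1 c (w1, cf_out1 c (cf_in1 c w1, cf_in2 c w2)) = r1 w1 w2"
        using w h1 by (auto simp: c_def)
      have 2: "enc2 c (w2, cf_out2 c (cf_in1 c w1, cf_in2 c w2)) = r2 w1 w2"
        using w h2 by (auto simp: c_def)
      have "error_prob W n c w1 w2 = measure_pmf.prob (pair_output W n (r1 w1 w2) (r2 w1 w2)) {y. dec c y \<noteq> (w1, w2)}"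
        unfolding error_prob_def Let_def sum_memoryless 1 2 ..
      also have "pair_output W n (r1 w1 w2) (r2 w1 w2) = pair_output W n (x1 w1 w2) (x2 w1 w2)"
        by (rule pair_output_cong) (auto simp: r1_def r2_def)
      also have "measure_pmf.prob \<dots> {y. dec c y \<noteq> (w1, w2)} \<le> measure_pmf.prob (pair_output W n (x1 w1 w2) (x2 w1 w2)) {y. g y \<noteq> (w1, w2)}"
        using w by (intro measure_pmf.finite_measure_mono) (auto simp: c_def)
      finally show ?thesis .
    qed
    have "(\<Sum>w1\<in>M1. \<Sum>w2\<in>M2. error_prob W n c w1 w2) \<le> e * card M1 * card M2"
      by (rule order_trans[OF _ s]) (intro sum_mono err)
    also have "\<dots> \<le> e * 2 powr (real n * fst R) * 2 powr (real n * snd R)"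
      unfolding M1_def M2_def card_index_set using e
      by (intro mult_mono nat_floor_le) auto
    also have "\<dots> = e * 2 powr (real n * (fst R + snd R))" by (simp add: powr_add distrib_left)
    finally have "(\<Sum>w1\<in>M1. \<Sum>w2\<in>M2. error_prob W n c w1 w2) \<le> e * 2 powr (real n * (fst R + snd R))" .
    then show ?thesis unfolding avg_error_prob_def M1_def[symmetric] M2_def[symmetric]
      by (simp only: two_powr_minus) (simp add: powr_add distrib_left field_simps)
  qed
  ultimately show ?thesis by blast
qed

text \<open>For each \<open>n\<close> a code is taken whose error is within \<open>1 / Suc n\<close>
  of the infimum at that length. This choice does not refer to \<open>e\<close>, so one sequence
  eventually falls below every tolerance.\<close>

lemma near_minimal_choice:
  fixes err :: "nat \<Rightarrow> 'z \<Rightarrow> real"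
  assumes ex: "\<And>n. n \<ge> 1 \<Longrightarrow> \<exists>c. Q n c" and nn: "\<And>n c. 0 \<le> err n c"
    and ev: "\<And>e. e > 0 \<Longrightarrow> \<forall>\<^sub>F n in sequentially. \<exists>c. Q n c \<and> err n c \<le> e"
  shows "\<exists>c. (\<forall>n\<ge>1. Q n (c n)) \<and> (\<lambda>n. err n (c n)) \<longlonglongrightarrow> 0"
proof -
  define I where "I n = Inf (err n ` {c. Q n c})" for n
  have bdd: "bdd_below (err n ` {c. Q n c})" for n using nn by (intro bdd_belowI[of _ 0]) auto
  have "\<exists>c. Q n c \<and> err n c < I n + 1 / Suc n" if "n \<ge> 1" for n
  proof -
    have "\<exists>x\<in>err n ` {c. Q n c}. x < I n + 1 / Suc n"
      using ex[OF that] by (subst cInf_less_iff[symmetric, OF _ bdd]) (auto simp: I_def)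
    then show ?thesis by auto
  qed
  then obtain c where c: "\<And>n. n \<ge> 1 \<Longrightarrow> Q n (c n) \<and> err n (c n) < I n + 1 / Suc n" by metis
  have "(\<lambda>n. err n (c n)) \<longlonglongrightarrow> 0"
  proof (rule order_tendstoI)
    fix e :: real assume "e > 0"
    have "(\<lambda>n. 1 / real (Suc n)) \<longlonglongrightarrow> 0" using LIMSEQ_inverse_real_of_nat by (simp add: inverse_eq_divide)
    then have "\<forall>\<^sub>F n in sequentially. 1 / real (Suc n) < e / 2"
      using \<open>e > 0\<close> by (intro order_tendstoD(2)) auto
    moreover have "\<forall>\<^sub>F n in sequentially. \<exists>c. Q n c \<and> err n c \<le> e / 2" using \<open>e > 0\<close> by (intro ev) auto
    ultimately show "\<forall>\<^sub>F n in sequentially. err n (c n) < e"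
      using eventually_ge_at_top[of 1]
    proof eventually_elim
      case (elim n)
      then obtain c' where c': "Q n c'" "err n c' \<le> e / 2" by blast
      have "I n \<le> err n c'" unfolding I_def using c' by (intro cInf_lower bdd) auto
      then show ?case using c[of n] c' elim by linarith
    qed
  qed (use nn in \<open>auto intro!: always_eventually less_le_trans[OF _ nn]\<close>)
  then show ?thesis using c by blast
qed

lemma achievable_informed_imp_achievable_avg:
  fixes W :: "'a \<Rightarrow> 'b \<Rightarrow> 'c::finite pmf"
  assumes a: "achievable_informed W C R" and C: "0 \<le> fst C" "0 \<le> snd C"
    and Cin: "fst R \<le> fst Cin" "snd R \<le> snd Cin"
  shows "achievable_avg W Cin C R"
proof -
  have R: "0 \<le> fst R" "0 \<le> snd R" using a by (auto simp: achievable_informed_def)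
  have "\<exists>c. (\<forall>n\<ge>1. is_cf_code Cin C R n (c n)) \<and> (\<lambda>n. avg_error_prob W R n (c n)) \<longlonglongrightarrow> 0"
  proof (rule near_minimal_choice)
    fix n :: nat
    have "coop_code W n (index_set (2 powr (real n * fst R))) (index_set (2 powr (real n * snd R)))
       (nat \<lfloor>2 powr (real n * fst C)\<rfloor>) (nat \<lfloor>2 powr (real n * snd C)\<rfloor>) 1"
      using C by (intro coop_code_trivial nat_floor_ge_1 two_powr_ge_1) auto
    from coop_code_imp_cf_code[OF R C Cin _ this]
    show "\<exists>c. is_cf_code Cin C R n (c :: ('a, 'b, 'c) cf_code)" by auto
  next
    fix e :: real assume e: "e > 0"
    with a have "\<forall>\<^sub>F n in sequentially. coop_code W n (index_set (2 powr (real n * fst R))) (index_set (2 powr (real n * snd R)))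
       (nat \<lfloor>2 powr (real n * fst C)\<rfloor>) (nat \<lfloor>2 powr (real n * snd C)\<rfloor>) e"
      by (auto simp: achievable_informed_def)
    then show "\<forall>\<^sub>F n in sequentially. \<exists>c. is_cf_code Cin C R n c \<and> avg_error_prob W R n c \<le> e"
      by eventually_elim (use e in \<open>auto intro!: coop_code_imp_cf_code R C Cin\<close>)
  qed (rule avg_error_prob_nonneg)
  then show ?thesis unfolding achievable_avg_def using R by blast
qed

section \<open>Mutual information as an upper bound\<close>

lemma pair_output_eq_channel_output:
  "pair_output W n u v = channel_output (case_prod W) n (\<lambda>t. (u t, v t))"
  by (simp add: pair_output_def channel_output_def)

lemma kl_div_nonneg:
  assumes "finite (set_pmf p)" "set_pmf p \<subseteq> set_pmf q"
  shows "0 \<le> kl_div p q"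
  using kl_div_event_bound[OF assms, of 1 "{}"] by simp

lemma kl_div_le_log:
  assumes fin: "finite (set_pmf p)" and K: "0 < K"
    and le: "\<And>y. y \<in> set_pmf p \<Longrightarrow> pmf p y \<le> K * pmf q y"
  shows "kl_div p q \<le> log 2 K"
  unfolding kl_div_def
proof (rule measure_pmf.integral_le_const)
  show "integrable (measure_pmf p) (\<lambda>y. log 2 (pmf p y / pmf q y))"
    by (rule integrable_measure_pmf_finite[OF fin])
  show "AE y in measure_pmf p. log 2 (pmf p y / pmf q y) \<le> log 2 K"
  proof (rule AE_pmfI)
    fix y assume y: "y \<in> set_pmf p"
    then have p: "0 < pmf p y" by (simp add: pmf_positive)
    then have "0 < K * pmf q y" using le[OF y] by linarith
    then have q: "0 < pmf q y" using K by (simp add: zero_less_mult_iff)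
    show "log 2 (pmf p y / pmf q y) \<le> log 2 K"
      using p q K le[OF y] by (subst log_le_cancel_iff) (auto simp: field_simps)
  qed
qed

text \<open>A reference law that dominates \<open>K\<close> times another one costs at most
  \<open>- log 2 K\<close> additional bits; it is applied to a mixture, with \<open>K\<close> the
  weight of one component.\<close>

lemma kl_div_mono_right:
  assumes fin: "finite (set_pmf p)" and K: "0 < K" and ac: "set_pmf p \<subseteq> set_pmf q"
    and le: "\<And>y. y \<in> set_pmf p \<Longrightarrow> K * pmf q y \<le> pmf r y"
  shows "kl_div p r \<le> kl_div p q - log 2 K"
proof -
  have "kl_div p r \<le> measure_pmf.expectation p (\<lambda>y. log 2 (pmf p y / pmf q y) - log 2 K)"
    unfolding kl_div_def
  proof (intro integral_mono_AE AE_pmfI integrable_measure_pmf_finite fin)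
    fix y assume y: "y \<in> set_pmf p"
    then have p: "0 < pmf p y" and q: "0 < pmf q y" using ac by (auto intro: pmf_positive)
    have Kq: "0 < K * pmf q y" using K q by simp
    have "log 2 (pmf p y / pmf r y) \<le> log 2 (pmf p y / (K * pmf q y))"
      using p Kq le[OF y] by (subst log_le_cancel_iff) (auto intro!: divide_left_mono mult_pos_pos)
    also have "\<dots> = log 2 (pmf p y / pmf q y) - log 2 K"
      using p q K by (simp add: log_divide log_mult)
    finally show "log 2 (pmf p y / pmf r y) \<le> log 2 (pmf p y / pmf q y) - log 2 K" .
  qed
  also have "\<dots> = kl_div p q - log 2 K"
    unfolding kl_div_def by (subst Bochner_Integration.integral_diff)
      (auto intro!: integrable_measure_pmf_finite fin)
  finally show ?thesis .
qed

text \<open>Mutual information between an input of law \<open>q\<close> and the output of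
  \<open>V\<close>, as the mean divergence of the conditional output law from the marginal one.
  Agreement with the measure-theoretic definition is
  \<open>mac_mutual_information_eq_info\<close>.\<close>

definition info :: "('x \<Rightarrow> 'y pmf) \<Rightarrow> 'x pmf \<Rightarrow> real" where
  "info V q = measure_pmf.expectation q (\<lambda>x. kl_div (V x) (bind_pmf q V))"

lemma info_sum:
  fixes q :: "'x::finite pmf"
  shows "info V q = (\<Sum>x\<in>UNIV. pmf q x * kl_div (V x) (bind_pmf q V))"
  unfolding info_def by (subst integral_measure_pmf[of UNIV]) auto

text \<open>A crude bound that makes the supremum in \<open>max_mutual_information\<close> range
  over a bounded set. The output law dominates \<open>pmf q x\<close> times \<open>V x\<close>, so a
  summand with probability p is at most p log (1/p), and \<open>ln x \<le> x - 1\<close> bounds this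
  by \<open>1 / ln 2\<close>.\<close>

lemma info_le:
  fixes q :: "'x::finite pmf" and V :: "'x \<Rightarrow> 'y::finite pmf"
  shows "info V q \<le> real CARD('x) / ln 2"
proof -
  have "pmf q x * kl_div (V x) (bind_pmf q V) \<le> 1 / ln 2" for x
  proof (cases "pmf q x = 0")
    case False
    then have q: "0 < pmf q x" by (simp add: pmf_pos)
    have "pmf (V x) y \<le> 1 / pmf q x * pmf (bind_pmf q V) y" for y
    proof -
      have "pmf q x * pmf (V x) y \<le> (\<Sum>x\<in>UNIV. pmf q x * pmf (V x) y)"
        by (rule member_le_sum) auto
      also have "\<dots> = pmf (bind_pmf q V) y"
        by (subst pmf_bind, subst integral_measure_pmf[of UNIV]) auto
      finally show ?thesis using q by (simp add: field_simps)
    qed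
    then have "kl_div (V x) (bind_pmf q V) \<le> log 2 (1 / pmf q x)"
      using q by (intro kl_div_le_log) auto
    then have "pmf q x * kl_div (V x) (bind_pmf q V) \<le> pmf q x * (ln (1 / pmf q x) / ln 2)"
      using q by (intro mult_left_mono) (auto simp: log_def)
    also have "\<dots> \<le> pmf q x * ((1 / pmf q x - 1) / ln 2)"
      using q by (intro mult_left_mono divide_right_mono ln_le_minus_one) auto
    also have "\<dots> \<le> 1 / ln 2" using q by (simp add: field_simps)
    finally show ?thesis .
  qed auto
  then have "info V q \<le> (\<Sum>x\<in>(UNIV::'x set). 1 / ln 2)" unfolding info_sum by (intro sum_mono)
  then show ?thesis by simp
qed

lemma pmf_bind_Pair:
  fixes q :: "'x::finite pmf"
  shows "pmf (bind_pmf q (\<lambda>x. map_pmf (Pair x) (V x))) (x, y) = pmf q x * pmf (V x) y"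
proof -
  have "pmf (bind_pmf q (\<lambda>x. map_pmf (Pair x) (V x))) (x, y)
      = (\<Sum>x'\<in>UNIV. pmf q x' * pmf (map_pmf (Pair x') (V x')) (x, y))"
    by (subst pmf_bind, subst integral_measure_pmf[of UNIV]) auto
  also have "\<dots> = (\<Sum>x'\<in>UNIV. if x' = x then pmf q x * pmf (V x) y else 0)"
  proof (intro sum.cong refl)
    fix x'
    have "pmf (map_pmf (Pair x') (V x')) (x, y) = (if x' = x then pmf (V x) y else 0)"
    proof (cases "x' = x")
      case True
      then show ?thesis using pmf_map_inj'[of "Pair x'" "V x'" y] by (simp add: inj_on_def)
    qed (auto simp: pmf_eq_0_set_pmf)
    then show "pmf q x' * pmf (map_pmf (Pair x') (V x')) (x, y) = (if x' = x then pmf q x * pmf (V x) y else 0)"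
      by simp
  qed
  finally show ?thesis by simp
qed

lemma mac_mutual_information_eq_info:
  fixes W :: "'a::finite \<Rightarrow> 'b::finite \<Rightarrow> 'c::finite pmf"
  shows "mac_mutual_information W q = info (case_prod W) q"
proof -
  let ?V = "case_prod W" and ?P = "mac_joint W q"
  have joint: "?P = bind_pmf q (\<lambda>x. map_pmf (Pair x) (?V x))"
    by (simp add: mac_joint_def case_prod_beta)
  interpret information_space "measure_pmf ?P" 2
    by unfold_locales auto
  have sf: "simple_function (measure_pmf ?P) f" for f :: "('a \<times> 'b) \<times> 'c \<Rightarrow> 'z"
    by (simp add: simple_function_def)
  have pxy: "pmf ?P (x, y) = pmf q x * pmf (?V x) y" for x y
    unfolding joint by (rule pmf_bind_Pair)
  have px: "measure_pmf.prob ?P (fst -` {x}) = pmf q x" for x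
  proof -
    have "map_pmf fst ?P = q" unfolding joint map_bind_pmf map_pmf_comp by (simp add: bind_return_pmf' map_pmf_const)
    then show ?thesis by (metis pmf_map)
  qed
  have py: "measure_pmf.prob ?P (snd -` {y}) = pmf (bind_pmf q ?V) y" for y
  proof -
    have "map_pmf snd ?P = bind_pmf q ?V" unfolding joint map_bind_pmf map_pmf_comp by (simp add: map_pmf_ident)
    then show ?thesis by (metis pmf_map)
  qed
  have "prob_space.mutual_information (measure_pmf ?P) 2 (count_space (fst ` space (measure_pmf ?P))) (count_space (snd ` space (measure_pmf ?P))) fst snd
     = (\<Sum>(x, y)\<in>(\<lambda>z. (fst z, snd z)) ` space (measure_pmf ?P).
         ((\<lambda>(x, y). pmf q x * pmf (?V x) y) (x, y)) * log 2 (((\<lambda>(x, y). pmf q x * pmf (?V x) y) (x, y)) / (pmf q x * pmf (bind_pmf q ?V) y)))"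
    by (rule mutual_information_simple_distributed[where Px = "pmf q" and Py = "pmf (bind_pmf q ?V)" and Pxy = "\<lambda>(x, y). pmf q x * pmf (?V x) y"])
       (auto intro!: measure_pmf.simple_distributedI sf simp: px py pxy measure_pmf_single split: prod.splits)
  then have "mac_mutual_information W q = (\<Sum>(x, y)\<in>UNIV. (pmf q x * pmf (?V x) y) * log 2 ((pmf q x * pmf (?V x) y) / (pmf q x * pmf (bind_pmf q ?V) y)))"
    unfolding mac_mutual_information_def by simp
  also have "\<dots> = (\<Sum>x\<in>UNIV. \<Sum>y\<in>UNIV. (pmf q x * pmf (?V x) y) * log 2 ((pmf q x * pmf (?V x) y) / (pmf q x * pmf (bind_pmf q ?V) y)))"
    by (simp add: sum.cartesian_product UNIV_Times_UNIV[symmetric] del: UNIV_Times_UNIV)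
  also have "\<dots> = (\<Sum>x\<in>UNIV. pmf q x * kl_div (?V x) (bind_pmf q ?V))"
  proof (intro sum.cong refl)
    fix x
    have "kl_div (?V x) (bind_pmf q ?V) = (\<Sum>y\<in>UNIV. pmf (?V x) y * log 2 (pmf (?V x) y / pmf (bind_pmf q ?V) y))"
      unfolding kl_div_def by (subst integral_measure_pmf[of UNIV]) auto
    then show "(\<Sum>y\<in>UNIV. (pmf q x * pmf (?V x) y) * log 2 ((pmf q x * pmf (?V x) y) / (pmf q x * pmf (bind_pmf q ?V) y)))
      = pmf q x * kl_div (?V x) (bind_pmf q ?V)"
      by (cases "pmf q x = 0") (auto simp: sum_distrib_left mult.assoc)
  qed
  finally show ?thesis by (simp only: info_sum)
qed

lemma info_le_max_mutual_information:
  fixes W :: "'a::finite \<Rightarrow> 'b::finite \<Rightarrow> 'c::finite pmf"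
  shows "info (case_prod W) q \<le> max_mutual_information W"
  unfolding max_mutual_information_def mac_mutual_information_eq_info
  by (rule cSUP_upper) (auto intro!: bdd_aboveI2 info_le)

text \<open>The message pairs of small individual error, at least half of all pairs.
  \<open>G\<close> is in general not a product set, which is what both the wringing and the binning
  argument have to cope with.\<close>

definition good_pairs ::
  "('a \<Rightarrow> 'b \<Rightarrow> 'c pmf) \<Rightarrow> nat \<Rightarrow> 'm set \<Rightarrow> 'k set \<Rightarrow> nat \<Rightarrow> nat \<Rightarrow> real \<Rightarrow>
    ('m \<Rightarrow> 'k \<Rightarrow> nat \<Rightarrow> 'a) \<Rightarrow> ('m \<Rightarrow> 'k \<Rightarrow> nat \<Rightarrow> 'b) \<Rightarrow> ((nat \<Rightarrow> 'c) \<Rightarrow> 'm \<times> 'k) \<Rightarrow> ('m \<times> 'k) set \<Rightarrow> bool" where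
  "good_pairs W n M1 M2 k1 k2 e x1 x2 g G \<longleftrightarrow>
    (\<forall>w1\<in>M1. card ((\<lambda>w2. x1 w1 w2) ` M2) \<le> k1) \<and>
    (\<forall>w2\<in>M2. card ((\<lambda>w1. x2 w1 w2) ` M1) \<le> k2) \<and>
    G \<subseteq> M1 \<times> M2 \<and> card M1 * card M2 \<le> 2 * card G \<and>
    (\<forall>(w1, w2)\<in>G. measure_pmf.prob (pair_output W n (x1 w1 w2) (x2 w1 w2)) {y. g y \<noteq> (w1, w2)} \<le> e)"

text \<open>Markov's inequality: with average error \<open>e / 2\<close>, at most half of the pairs
  have error above \<open>e\<close>.\<close>

lemma coop_code_good_pairs:
  assumes "coop_code W n M1 M2 k1 k2 (e / 2)" "0 < e"
  shows "\<exists>x1 x2 g G. good_pairs W n M1 M2 k1 k2 e x1 x2 g G"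
proof -
  from assms obtain x1 x2 g where fin: "finite M1" "finite M2"
    and x1: "\<forall>w1\<in>M1. card ((\<lambda>w2. x1 w1 w2) ` M2) \<le> k1"
    and x2: "\<forall>w2\<in>M2. card ((\<lambda>w1. x2 w1 w2) ` M1) \<le> k2"
    and s: "(\<Sum>w1\<in>M1. \<Sum>w2\<in>M2. measure_pmf.prob (pair_output W n (x1 w1 w2) (x2 w1 w2)) {y. g y \<noteq> (w1, w2)})
         \<le> e / 2 * card M1 * card M2" unfolding coop_code_def by blast
  define E where "E = (\<lambda>(w1, w2). measure_pmf.prob (pair_output W n (x1 w1 w2) (x2 w1 w2)) {y. g y \<noteq> (w1, w2)})"
  define G where "G = {w \<in> M1 \<times> M2. E w \<le> e}"
  have finG: "finite (M1 \<times> M2)" using fin by simp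
  have sE: "sum E (M1 \<times> M2) \<le> e / 2 * card (M1 \<times> M2)"
    using s unfolding sum.cartesian_product by (simp add: E_def card_cartesian_product mult.assoc)
  have "real (card (M1 \<times> M2 - G)) * (e) = (\<Sum>w\<in>M1 \<times> M2 - G. e)" by simp
  also have "\<dots> \<le> sum E (M1 \<times> M2 - G)" by (intro sum_mono) (auto simp: G_def)
  also have "\<dots> \<le> sum E (M1 \<times> M2)" using finG by (intro sum_mono2) (auto simp: E_def)
  also note sE
  finally have "(2 * real (card (M1 \<times> M2 - G))) * e \<le> real (card (M1 \<times> M2)) * e" by (simp add: ac_simps)
  then have "2 * real (card (M1 \<times> M2 - G)) \<le> real (card (M1 \<times> M2))" using assms(2) by simp
  moreover have "card (M1 \<times> M2 - G) = card (M1 \<times> M2) - card G" "card G \<le> card (M1 \<times> M2)"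
    using finG by (auto simp: G_def intro!: card_Diff_subset card_mono)
  ultimately have "card (M1 \<times> M2) \<le> 2 * card G" by linarith
  then have "good_pairs W n M1 M2 k1 k2 e x1 x2 g G"
    unfolding good_pairs_def using x1 x2 by (auto simp: G_def E_def card_cartesian_product)
  then show ?thesis by blast
qed

text \<open>Divide by \<open>n\<close>, let \<open>n\<close> tend to infinity and then
  \<open>e\<close> to 0. The constant \<open>c\<close>, which absorbs all terms bounded in
  \<open>n\<close>, is the same for all \<open>e\<close>.\<close>

lemma rate_limit:
  assumes "\<And>e. 0 < e \<Longrightarrow> e < 1 \<Longrightarrow> \<forall>\<^sub>F n in sequentially. (1 - e) * (real n * A - c) \<le> real n * B + c"
  shows "A \<le> (B :: real)"
proof (rule ccontr)
  assume "\<not> A \<le> B"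
  then have AB: "B < A" by simp
  \<comment> \<open>With this \<open>e\<close> the loss \<open>e * A\<close> is at most half of the
    gap \<open>A - B\<close>, so what remains still grows linearly in \<open>n\<close>.\<close>
  define e where "e = min (1 / 2) ((A - B) / (2 * (\<bar>A\<bar> + 1)))"
  have e: "0 < e" "e < 1" using AB by (auto simp: e_def)
  have "e * A \<le> e * (\<bar>A\<bar> + 1)" using e by (intro mult_left_mono) auto
  also have "\<dots> \<le> (A - B) / (2 * (\<bar>A\<bar> + 1)) * (\<bar>A\<bar> + 1)"
    by (intro mult_right_mono) (auto simp: e_def)
  also have "\<dots> = (A - B) / 2" by (simp add: field_simps)
  finally have gap: "0 < (1 - e) * A - B" using AB by (simp add: algebra_simps)
  obtain N :: nat where N: "(c + (1 - e) * c) / ((1 - e) * A - B) < N" using reals_Archimedean2 by blast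
  have "\<forall>\<^sub>F n in sequentially. False"
    using assms[OF e] eventually_ge_at_top[of N]
  proof eventually_elim
    case (elim n)
    have "(c + (1 - e) * c) / ((1 - e) * A - B) < n" using N elim(2) by linarith
    then have "c + (1 - e) * c < n * ((1 - e) * A - B)" using gap by (simp add: field_simps)
    then show ?case using elim(1) by (simp add: algebra_simps)
  qed
  then show False by simp
qed

text \<open>The three bits: one for each floor in the two message counts, one because
  \<open>G\<close> may contain only half of the pairs.\<close>

lemma log_message_pairs:
  assumes R: "0 \<le> R1" "0 \<le> R2"
    and G: "nat \<lfloor>2 powr (real n * R1)\<rfloor> * nat \<lfloor>2 powr (real n * R2)\<rfloor> \<le> 2 * card G"
  shows "real n * (R1 + R2) - 3 \<le> log 2 (card G)"
proof -
  have "2 powr (real n * R1) * 2 powr (real n * R2) \<le>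
      (2 * real (nat \<lfloor>2 powr (real n * R1)\<rfloor>)) * (2 * real (nat \<lfloor>2 powr (real n * R2)\<rfloor>))"
    using R by (intro mult_mono nat_floor_ge_half two_powr_ge_1) auto
  also have "\<dots> = 4 * real (nat \<lfloor>2 powr (real n * R1)\<rfloor> * nat \<lfloor>2 powr (real n * R2)\<rfloor>)" by simp
  also have "\<dots> \<le> 4 * real (2 * card G)" using G by (intro mult_left_mono of_nat_mono) auto
  finally have "2 powr (real n * (R1 + R2)) \<le> 8 * real (card G)"
    by (simp add: powr_add distrib_left)
  then have "2 powr (real n * (R1 + R2)) / 8 \<le> card G" by simp
  moreover have "2 powr (real n * (R1 + R2)) / 8 = 2 powr (real n * (R1 + R2) - 3)"
    by (simp add: powr_diff)
  ultimately have *: "2 powr (real n * (R1 + R2) - 3) \<le> card G" by simp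
  then have "0 < real (card G)" by (smt (verit) powr_gt_zero)
  then show ?thesis using * by (simp add: le_log_iff)
qed

text \<open>\<open>q t\<close> is the law of the input letters in position \<open>t\<close> for a
  uniformly drawn good message pair, and the reference output is the one it induces. Summing the
  divergences over \<open>G\<close> gives \<open>card G\<close> times the mutual information of
  \<open>q t\<close>. The facilitator only shapes the joint law \<open>q t\<close>, hence the
  maximum over all joint inputs.\<close>

lemma achievable_informed_le_max_mutual_information:
  fixes W :: "'a::finite \<Rightarrow> 'b::finite \<Rightarrow> 'c::finite pmf"
  assumes a: "achievable_informed W (a, b) (R1, R2)"
  shows "R1 + R2 \<le> max_mutual_information W"
proof (rule rate_limit[where c = "3 + 1 / ln 2"])
  fix e :: real assume e: "0 < e" "e < 1"
  have R: "0 \<le> R1" "0 \<le> R2" using a by (auto simp: achievable_informed_def)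
  let ?I = "max_mutual_information W" and ?V = "case_prod W"
  have "0 < e / 2" using e by simp
  from achievable_informedD[OF a this]
  show "\<forall>\<^sub>F n in sequentially. (1 - e) * (real n * (R1 + R2) - (3 + 1 / ln 2)) \<le> real n * ?I + (3 + 1 / ln 2)"
  proof eventually_elim
    case (elim n)
    obtain x1 x2 g G where gp: "good_pairs W n {..<nat \<lfloor>2 powr (real n * R1)\<rfloor>} {..<nat \<lfloor>2 powr (real n * R2)\<rfloor>}
        (nat \<lfloor>2 powr (real n * a)\<rfloor>) (nat \<lfloor>2 powr (real n * b)\<rfloor>) e x1 x2 g G"
      using coop_code_good_pairs[OF elim e(1)] by blast
    then have G: "G \<subseteq> {..<nat \<lfloor>2 powr (real n * R1)\<rfloor>} \<times> {..<nat \<lfloor>2 powr (real n * R2)\<rfloor>}"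
      and G2: "nat \<lfloor>2 powr (real n * R1)\<rfloor> * nat \<lfloor>2 powr (real n * R2)\<rfloor> \<le> 2 * card G"
      by (simp_all add: good_pairs_def)
    have err: "measure_pmf.prob (pair_output W n (x1 w1 w2) (x2 w1 w2)) {y. g y \<noteq> (w1, w2)} \<le> e"
      if "(w1, w2) \<in> G" for w1 w2 using gp that by (auto simp: good_pairs_def)
    have finG: "finite G" using G by (rule finite_subset) auto
    have lg: "real n * (R1 + R2) - 3 \<le> log 2 (card G)" by (rule log_message_pairs[OF R G2])
    have "1 \<le> nat \<lfloor>2 powr (real n * R1)\<rfloor> * nat \<lfloor>2 powr (real n * R2)\<rfloor>"
      using mult_le_mono[OF nat_floor_ge_1[OF two_powr_ge_1[OF R(1), of n]] nat_floor_ge_1[OF two_powr_ge_1[OF R(2), of n]]]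
      by simp
    then have neG: "G \<noteq> {}" using G2 by auto
    then have cG: "0 < real (card G)" using finG by (simp add: card_gt_0_iff)
    define u where "u = (\<lambda>(w1, w2) t. (x1 w1 w2 t, x2 w1 w2 t))"
    define q where "q t = map_pmf (\<lambda>w. u w t) (pmf_of_set G)" for t
    have sq: "set_pmf (q t) = (\<lambda>w. u w t) ` G" for t using finG neG by (simp add: q_def)
    have "real (card G) * ((1 - e) * log 2 (card G) - 1 / ln 2) \<le> (\<Sum>w\<in>G. \<Sum>t=1..n. kl_div (?V (u w t)) (bind_pmf (q t) ?V))"
    proof (rule converse_bound[where V = ?V and u = u and g = g and e = e and n = n and Q = "\<lambda>t. bind_pmf (q t) ?V", OF finG neG])
      fix w assume "w \<in> G"
      then show "measure_pmf.prob (channel_output ?V n (u w)) {y. g y \<noteq> w} \<le> e"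
        using err[of "fst w" "snd w"] by (cases w) (simp add: u_def pair_output_eq_channel_output)
      fix t show "set_pmf (?V (u w t)) \<subseteq> set_pmf (bind_pmf (q t) ?V)"
        using \<open>w \<in> G\<close> by (auto simp: sq)
    qed
    also have "\<dots> = (\<Sum>t=1..n. \<Sum>w\<in>G. kl_div (?V (u w t)) (bind_pmf (q t) ?V))" by (rule sum.swap)
    also have "\<dots> = (\<Sum>t=1..n. real (card G) * info ?V (q t))"
    proof (intro sum.cong refl)
      fix t
      have "info ?V (q t) = measure_pmf.expectation (pmf_of_set G) (\<lambda>w. kl_div (?V (u w t)) (bind_pmf (q t) ?V))"
        unfolding info_def by (subst (1) q_def) simp
      also have "\<dots> = (\<Sum>w\<in>G. kl_div (?V (u w t)) (bind_pmf (q t) ?V)) / card G"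
        by (rule integral_pmf_of_set[OF neG finG])
      finally show "(\<Sum>w\<in>G. kl_div (?V (u w t)) (bind_pmf (q t) ?V)) = real (card G) * info ?V (q t)"
        using cG by simp
    qed
    also have "\<dots> \<le> (\<Sum>t=1..n. real (card G) * ?I)"
      by (intro sum_mono mult_left_mono info_le_max_mutual_information) auto
    also have "\<dots> = real (card G) * (n * ?I)" by simp
    finally have main: "(1 - e) * log 2 (card G) - 1 / ln 2 \<le> n * ?I" using cG by simp
    have "(1 - e) * (real n * (R1 + R2) - 3) \<le> (1 - e) * log 2 (card G)"
      using lg e by (intro mult_left_mono) auto
    then have "(1 - e) * (real n * (R1 + R2) - 3) \<le> n * ?I + 1 / ln 2" using main by linarith
    moreover have "0 \<le> (1 - e) * (1 / ln 2)" using e by simp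
    ultimately show ?case by (simp only: right_diff_distrib distrib_left)
  qed
qed

section \<open>Small cooperation rates\<close>

text \<open>
  Whenever some pair of letters in some position is more than \<open>1 + \<gamma>\<close> times as frequent in \<open>G\<close> as in
  \<open>A \<times> B\<close>, and has frequency at least \<open>\<beta>\<close>, condition on it.  This divides the ratio \<open>K\<close> by \<open>1 + \<gamma>\<close>, so it
  happens at most \<open>ln K / ln (1 + \<gamma>)\<close> times, and each time \<open>G\<close> shrinks by a factor of at least \<open>\<beta>\<close>.
\<close>
lemma wringing:
  fixes u :: "'m \<Rightarrow> nat \<Rightarrow> 'a" and v :: "'k \<Rightarrow> nat \<Rightarrow> 'b" and K \<beta> \<gamma> :: real
  assumes "finite A" "finite B" "G \<subseteq> A \<times> B" "G \<noteq> {}"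
    and "real (card A) * real (card B) \<le> K * card G"
    and "0 < \<gamma>" "0 < \<beta>" "\<beta> < 1"
  defines "s \<equiv> ln (1 / \<beta>) / ln (1 + \<gamma>)"
  shows "\<exists>A' B' G'. A' \<subseteq> A \<and> B' \<subseteq> B \<and> A' \<noteq> {} \<and> B' \<noteq> {} \<and> G' \<subseteq> G \<and> G' \<subseteq> A' \<times> B' \<and> G' \<noteq> {} \<and>
    K powr (- s) * card G \<le> card G' \<and>
    (\<forall>t a b. real (card {w \<in> G'. u (fst w) t = a \<and> v (snd w) t = b})
      \<le> ((1 + \<gamma>) * (card {i \<in> A'. u i t = a} / card A' * (card {j \<in> B'. v j t = b} / card B')) + \<beta>) * card G')"
  using assms(1-5)
proof (induction "card A + card B" arbitrary: A B G K rule: less_induct)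
  case less
  have finG: "finite G" using less.prems finite_subset by blast
  have neAB: "A \<noteq> {}" "B \<noteq> {}" using less.prems by auto
  have cG: "0 < real (card G)" using finG less.prems(4) by (simp add: card_gt_0_iff)
  have cA: "0 < real (card A)" "0 < real (card B)" using neAB less.prems by (auto simp: card_gt_0_iff)
  have s0: "0 \<le> s" using assms(6-8) by (simp add: s_def)
  have "card G \<le> card (A \<times> B)" using less.prems by (intro card_mono) auto
  then have "real (card G) \<le> real (card A * card B)" by (simp only: card_cartesian_product of_nat_le_iff)
  then have "1 * real (card G) \<le> K * card G" using less.prems(5) by simp
  then have K1: "1 \<le> K" using cG by simp
  show ?case
  proof (cases "\<forall>t a b. real (card {w \<in> G. u (fst w) t = a \<and> v (snd w) t = b})
      \<le> ((1 + \<gamma>) * (card {i \<in> A. u i t = a} / card A * (card {j \<in> B. v j t = b} / card B)) + \<beta>) * card G")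
    case True
    have "K powr (- s) \<le> 1" using K1 s0 by (simp add: powr_minus inverse_le_1_iff ge_one_powr_ge_zero)
    then have "K powr (- s) * card G \<le> card G" by (simp add: mult_left_le_one_le)
    then show ?thesis using True less.prems neAB
      by (intro exI[of _ A] exI[of _ B] exI[of _ G]) auto
  next
    case False
    then obtain t a b where viol: "((1 + \<gamma>) * (card {i \<in> A. u i t = a} / card A * (card {j \<in> B. v j t = b} / card B)) + \<beta>) * card G
        < card {w \<in> G. u (fst w) t = a \<and> v (snd w) t = b}" by (auto simp: not_le)
    define A1 where "A1 = {i \<in> A. u i t = a}"
    define B1 where "B1 = {j \<in> B. v j t = b}"
    define G1 where "G1 = {w \<in> G. u (fst w) t = a \<and> v (snd w) t = b}"
    have sub: "A1 \<subseteq> A" "B1 \<subseteq> B" "G1 \<subseteq> G" "G1 \<subseteq> A1 \<times> B1"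
      using less.prems(3) by (auto simp: A1_def B1_def G1_def)
    have fin1: "finite A1" "finite B1" "finite G1" using less.prems finG by (auto simp: A1_def B1_def G1_def)
    define r where "r = real (card A1) / card A * (card B1 / card B)"
    have r0: "0 \<le> r" by (simp add: r_def)
    have viol': "((1 + \<gamma>) * r + \<beta>) * card G < card G1"
      using viol by (simp add: A1_def B1_def G1_def r_def)
    have "0 \<le> (1 + \<gamma>) * r * card G" using r0 assms(6) by simp
    then have v1: "\<beta> * card G < card G1" using viol' by (simp add: distrib_right)
    have "0 \<le> \<beta> * card G" using assms(7) by simp
    then have v2: "(1 + \<gamma>) * r * card G < card G1" using viol' by (simp add: distrib_right)
    have G1ne: "G1 \<noteq> {}" using v1 \<open>0 \<le> \<beta> * card G\<close> by auto
    have cG1: "card G1 \<le> card G" using sub finG by (simp add: card_mono)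
    \<comment> \<open>With \<open>r \<ge> 1\<close> the subset \<open>G1\<close> would have to
      outnumber \<open>G\<close>. Hence the restriction is proper in at least one coordinate and the
      induction on \<open>card A + card B\<close> proceeds.\<close>
    have "r < 1"
    proof (rule ccontr)
      assume "\<not> r < 1"
      then have "1 * real (card G) \<le> (1 + \<gamma>) * r * card G"
        using assms(6) mult_mono[of 1 "1 + \<gamma>" 1 r] by (intro mult_right_mono) auto
      then show False using v2 cG1 by simp
    qed
    have "card A1 + card B1 < card A + card B"
    proof (rule ccontr)
      assume "\<not> card A1 + card B1 < card A + card B"
      moreover have "card A1 \<le> card A" "card B1 \<le> card B" using sub less.prems by (auto intro: card_mono)
      ultimately have "card A1 = card A" "card B1 = card B" by linarith+
      then have "r = 1" using cA by (simp add: r_def)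
      then show False using \<open>r < 1\<close> by simp
    qed
    moreover have "real (card A1) * real (card B1) \<le> K / (1 + \<gamma>) * card G1"
    proof -
      have "real (card A1) * real (card B1) = r * (card A * card B)" using cA by (simp add: r_def)
      also have "\<dots> \<le> r * (K * card G)" using less.prems(5) r0 by (intro mult_left_mono) auto
      also have "\<dots> = K / (1 + \<gamma>) * ((1 + \<gamma>) * r * card G)" using assms(6) by simp
      also have "\<dots> \<le> K / (1 + \<gamma>) * card G1" using v2 K1 assms(6) by (intro mult_left_mono) auto
      finally show ?thesis .
    qed
    ultimately obtain A' B' G' where IH: "A' \<subseteq> A1" "B' \<subseteq> B1" "A' \<noteq> {}" "B' \<noteq> {}" "G' \<subseteq> G1" "G' \<subseteq> A' \<times> B'" "G' \<noteq> {}"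
      and IHc: "(K / (1 + \<gamma>)) powr (- s) * card G1 \<le> card G'"
      and IHq: "(\<forall>t a b. real (card {w \<in> G'. u (fst w) t = a \<and> v (snd w) t = b})
      \<le> ((1 + \<gamma>) * (card {i \<in> A'. u i t = a} / card A' * (card {j \<in> B'. v j t = b} / card B')) + \<beta>) * card G')"
      using less.hyps[of A1 B1 G1 "K / (1 + \<gamma>)"] fin1 sub(4) G1ne by auto
    \<comment> \<open>The exponent \<open>s\<close> is chosen for this identity: dividing
      \<open>K\<close> by \<open>1 + \<gamma>\<close> raises \<open>K powr (- s)\<close> by exactly
      the factor \<open>1 / \<beta>\<close> that pays for shrinking \<open>G\<close> by
      \<open>\<beta>\<close>.\<close>
    have "(1 + \<gamma>) powr s = 1 / \<beta>"
      using assms(6-8) by (simp add: powr_def s_def ln_div exp_minus inverse_eq_divide)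
    then have "(K / (1 + \<gamma>)) powr (- s) * \<beta> = K powr (- s)"
      using K1 assms(6-8) by (simp add: powr_minus powr_divide field_simps)
    then have "K powr (- s) * card G = (K / (1 + \<gamma>)) powr (- s) * (\<beta> * card G)" by simp
    also have "\<dots> \<le> (K / (1 + \<gamma>)) powr (- s) * card G1" using v1 by (intro mult_left_mono) auto
    also note IHc
    finally have "K powr (- s) * card G \<le> card G'" .
    then show ?thesis using IH IHq sub
      by (intro exI[of _ A'] exI[of _ B'] exI[of _ G']) auto
  qed
qed

text \<open>
  The reference output distribution is mixed with the output of uniform inputs, because otherwise
  letters of small \<open>q\<close>-probability could have an arbitrarily large divergence.
\<close>
lemma smoothed_information_bound:
  fixes V :: "'x::finite \<Rightarrow> 'y::finite pmf" and q :: "'x pmf" and f :: "'x \<Rightarrow> real"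
  assumes \<tau>: "0 < \<tau>" "\<tau> < 1" and \<beta>: "0 \<le> \<beta>" and \<gamma>: "0 \<le> \<gamma>"
    and f: "\<And>x. f x \<le> (1 + \<gamma>) * pmf q x + \<beta>"
  defines "Q \<equiv> bind_pmf (bernoulli_pmf \<tau>) (\<lambda>c. if c then bind_pmf (pmf_of_set UNIV) V else bind_pmf q V)"
  shows "(\<Sum>x\<in>UNIV. f x * kl_div (V x) Q)
     \<le> (1 + \<gamma>) * (info V q - log 2 (1 - \<tau>)) + \<beta> * (CARD('x) * log 2 (CARD('x) / \<tau>))"
    and "set_pmf (V x) \<subseteq> set_pmf Q"
proof -
  let ?N = "real CARD('x)"
  have N: "0 < ?N" by simp
  have pQ: "pmf Q y = \<tau> * pmf (bind_pmf (pmf_of_set UNIV) V) y + (1 - \<tau>) * pmf (bind_pmf q V) y" for y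
    unfolding Q_def using \<tau> by (subst pmf_bind, subst integral_measure_pmf[of UNIV]) (auto simp: UNIV_bool)
  have pu: "pmf (bind_pmf (pmf_of_set UNIV) V) y = (\<Sum>x\<in>UNIV. pmf (V x) y) / ?N" for y
    by (subst pmf_bind, subst integral_pmf_of_set) auto
  \<comment> \<open>The uniform component of \<open>Q\<close>, of weight \<open>\<tau>\<close>,
    dominates every \<open>V x\<close> up to this factor. This caps the divergences that are
    weighted by the additive slack \<open>\<beta>\<close>.\<close>
  have K: "pmf (V x) y \<le> ?N / \<tau> * pmf Q y" for x y
  proof -
    have "pmf (V x) y \<le> (\<Sum>x\<in>UNIV. pmf (V x) y)" by (rule member_le_sum) auto
    also have "\<dots> = ?N / \<tau> * (\<tau> * pmf (bind_pmf (pmf_of_set UNIV) V) y)" using \<tau> N unfolding pu by simp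
    also have "\<dots> \<le> ?N / \<tau> * pmf Q y" using \<tau> unfolding pQ by (intro mult_left_mono) auto
    finally show ?thesis .
  qed
  show ac: "set_pmf (V x) \<subseteq> set_pmf Q" for x
  proof
    fix y assume "y \<in> set_pmf (V x)"
    then have "0 < ?N / \<tau> * pmf Q y" using K[of x y] by (simp add: pmf_positive_iff[symmetric] less_le_trans)
    then show "y \<in> set_pmf Q" by (auto simp: set_pmf_iff)
  qed
  have nn: "0 \<le> kl_div (V x) Q" for x using ac by (intro kl_div_nonneg) auto
  have up: "kl_div (V x) Q \<le> log 2 (?N / \<tau>)" for x
    using K \<tau> N by (intro kl_div_le_log) auto
  \<comment> \<open>The other component has weight \<open>1 - \<tau>\<close>, so for letters charged
    by \<open>q\<close> smoothing costs only \<open>- log 2 (1 - \<tau>)\<close>.\<close>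
  have up2: "pmf q x * kl_div (V x) Q \<le> pmf q x * (kl_div (V x) (bind_pmf q V) - log 2 (1 - \<tau>))" for x
  proof (cases "pmf q x = 0")
    case False
    then have "x \<in> set_pmf q" by (simp add: set_pmf_iff)
    then show ?thesis using \<tau> by (intro mult_left_mono kl_div_mono_right) (auto simp: pQ)
  qed simp
  have "(\<Sum>x\<in>UNIV. f x * kl_div (V x) Q) \<le> (\<Sum>x\<in>UNIV. (1 + \<gamma>) * (pmf q x * kl_div (V x) Q) + \<beta> * kl_div (V x) Q)"
  proof (rule sum_mono)
    fix x show "f x * kl_div (V x) Q \<le> (1 + \<gamma>) * (pmf q x * kl_div (V x) Q) + \<beta> * kl_div (V x) Q"
      using mult_right_mono[OF f[of x] nn[of x]] by (simp add: distrib_right mult.assoc)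
  qed
  also have "\<dots> \<le> (\<Sum>x\<in>UNIV. (1 + \<gamma>) * (pmf q x * (kl_div (V x) (bind_pmf q V) - log 2 (1 - \<tau>))) + \<beta> * log 2 (?N / \<tau>))"
    using \<gamma> \<beta> by (intro sum_mono add_mono mult_left_mono up up2) auto
  also have "\<dots> = (1 + \<gamma>) * ((\<Sum>x\<in>UNIV. pmf q x * kl_div (V x) (bind_pmf q V)) - log 2 (1 - \<tau>) * (\<Sum>x\<in>UNIV. pmf q x)) + \<beta> * (?N * log 2 (?N / \<tau>))"
  proof -
    have "(\<Sum>x\<in>UNIV. pmf q x * (kl_div (V x) (bind_pmf q V) - log 2 (1 - \<tau>)))
        = (\<Sum>x\<in>UNIV. pmf q x * kl_div (V x) (bind_pmf q V)) - log 2 (1 - \<tau>) * (\<Sum>x\<in>UNIV. pmf q x)"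
      by (simp only: right_diff_distrib sum_subtractf sum_distrib_right[symmetric] mult.commute)
    then show ?thesis by (simp only: sum.distrib sum_distrib_left[symmetric]) simp
  qed
  also have "(\<Sum>x\<in>UNIV. pmf q x) = 1" by (rule sum_pmf_eq_1) auto
  finally show "(\<Sum>x\<in>UNIV. f x * kl_div (V x) Q)
     \<le> (1 + \<gamma>) * (info V q - log 2 (1 - \<tau>)) + \<beta> * (?N * log 2 (?N / \<tau>))"
    unfolding info_sum by simp
qed

lemma pmf_map_pmf_of_set:
  assumes "finite A" "A \<noteq> {}"
  shows "pmf (map_pmf f (pmf_of_set A)) a = card {i \<in> A. f i = a} / card A"
  using assms by (simp add: pmf_map measure_pmf_of_set vimage_def Int_def conj_commute)

text \<open>Good pairs have density at least \<open>1 / (2 * k1 * k2)\<close> in a product of two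
  enlarged codebooks, so wringing with \<open>K = 2 * k1 * k2\<close> loses \<open>s\<close> times
  \<open>log 2 K\<close>, about \<open>n * s * (a + b)\<close> bits. In every position the surviving
  letter pairs have frequencies at most \<open>1 + \<gamma>\<close> times a product law plus
  \<open>\<beta>\<close>, and the smoothed reference output converts this into the first two terms
  of the bound.\<close>

lemma small_cooperation_converse:
  fixes W :: "'a::finite \<Rightarrow> 'b::finite \<Rightarrow> 'c::finite pmf"
  assumes a: "achievable_informed W (a, b) (R1, R2)" and ab: "0 \<le> a" "0 \<le> b"
    and I: "\<And>q1 q2. info (case_prod W) (pair_pmf q1 q2) \<le> C0"
    and par: "0 < \<gamma>" "0 < \<beta>" "\<beta> < 1" "0 < \<tau>" "\<tau> < 1"
  defines "N \<equiv> real CARD('a \<times> 'b)"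
  shows "R1 + R2 \<le> (1 + \<gamma>) * (C0 - log 2 (1 - \<tau>)) + \<beta> * (N * log 2 (N / \<tau>)) + ln (1 / \<beta>) / ln (1 + \<gamma>) * (a + b)"
proof -
  define s where "s = ln (1 / \<beta>) / ln (1 + \<gamma>)"
  define U where "U = (1 + \<gamma>) * (C0 - log 2 (1 - \<tau>)) + \<beta> * (N * log 2 (N / \<tau>))"
  have s0: "0 \<le> s" using par by (simp add: s_def)
  have R: "0 \<le> R1" "0 \<le> R2" using a by (auto simp: achievable_informed_def)
  let ?V = "case_prod W"
  have "R1 + R2 - s * (a + b) \<le> U"
  \<comment> \<open>The constants: 3 from \<open>log_message_pairs\<close>, \<open>s\<close> from
    the factor 2 in \<open>K\<close>, \<open>1 / ln 2\<close> from the converse.\<close>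
  proof (rule rate_limit[where c = "3 + s + 1 / ln 2"])
    fix e :: real assume e: "0 < e" "e < 1"
    have "0 < e / 2" using e by simp
    from achievable_informedD[OF a this]
    show "\<forall>\<^sub>F n in sequentially. (1 - e) * (real n * (R1 + R2 - s * (a + b)) - (3 + s + 1 / ln 2)) \<le> real n * U + (3 + s + 1 / ln 2)"
    proof eventually_elim
      case (elim n)
      define M1 where "M1 = {..<nat \<lfloor>2 powr (real n * R1)\<rfloor>}"
      define M2 where "M2 = {..<nat \<lfloor>2 powr (real n * R2)\<rfloor>}"
      define k1 where "k1 = nat \<lfloor>2 powr (real n * a)\<rfloor>"
      define k2 where "k2 = nat \<lfloor>2 powr (real n * b)\<rfloor>"
      have "coop_code W n M1 M2 k1 k2 (e / 2)" using elim by (simp add: M1_def M2_def k1_def k2_def)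
      then obtain x1 x2 g G where gp: "good_pairs W n M1 M2 k1 k2 e x1 x2 g G"
        using coop_code_good_pairs e(1) by blast
      have finM: "finite M1" "finite M2" by (simp_all add: M1_def M2_def)
      have GM: "G \<subseteq> M1 \<times> M2" and G2: "card M1 * card M2 \<le> 2 * card G"
        and k: "\<And>w1. w1 \<in> M1 \<Longrightarrow> card (x1 w1 ` M2) \<le> k1" "\<And>w2. w2 \<in> M2 \<Longrightarrow> card ((\<lambda>w1. x2 w1 w2) ` M1) \<le> k2"
        using gp by (auto simp: good_pairs_def)
      have err: "measure_pmf.prob (pair_output W n (x1 w1 w2) (x2 w1 w2)) {y. g y \<noteq> (w1, w2)} \<le> e"
        if "(w1, w2) \<in> G" for w1 w2 using gp that by (auto simp: good_pairs_def)
      have k1pos: "1 \<le> k1" "1 \<le> k2" unfolding k1_def k2_def using ab by (intro nat_floor_ge_1 two_powr_ge_1; simp)+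
      have Mpos: "1 \<le> card M1" "1 \<le> card M2" unfolding M1_def M2_def card_lessThan using R by (intro nat_floor_ge_1 two_powr_ge_1; simp)+
      have lg: "real n * (R1 + R2) - 3 \<le> log 2 (card G)"
        using log_message_pairs[OF R, of n G] G2 by (simp add: M1_def M2_def)
      have finG: "finite G" using GM finM finite_subset by blast
      have neG: "G \<noteq> {}" using G2 mult_le_mono[OF Mpos] by auto
      \<comment> \<open>A codeword depends on both messages, whereas wringing needs points that
        determine their letters alone. The points of \<open>A\<close> and \<open>B\<close> are
        therefore messages together with one of their possible codewords; \<open>lift\<close> sends
        a message pair to the codewords it actually uses.\<close>
      define A where "A = (SIGMA w1:M1. x1 w1 ` M2)"
      define B where "B = (SIGMA w2:M2. (\<lambda>w1. x2 w1 w2) ` M1)"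
      define lift where "lift = (\<lambda>(w1, w2). ((w1, x1 w1 w2), (w2, x2 w1 w2)))"
      define H where "H = lift ` G"
      have finAB: "finite A" "finite B" using finM by (auto simp: A_def B_def)
      have cA: "card A \<le> card M1 * k1"
        using sum_bounded_above[of M1 "\<lambda>w1. card (x1 w1 ` M2)" k1] finM k(1) by (simp add: A_def card_SigmaI)
      have cB: "card B \<le> card M2 * k2"
        using sum_bounded_above[of M2 "\<lambda>w2. card ((\<lambda>w1. x2 w1 w2) ` M1)" k2] finM k(2) by (simp add: B_def card_SigmaI)
      have HAB: "H \<subseteq> A \<times> B" using GM by (auto simp: H_def lift_def A_def B_def)
      have neH: "H \<noteq> {}" using neG by (simp add: H_def)
      have "inj lift" by (auto simp: lift_def inj_on_def)
      then have cH: "card H = card G" unfolding H_def by (metis card_image inj_on_subset subset_UNIV)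
      have "card A * card B \<le> (card M1 * k1) * (card M2 * k2)" by (rule mult_le_mono[OF cA cB])
      also have "\<dots> = (k1 * k2) * (card M1 * card M2)" by (simp add: ac_simps)
      also have "\<dots> \<le> (k1 * k2) * (2 * card H)" using G2 cH by (intro mult_le_mono2) simp
      also have "\<dots> = 2 * k1 * k2 * card H" by (simp add: ac_simps)
      finally have "real (card A * card B) \<le> real (2 * k1 * k2 * card H)" by (simp only: of_nat_le_iff)
      then have AB: "real (card A) * real (card B) \<le> real (2 * k1 * k2) * card H" by simp
      obtain A' B' G' where w: "A' \<subseteq> A" "B' \<subseteq> B" "A' \<noteq> {}" "B' \<noteq> {}" "G' \<subseteq> H" "G' \<subseteq> A' \<times> B'" "G' \<noteq> {}"
        and wc: "real (2 * k1 * k2) powr (- s) * card H \<le> card G'"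
        and wq: "\<And>t a b. real (card {w \<in> G'. snd (fst w) t = a \<and> snd (snd w) t = b})
           \<le> ((1 + \<gamma>) * (card {i \<in> A'. snd i t = a} / card A' * (card {j \<in> B'. snd j t = b} / card B')) + \<beta>) * card G'"
        using wringing[OF finAB HAB neH AB par(1-3), of snd snd] unfolding s_def by blast
      have fin': "finite A'" "finite B'" "finite G'" using w finAB HAB finite_subset by (blast, blast, metis finite_SigmaI)
      have cG': "0 < real (card G')" using fin' w by (simp add: card_gt_0_iff)
      define u :: "(nat \<times> (nat \<Rightarrow> 'a)) \<times> nat \<times> (nat \<Rightarrow> 'b) \<Rightarrow> nat \<Rightarrow> 'a \<times> 'b"
        where "u = (\<lambda>w t. (snd (fst w) t, snd (snd w) t))"
      define g' where "g' y = lift (g y)" for y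
      define q where "q t = pair_pmf (map_pmf (\<lambda>i. snd i t) (pmf_of_set A')) (map_pmf (\<lambda>j. snd j t) (pmf_of_set B'))" for t
      define Q where "Q t = bind_pmf (bernoulli_pmf \<tau>) (\<lambda>c. if c then bind_pmf (pmf_of_set UNIV) ?V else bind_pmf (q t) ?V)" for t
      define p where "p t x = real (card {w \<in> G'. u w t = x}) / card G'" for t x
      have pq: "p t x \<le> (1 + \<gamma>) * pmf (q t) x + \<beta>" for t x
      proof -
        obtain xa xb where x: "x = (xa, xb)" by (cases x)
        have "real (card {w \<in> G'. u w t = x}) \<le> ((1 + \<gamma>) * pmf (q t) x + \<beta>) * card G'"
          using wq[of t xa xb] unfolding x q_def pmf_pair using fin' w by (simp add: pmf_map_pmf_of_set u_def)
        then show ?thesis using cG' by (simp add: p_def field_simps)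
      qed
      have "real (card G') * ((1 - e) * log 2 (card G') - 1 / ln 2) \<le> (\<Sum>w\<in>G'. \<Sum>t=1..n. kl_div (?V (u w t)) (Q t))"
      proof (rule converse_bound[where V = ?V and u = u and g = g' and e = e and n = n and Q = Q, OF fin'(3) w(7)])
        fix i assume i: "i \<in> G'"
        then obtain w1 w2 where ii: "(w1, w2) \<in> G" "i = lift (w1, w2)" using w(5) by (auto simp: H_def)
        have "{y. g' y \<noteq> i} \<subseteq> {y. g y \<noteq> (w1, w2)}" by (auto simp: g'_def ii)
        then have "measure_pmf.prob (channel_output ?V n (u i)) {y. g' y \<noteq> i} \<le> measure_pmf.prob (channel_output ?V n (u i)) {y. g y \<noteq> (w1, w2)}"
          by (intro measure_pmf.finite_measure_mono) auto
        moreover have "channel_output ?V n (u i) = pair_output W n (x1 w1 w2) (x2 w1 w2)"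
          by (simp add: pair_output_eq_channel_output u_def ii lift_def)
        ultimately show "measure_pmf.prob (channel_output ?V n (u i)) {y. g' y \<noteq> i} \<le> e"
          using err[OF ii(1)] by simp
        show "set_pmf (?V (u i t)) \<subseteq> set_pmf (Q t)" for t
          unfolding Q_def by (rule smoothed_information_bound(2)[OF par(4,5) _ _ pq[of t]]) (use par in auto)
      qed
      also have "\<dots> = (\<Sum>t=1..n. \<Sum>w\<in>G'. kl_div (?V (u w t)) (Q t))" by (rule sum.swap)
      also have "\<dots> \<le> (\<Sum>t=1..n. real (card G') * U)"
      proof (rule sum_mono)
        fix t
        have "(\<Sum>w\<in>G'. kl_div (?V (u w t)) (Q t)) = (\<Sum>x\<in>UNIV. \<Sum>w\<in>{w \<in> G'. u w t = x}. kl_div (?V (u w t)) (Q t))"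
          using fin' by (intro sum.group[symmetric]) auto
        also have "\<dots> = (\<Sum>x\<in>UNIV. real (card {w \<in> G'. u w t = x}) * kl_div (?V x) (Q t))"
          by (intro sum.cong refl) simp
        also have "\<dots> = real (card G') * (\<Sum>x\<in>UNIV. p t x * kl_div (?V x) (Q t))"
          using cG' by (simp add: p_def sum_distrib_left)
        also have "\<dots> \<le> real (card G') * U"
        proof (rule mult_left_mono)
          have "(\<Sum>x\<in>UNIV. p t x * kl_div (?V x) (Q t)) \<le> (1 + \<gamma>) * (info ?V (q t) - log 2 (1 - \<tau>)) + \<beta> * (N * log 2 (N / \<tau>))"
            unfolding Q_def N_def by (rule smoothed_information_bound(1)[OF par(4,5) _ _ pq[of t]]) (use par in auto)
          also have "\<dots> \<le> U" unfolding U_def using I par by (intro add_mono mult_left_mono diff_mono) (auto simp: q_def N_def)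
          finally show "(\<Sum>x\<in>UNIV. p t x * kl_div (?V x) (Q t)) \<le> U" .
        qed simp
        finally show "(\<Sum>w\<in>G'. kl_div (?V (u w t)) (Q t)) \<le> real (card G') * U" .
      qed
      also have "\<dots> = real (card G') * (n * U)" by simp
      finally have main: "(1 - e) * log 2 (card G') - 1 / ln 2 \<le> n * U" using cG' by simp
      have lk: "log 2 (real (2 * k1 * k2)) \<le> 1 + n * (a + b)"
      proof -
        have "real (2 * k1 * k2) \<le> 2 * 2 powr (real n * a) * 2 powr (real n * b)"
          unfolding k1_def k2_def of_nat_mult of_nat_numeral by (intro mult_mono nat_floor_le) auto
        also have "\<dots> = 2 powr (1 + n * (a + b))" by (simp add: powr_add distrib_left)
        finally show ?thesis using k1pos by (subst log_le_iff) auto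
      qed
      have "real n * (R1 + R2 - s * (a + b)) - (3 + s) \<le> log 2 (card G')"
      proof -
        have cH0: "0 < real (card H)" using cH finG neG by (simp add: card_gt_0_iff)
        have K0: "0 < real (2 * k1 * k2)" using k1pos by simp
        have "0 < real (2 * k1 * k2) powr (- s)" using K0 powr_gt_zero[of "real (2 * k1 * k2)" "- s"] by linarith
        then have "0 < real (2 * k1 * k2) powr (- s) * card H" using cH0 by (rule mult_pos_pos)
        then have "log 2 (real (2 * k1 * k2) powr (- s) * card H) \<le> log 2 (card G')"
          using wc cG' by (intro log_le_cancel_iff[THEN iffD2]) auto
        moreover have "log 2 (real (2 * k1 * k2) powr (- s) * card H) = - s * log 2 (real (2 * k1 * k2)) + log 2 (card H)"
          using cH0 K0 k1pos by (simp add: log_mult log_powr)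
        moreover have "s * log 2 (real (2 * k1 * k2)) \<le> s * (1 + n * (a + b))" using lk s0 by (rule mult_left_mono)
        ultimately show ?thesis using lg cH by (simp add: algebra_simps)
      qed
      then have "(1 - e) * (real n * (R1 + R2 - s * (a + b)) - (3 + s)) \<le> (1 - e) * log 2 (card G')"
        using e by (intro mult_left_mono) auto
      then have "(1 - e) * (real n * (R1 + R2 - s * (a + b)) - (3 + s)) \<le> n * U + 1 / ln 2" using main by linarith
      moreover have "0 \<le> (1 - e) * (1 / ln 2)" using e by simp
      moreover have "(1 - e) * (real n * (R1 + R2 - s * (a + b)) - (3 + s + 1 / ln 2)) =
        (1 - e) * (real n * (R1 + R2 - s * (a + b)) - (3 + s)) - (1 - e) * (1 / ln 2)"
        by (simp only: right_diff_distrib distrib_left diff_diff_eq)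
      ultimately show ?case using s0 by linarith
    qed
  qed
  then show ?thesis unfolding U_def s_def by linarith
qed

section \<open>Moving cooperation from one encoder to the other\<close>

lemma nat_floor_powr_mono: "x \<le> y \<Longrightarrow> nat \<lfloor>2 powr x\<rfloor> \<le> nat \<lfloor>2 powr (y::real)\<rfloor>"
  by (intro nat_mono floor_mono powr_mono) auto

text \<open>A code of length about \<open>n / l\<close> for capacities \<open>l * a\<close>,
  \<open>l * b\<close> needs no more link values than \<open>a\<close>, \<open>b\<close> allow at
  length \<open>n\<close>; the remaining channel uses stay idle. The rates are divided by
  \<open>l\<close>, and \<open>\<theta>\<close> absorbs rounding \<open>n / l\<close> down.\<close>

lemma achievable_informed_scale:
  fixes W :: "'a \<Rightarrow> 'b \<Rightarrow> 'c::finite pmf"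
  assumes a: "achievable_informed W (l * a, l * b) (R1, R2)" and l: "1 \<le> l" and ab: "0 \<le> a" "0 \<le> b" and \<theta>: "0 < \<theta>"
  shows "achievable_informed W (a, b) (max 0 (R1 / l - \<theta>), max 0 (R2 / l - \<theta>))"
proof (rule achievable_informedI)
  fix e :: real assume "e > 0"
  have R: "0 \<le> R1" "0 \<le> R2" using a by (auto simp: achievable_informed_def)
  from achievable_informedD[OF a \<open>e > 0\<close>] obtain N where N: "\<And>m. m \<ge> N \<Longrightarrow>
     coop_code W m {..<nat \<lfloor>2 powr (real m * R1)\<rfloor>} {..<nat \<lfloor>2 powr (real m * R2)\<rfloor>}
       (nat \<lfloor>2 powr (real m * (l * a))\<rfloor>) (nat \<lfloor>2 powr (real m * (l * b))\<rfloor>) e"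
    unfolding eventually_sequentially by blast
  obtain N1 where N1: "l * (real N + 1) \<le> real N1" using real_arch_simple by blast
  obtain N2 where N2: "max R1 R2 / \<theta> \<le> real N2" using real_arch_simple by blast
  show "\<forall>\<^sub>F n in sequentially. \<exists>m1 m2 k1 k2.
       coop_code W n {..<m1::nat} {..<m2::nat} k1 k2 e \<and>
       nat \<lfloor>2 powr (real n * max 0 (R1 / l - \<theta>))\<rfloor> \<le> m1 \<and> nat \<lfloor>2 powr (real n * max 0 (R2 / l - \<theta>))\<rfloor> \<le> m2 \<and>
       k1 \<le> nat \<lfloor>2 powr (real n * a)\<rfloor> \<and> k2 \<le> nat \<lfloor>2 powr (real n * b)\<rfloor>"
    using eventually_ge_at_top[of N1] eventually_ge_at_top[of N2]
  proof eventually_elim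
    case (elim n)
    define m where "m = nat \<lfloor>real n / l\<rfloor>"
    have ml: "real m \<le> n / l" unfolding m_def using l by (intro nat_floor_le) auto
    have mg: "n / l - 1 \<le> real m" unfolding m_def by linarith
    have "l * (real N + 1) \<le> n" using N1 elim(1) by linarith
    then have "real N + 1 \<le> n / l" using l by (simp add: field_simps)
    then have "N \<le> m" using mg by linarith
    have "n / l \<le> n" using l mult_left_mono[of 1 l "real n"] by (simp add: field_simps)
    then have "m \<le> n" using ml by linarith
    have ml': "real m * l \<le> n" using ml l by (simp add: field_simps)
    have rate: "n * max 0 (R / l - \<theta>) \<le> m * R" if R: "0 \<le> R" "R \<le> max R1 R2" for R :: real
    proof (cases "R / l \<le> \<theta>")
      case False
      have "max R1 R2 / \<theta> \<le> n" using N2 elim(2) by linarith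
      then have "max R1 R2 \<le> n * \<theta>" using \<theta> by (simp only: pos_divide_le_eq)
      then have "R \<le> n * \<theta>" using R by linarith
      moreover have "(n / l - 1) * R \<le> m * R" using mg R by (intro mult_right_mono) auto
      ultimately show ?thesis using False by (simp add: algebra_simps)
    qed (use R in auto)
    have cap: "m * (l * c) \<le> n * c" if "0 \<le> c" for c :: real
      using mult_right_mono[OF ml' that] by (simp add: mult.assoc)
    show ?case
      using coop_code_pad[OF N[OF \<open>N \<le> m\<close>] \<open>m \<le> n\<close>]
        nat_floor_powr_mono[OF rate[of R1]] nat_floor_powr_mono[OF rate[of R2]] nat_floor_powr_mono[OF cap[OF ab(1)]]
        nat_floor_powr_mono[OF cap[OF ab(2)]] R by auto
  qed
qed auto

text \<open>By double counting some \<open>i\<close> covers at least the fraction \<open>d\<close>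
  of the elements of \<open>T\<close> still uncovered, so each choice multiplies their number by at
  most \<open>1 - d\<close>.\<close>

lemma greedy_cover:
  fixes d :: real
  assumes fin: "finite U" "finite T" and U: "U \<noteq> {}" and d: "d \<le> 1"
    and dense: "\<And>j. j \<in> T \<Longrightarrow> d * card U \<le> card {i \<in> U. (i, j) \<in> H}"
  shows "\<exists>B\<subseteq>U. card B \<le> L \<and> real (card {j \<in> T. \<forall>i\<in>B. (i, j) \<notin> H}) \<le> (1 - d) ^ L * card T"
proof (induction L)
  case 0
  then show ?case by (intro exI[of _ "{}"]) auto
next
  case (Suc L)
  then obtain B where B: "B \<subseteq> U" "card B \<le> L"
    and unc: "real (card {j \<in> T. \<forall>i\<in>B. (i, j) \<notin> H}) \<le> (1 - d) ^ L * card T" by blast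
  define T' where "T' = {j \<in> T. \<forall>i\<in>B. (i, j) \<notin> H}"
  have finT': "finite T'" using fin by (simp add: T'_def)
  have "\<exists>i\<in>U. d * card T' \<le> card {j \<in> T'. (i, j) \<in> H}"
  proof (rule ccontr)
    assume "\<not> ?thesis"
    then have "(\<Sum>i\<in>U. real (card {j \<in> T'. (i, j) \<in> H})) < (\<Sum>i\<in>U. d * card T')"
      using fin U by (intro sum_strict_mono) (auto simp: not_le)
    moreover have "(\<Sum>i\<in>U. card {j \<in> T'. (i, j) \<in> H}) = (\<Sum>j\<in>T'. card {i \<in> U. (i, j) \<in> H})"
      using fin finT' sum.swap_restrict[of U T' "\<lambda>_ _. 1::nat" "\<lambda>i j. (i, j) \<in> H"] by simp
    then have "(\<Sum>i\<in>U. real (card {j \<in> T'. (i, j) \<in> H})) = (\<Sum>j\<in>T'. real (card {i \<in> U. (i, j) \<in> H}))"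
      by (simp only: of_nat_sum[symmetric])
    moreover have "(\<Sum>j\<in>T'. d * card U) \<le> (\<Sum>j\<in>T'. real (card {i \<in> U. (i, j) \<in> H}))"
      by (intro sum_mono dense) (auto simp: T'_def)
    ultimately show False by (simp add: ac_simps)
  qed
  then obtain i where i: "i \<in> U" "d * card T' \<le> card {j \<in> T'. (i, j) \<in> H}" by blast
  have "{j \<in> T. \<forall>i\<in>insert i B. (i, j) \<notin> H} = T' - {j \<in> T'. (i, j) \<in> H}" by (auto simp: T'_def)
  then have "real (card {j \<in> T. \<forall>i\<in>insert i B. (i, j) \<notin> H}) = real (card T') - card {j \<in> T'. (i, j) \<in> H}"
    using finT' by (simp add: card_Diff_subset card_mono of_nat_diff)
  also have "\<dots> \<le> (1 - d) * card T'" using i by (simp add: algebra_simps)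
  also have "\<dots> \<le> (1 - d) * ((1 - d) ^ L * card T)" using unc d unfolding T'_def[symmetric] by (intro mult_left_mono) auto
  finally have "real (card {j \<in> T. \<forall>i\<in>insert i B. (i, j) \<notin> H}) \<le> (1 - d) ^ Suc L * card T" by simp
  moreover have "card (insert i B) \<le> Suc L" using B(2) card_insert_le_m1[of "Suc L" B i] by simp
  ultimately show ?case using B i by (intro exI[of _ "insert i B"]) auto
qed

text \<open>Bins are taken greedily from the messages not yet used. The bound on
  \<open>N * L\<close> keeps the used part below \<open>d * card M\<close>, half of what each
  \<open>j\<close> is guaranteed, so density \<open>d\<close> persists. After \<open>L\<close>
  choices fewer than one element of \<open>T\<close> is uncovered, hence none.\<close>

lemma disjoint_covering_bins:
  fixes d :: real
  assumes fin: "finite M" "finite T" and ne: "M \<noteq> {}" "T \<noteq> {}" and d: "0 < d" "d \<le> 1"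
    and dense: "\<And>j. j \<in> T \<Longrightarrow> 2 * d * card M \<le> card {i \<in> M. (i, j) \<in> H}"
    and L: "exp (- (d * real L)) * card T < 1" and N: "real N * real L \<le> d * card M"
  shows "\<exists>B. (\<forall>v<N. B v \<subseteq> M \<and> card (B v) \<le> L \<and> (\<forall>j\<in>T. \<exists>i\<in>B v. (i, j) \<in> H)) \<and> disjoint_family_on B {..<N}"
  using N
proof (induction N)
  case 0
  then show ?case by (auto simp: disjoint_family_on_def)
next
  case (Suc N)
  then have "real N * L \<le> d * card M" by (simp add: distrib_right)
  then obtain B where B: "\<And>v. v < N \<Longrightarrow> B v \<subseteq> M \<and> card (B v) \<le> L \<and> (\<forall>j\<in>T. \<exists>i\<in>B v. (i, j) \<in> H)"
    and dj: "disjoint_family_on B {..<N}" using Suc.IH by blast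
  define X where "X = (\<Union>v<N. B v)"
  define U where "U = M - X"
  have XM: "X \<subseteq> M" using B by (auto simp: X_def)
  have finX: "finite X" using XM fin finite_subset by blast
  have "card X \<le> (\<Sum>v<N. card (B v))" unfolding X_def by (rule card_UN_le) simp
  also have "\<dots> \<le> N * L" using sum_bounded_above[of "{..<N}" "\<lambda>v. card (B v)" L] B by auto
  finally have "real (card X) \<le> real (N * L)" by (simp only: of_nat_le_iff)
  also have "\<dots> \<le> d * card M" using \<open>real N * L \<le> d * card M\<close> by simp
  finally have X: "real (card X) \<le> d * card M" .
  have finU: "finite U" using fin by (simp add: U_def)
  have dense': "d * card M \<le> card {i \<in> U. (i, j) \<in> H}" if j: "j \<in> T" for j
  proof -
    have "{i \<in> M. (i, j) \<in> H} \<subseteq> {i \<in> U. (i, j) \<in> H} \<union> X" by (auto simp: U_def)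
    then have "card {i \<in> M. (i, j) \<in> H} \<le> card ({i \<in> U. (i, j) \<in> H} \<union> X)" using finU finX by (intro card_mono) auto
    also have "\<dots> \<le> card {i \<in> U. (i, j) \<in> H} + card X" by (rule card_Un_le)
    finally have "real (card {i \<in> M. (i, j) \<in> H}) \<le> card {i \<in> U. (i, j) \<in> H} + real (card X)" by simp
    then show ?thesis using dense[OF j] X by linarith
  qed
  have cM: "0 < real (card M)" using fin ne by (simp add: card_gt_0_iff)
  obtain j0 where "j0 \<in> T" using ne by blast
  moreover have "0 < d * card M" using d cM by simp
  ultimately have "0 < real (card {i \<in> U. (i, j0) \<in> H})" using dense'[of j0] by linarith
  then have Une: "U \<noteq> {}" by auto
  have "card U \<le> card M" using fin by (auto simp: U_def intro: card_mono)
  then have "d * card U \<le> d * card M" using d by (intro mult_left_mono) auto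
  then have "d * card U \<le> card {i \<in> U. (i, j) \<in> H}" if "j \<in> T" for j using dense'[OF that] by linarith
  from greedy_cover[OF finU fin(2) Une d(2) this, of L]
  obtain C where C: "C \<subseteq> U" "card C \<le> L" and unc: "real (card {j \<in> T. \<forall>i\<in>C. (i, j) \<notin> H}) \<le> (1 - d) ^ L * card T" by blast
  have "(1 - d) ^ L \<le> exp (- d) ^ L" using d exp_ge_add_one_self[of "- d"] by (intro power_mono) auto
  also have "\<dots> = exp (- (d * real L))" by (simp add: exp_of_nat_mult[symmetric] mult.commute)
  finally have "(1 - d) ^ L * card T \<le> exp (- (d * real L)) * card T" by (intro mult_right_mono) auto
  then have "card {j \<in> T. \<forall>i\<in>C. (i, j) \<notin> H} = 0" using unc L by linarith
  then have "{j \<in> T. \<forall>i\<in>C. (i, j) \<notin> H} = {}" using fin by simp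
  then have cov: "\<forall>j\<in>T. \<exists>i\<in>C. (i, j) \<in> H" by blast
  define B' where "B' v = (if v < N then B v else C)" for v
  have "B' v \<subseteq> M \<and> card (B' v) \<le> L \<and> (\<forall>j\<in>T. \<exists>i\<in>B' v. (i, j) \<in> H)" for v
    using B[of v] C cov by (auto simp: B'_def U_def)
  moreover have "disjoint_family_on B' {..<Suc N}"
    using dj C(1) unfolding disjoint_family_on_def B'_def U_def X_def by (auto simp: less_Suc_eq)
  ultimately show ?case by blast
qed

lemma pigeonhole_popular:
  fixes A :: "'m set" and f :: "'m \<Rightarrow> 'v"
  assumes "finite A" "card (f ` A) \<le> k"
  shows "\<exists>c. card A \<le> k * card {i \<in> A. f i = c}"
proof (rule ccontr)
  assume "\<not> ?thesis"
  then have c: "k * card {i \<in> A. f i = c} < card A" for c by (auto simp: not_le)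
  have k: "0 < k"
  proof (rule ccontr)
    assume "\<not> 0 < k"
    then have "A = {}" using assms by auto
    then show False using c[of undefined] by simp
  qed
  have "card A = (\<Sum>c\<in>f ` A. card {i \<in> A. f i = c})"
    using sum.group[of A "f ` A" f "\<lambda>_. 1::nat"] assms by simp
  then have "k * card A = (\<Sum>c\<in>f ` A. k * card {i \<in> A. f i = c})" by (simp add: sum_distrib_left)
  also have "\<dots> \<le> (\<Sum>c\<in>f ` A. card A - 1)"
  proof (rule sum_mono)
    fix x show "k * card {i \<in> A. f i = x} \<le> card A - 1" using c[of x] by linarith
  qed
  also have "\<dots> \<le> k * (card A - 1)" using assms by simp
  finally have "card A \<le> card A - 1" using k by simp
  then show False using c[of undefined] by linarith
qed

text \<open>The new first message is the index \<open>v\<close> of a bin; the facilitator selects in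
  it an old message \<open>sel v w2\<close> that is good with \<open>w2\<close> and for which the
  second encoder uses its frozen codeword \<open>c w2\<close>. The first codeword then takes at most
  \<open>L * k1\<close> values and the second one a single value. \<open>T\<close> keeps the
  \<open>w2\<close> that are good with a quarter of \<open>M1\<close>; popularity of the codeword
  costs \<open>k2\<close>, and reserving half for disjoint bins gives \<open>8 * k2\<close>.\<close>

lemma transfer_code:
  assumes gp: "good_pairs W n M1 M2 k1 k2 e x1 x2 g G" and e: "0 \<le> e"
    and fin: "finite M1" "finite M2" and ne: "M1 \<noteq> {}" "M2 \<noteq> {}" and k2: "1 \<le> k2"
    and N: "real N * real L \<le> 1 / (8 * k2) * card M1" and L: "exp (- (1 / (8 * k2) * real L)) * card M2 < 1"
  shows "\<exists>T\<subseteq>M2. card M2 \<le> 4 * card T \<and> coop_code W n {..<N} T (L * k1) 1 e"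
proof -
  have GM: "G \<subseteq> M1 \<times> M2" and G2: "card M1 * card M2 \<le> 2 * card G"
    and k: "\<And>w1. w1 \<in> M1 \<Longrightarrow> card (x1 w1 ` M2) \<le> k1" "\<And>w2. w2 \<in> M2 \<Longrightarrow> card ((\<lambda>w1. x2 w1 w2) ` M1) \<le> k2"
    using gp by (auto simp: good_pairs_def)
  have err: "measure_pmf.prob (pair_output W n (x1 w1 w2) (x2 w1 w2)) {y. g y \<noteq> (w1, w2)} \<le> e"
    if "(w1, w2) \<in> G" for w1 w2 using gp that by (auto simp: good_pairs_def)
  have cM: "0 < card M1" "0 < card M2" using fin ne by (auto simp: card_gt_0_iff)
  define S where "S w2 = {w1 \<in> M1. (w1, w2) \<in> G}" for w2
  have finS: "finite (S w2)" for w2 using fin by (simp add: S_def)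
  define T where "T = {w2 \<in> M2. card M1 \<le> 4 * card (S w2)}"
  have T: "T \<subseteq> M2" "finite T" using fin by (auto simp: T_def)
  have "G = (\<lambda>(a, b). (b, a)) ` (SIGMA w2:M2. S w2)" using GM by (force simp: S_def)
  then have "card G = card (SIGMA w2:M2. S w2)" by (simp add: card_image inj_on_def split_def prod_eq_iff)
  also have "\<dots> = (\<Sum>w2\<in>M2. card (S w2))" using fin finS by simp
  finally have cG: "card G = (\<Sum>w2\<in>M2. card (S w2))" .
  have "4 * card G = (\<Sum>w2\<in>M2. 4 * card (S w2))" unfolding cG by (simp add: sum_distrib_left)
  also have "\<dots> = (\<Sum>w2\<in>T. 4 * card (S w2)) + (\<Sum>w2\<in>M2 - T. 4 * card (S w2))"
    using T fin by (subst sum.subset_diff[of T]) auto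
  also have "\<dots> \<le> (\<Sum>w2\<in>T. 4 * card M1) + (\<Sum>w2\<in>M2 - T. card M1)"
    using fin by (intro add_mono sum_mono mult_le_mono2 card_mono) (auto simp: S_def T_def)
  also have "\<dots> \<le> 4 * card T * card M1 + card M2 * card M1"
    using fin by (simp add: card_mono mult.commute)
  finally have "2 * (card M1 * card M2) \<le> 4 * card T * card M1 + card M2 * card M1" using G2 by linarith
  then have "card M2 * card M1 \<le> (4 * card T) * card M1" by (simp add: algebra_simps)
  then have cT: "card M2 \<le> 4 * card T" using cM by simp
  then have Tne: "T \<noteq> {}" using cM by auto
  have "\<exists>c. card (S w2) \<le> k2 * card {w1 \<in> S w2. x2 w1 w2 = c}" if "w2 \<in> M2" for w2
  proof (rule pigeonhole_popular[OF finS])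
    have "card ((\<lambda>w1. x2 w1 w2) ` S w2) \<le> card ((\<lambda>w1. x2 w1 w2) ` M1)" using fin by (intro card_mono) (auto simp: S_def)
    then show "card ((\<lambda>w1. x2 w1 w2) ` S w2) \<le> k2" using k(2)[OF that] by linarith
  qed
  then obtain c where c: "\<And>w2. w2 \<in> M2 \<Longrightarrow> card (S w2) \<le> k2 * card {w1 \<in> S w2. x2 w1 w2 = c w2}" by metis
  define H where "H = {(w1, w2). (w1, w2) \<in> G \<and> x2 w1 w2 = c w2}"
  define d where "d = 1 / (8 * real k2)"
  have d: "0 < d" "d \<le> 1" using k2 by (auto simp: d_def)
  have dense: "2 * d * card M1 \<le> card {i \<in> M1. (i, j) \<in> H}" if j: "j \<in> T" for j
  proof -
    have "card M1 \<le> 4 * card (S j)" "card (S j) \<le> k2 * card {w1 \<in> S j. x2 w1 j = c j}" using j c T by (auto simp: T_def)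
    moreover have "{w1 \<in> S j. x2 w1 j = c j} = {i \<in> M1. (i, j) \<in> H}" by (auto simp: S_def H_def)
    ultimately have "card M1 \<le> 4 * (k2 * card {i \<in> M1. (i, j) \<in> H})" by simp
    then have "real (card M1) \<le> real (4 * (k2 * card {i \<in> M1. (i, j) \<in> H}))" by (simp only: of_nat_le_iff)
    then show ?thesis using k2 by (simp add: d_def field_simps)
  qed
  have "exp (- (d * real L)) * card T \<le> exp (- (d * real L)) * card M2" using T fin by (intro mult_left_mono of_nat_mono card_mono) auto
  then have L': "exp (- (d * real L)) * card T < 1"
    by (rule le_less_trans) (use L in \<open>simp add: d_def\<close>)
  have N': "real N * real L \<le> d * card M1" using N by (simp add: d_def)
  obtain B where B: "\<And>v. v < N \<Longrightarrow> B v \<subseteq> M1 \<and> card (B v) \<le> L \<and> (\<forall>j\<in>T. \<exists>i\<in>B v. (i, j) \<in> H)"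
    and dj: "disjoint_family_on B {..<N}"
    using disjoint_covering_bins[OF fin(1) T(2) ne(1) Tne d dense L' N'] by blast
  define sel where "sel v j = (SOME i. i \<in> B v \<and> (i, j) \<in> H)" for v j
  have sel: "sel v j \<in> B v \<and> (sel v j, j) \<in> H" if "v < N" "j \<in> T" for v j
    unfolding sel_def by (rule someI_ex) (use B[OF that(1)] that(2) in blast)
  \<comment> \<open>Bins are disjoint, so the decoded old message determines the new one.\<close>
  define idx where "idx i = (SOME v. v < N \<and> i \<in> B v)" for i
  have idx: "idx i = v" if "v < N" "i \<in> B v" for i v
  proof -
    have "idx i < N \<and> i \<in> B (idx i)" unfolding idx_def by (rule someI_ex) (use that in blast)
    then show ?thesis using dj that unfolding disjoint_family_on_def by blast
  qed
  have "coop_code W n {..<N} T (L * k1) 1 e"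
  proof (rule coop_codeI[where ?x1.0 = "\<lambda>v w2. x1 (sel v w2) w2" and ?x2.0 = "\<lambda>v w2. x2 (sel v w2) w2" and g = "\<lambda>y. (idx (fst (g y)), snd (g y))"])
    fix v assume "v \<in> {..<N}"
    then have v: "v < N" by simp
    have "(\<lambda>w2. x1 (sel v w2) w2) ` T \<subseteq> (\<Union>i\<in>B v. x1 i ` M2)" using sel[OF v] T by blast
    moreover have finB: "finite (B v)" using B[OF v] fin finite_subset by blast
    ultimately have "card ((\<lambda>w2. x1 (sel v w2) w2) ` T) \<le> card (\<Union>i\<in>B v. x1 i ` M2)" using fin by (intro card_mono) auto
    also have "\<dots> \<le> (\<Sum>i\<in>B v. card (x1 i ` M2))" by (rule card_UN_le[OF finB])
    also have "\<dots> \<le> card (B v) * k1" using sum_bounded_above[of "B v" "\<lambda>i. card (x1 i ` M2)" k1] k(1) B[OF v] by auto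
    also have "\<dots> \<le> L * k1" using B[OF v] by simp
    finally show "card ((\<lambda>w2. x1 (sel v w2) w2) ` T) \<le> L * k1" .
  next
    fix w2 assume w2: "w2 \<in> T"
    have "(\<lambda>v. x2 (sel v w2) w2) ` {..<N} \<subseteq> {c w2}" using sel w2 by (auto simp: H_def)
    then show "card ((\<lambda>v. x2 (sel v w2) w2) ` {..<N}) \<le> 1" using card_mono[of "{c w2}"] by auto
  next
    have "(\<Sum>v<N. \<Sum>w2\<in>T. measure_pmf.prob (pair_output W n (x1 (sel v w2) w2) (x2 (sel v w2) w2)) {y. (idx (fst (g y)), snd (g y)) \<noteq> (v, w2)})
      \<le> (\<Sum>v<N. \<Sum>w2\<in>T. e)"
    proof (intro sum_mono)
      fix v w2 assume v: "v \<in> {..<N}" "w2 \<in> T"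
      then have s: "sel v w2 \<in> B v" "(sel v w2, w2) \<in> G" using sel by (auto simp: H_def)
      have "{y. (idx (fst (g y)), snd (g y)) \<noteq> (v, w2)} \<subseteq> {y. g y \<noteq> (sel v w2, w2)}"
        using idx[of v "sel v w2"] v s by auto
      then have "measure_pmf.prob (pair_output W n (x1 (sel v w2) w2) (x2 (sel v w2) w2)) {y. (idx (fst (g y)), snd (g y)) \<noteq> (v, w2)}
        \<le> measure_pmf.prob (pair_output W n (x1 (sel v w2) w2) (x2 (sel v w2) w2)) {y. g y \<noteq> (sel v w2, w2)}"
        by (intro measure_pmf.finite_measure_mono) auto
      also have "\<dots> \<le> e" by (rule err[OF s(2)])
      finally show "measure_pmf.prob (pair_output W n (x1 (sel v w2) w2) (x2 (sel v w2) w2)) {y. (idx (fst (g y)), snd (g y)) \<noteq> (v, w2)} \<le> e" .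
    qed
    then show "(\<Sum>v<N. \<Sum>w2\<in>T. measure_pmf.prob (pair_output W n (x1 (sel v w2) w2) (x2 (sel v w2) w2)) {y. (idx (fst (g y)), snd (g y)) \<noteq> (v, w2)})
      \<le> e * card {..<N} * card T" by (simp add: ac_simps)
  qed (use T in auto)
  then show ?thesis using T cT by blast
qed

text \<open>144 is 9 * 8 * 2: in the next lemma the bin size is at most \<open>9 * D * P\<close>,
  the density contributes \<open>8 * k2\<close>, and a factor 2 is lost in the floor of the message
  count.\<close>

lemma linear_le_exponential:
  assumes "0 < \<delta>" "0 \<le> R"
  shows "\<forall>\<^sub>F n in sequentially. 144 * (real n * R + 1) \<le> 2 powr (real n * \<delta>)"
proof (cases "R = 0")
  case True
  then show ?thesis using assms by simp real_asymp
next
  case False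
  then have "0 < R" using assms by simp
  then show ?thesis using assms(1) by real_asymp
qed

text \<open>Of the \<open>3 * \<delta>\<close> taken from \<open>R1\<close>, one
  \<open>\<delta>\<close> pays for the density \<open>1 / k2\<close>, one for the factor
  \<open>k2\<close> in the bin size, and one for constants and the factor linear in
  \<open>n\<close>. Bins have size at most \<open>D * D\<close>, which raises the first capacity by
  \<open>2 * \<delta>\<close>. The \<open>\<delta>\<close> taken from \<open>R2\<close> pays for
  keeping only a quarter of \<open>M2\<close>.\<close>

lemma transfer_large_rate:
  fixes W :: "'a \<Rightarrow> 'b \<Rightarrow> 'c pmf"
  assumes a: "achievable_informed W (a, \<delta>) (R1, R2)" and a0: "0 \<le> a" and \<delta>: "0 < \<delta>" and R1: "3 * \<delta> \<le> R1"
  shows "achievable_informed W (a + 2 * \<delta>, 0) (R1 - 3 * \<delta>, max 0 (R2 - \<delta>))"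
proof (rule achievable_informedI)
  fix e :: real assume e: "e > 0"
  have R: "0 \<le> R1" "0 \<le> R2" using a by (auto simp: achievable_informed_def)
  from e have "0 < e / 2" by simp
  from achievable_informedD[OF a this] linear_le_exponential[OF \<delta> R(2)]
  show "\<forall>\<^sub>F n in sequentially. \<exists>m1 m2 k1 k2.
       coop_code W n {..<m1::nat} {..<m2::nat} k1 k2 e \<and>
       nat \<lfloor>2 powr (real n * (R1 - 3 * \<delta>))\<rfloor> \<le> m1 \<and> nat \<lfloor>2 powr (real n * (max 0 (R2 - \<delta>)))\<rfloor> \<le> m2 \<and>
       k1 \<le> nat \<lfloor>2 powr (real n * (a + 2 * \<delta>))\<rfloor> \<and> k2 \<le> nat \<lfloor>2 powr (real n * 0)\<rfloor>"
  proof eventually_elim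
    case (elim n)
    define M1 where "M1 = {..<nat \<lfloor>2 powr (real n * R1)\<rfloor>}"
    define M2 where "M2 = {..<nat \<lfloor>2 powr (real n * R2)\<rfloor>}"
    define k1 where "k1 = nat \<lfloor>2 powr (real n * a)\<rfloor>"
    define k2 where "k2 = nat \<lfloor>2 powr (real n * \<delta>)\<rfloor>"
    have "coop_code W n M1 M2 k1 k2 (e / 2)" using elim(1) by (simp add: M1_def M2_def k1_def k2_def)
    then obtain x1 x2 g G where gp: "good_pairs W n M1 M2 k1 k2 e x1 x2 g G"
      using coop_code_good_pairs e by blast
    have k2pos: "1 \<le> k2" unfolding k2_def using \<delta> by (intro nat_floor_ge_1 two_powr_ge_1) simp
    have Mpos: "1 \<le> card M1" "1 \<le> card M2" unfolding M1_def M2_def card_lessThan using R by (intro nat_floor_ge_1 two_powr_ge_1; simp)+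
    have cM1: "2 powr (real n * R1) / 2 \<le> card M1" "2 powr (real n * R2) / 2 \<le> card M2"
      using nat_floor_ge_half[OF two_powr_ge_1[OF R(1), of n]] nat_floor_ge_half[OF two_powr_ge_1[OF R(2), of n]] by (auto simp: M1_def M2_def)
    have cM2: "card M2 \<le> 2 powr (real n * R2)" unfolding M2_def card_lessThan by (rule nat_floor_le) simp
    define D where "D = 2 powr (real n * \<delta>)"
    \<comment> \<open>\<open>M2\<close> has logarithmic size at most \<open>n * R2\<close> even in
      nats, because \<open>ln 2 < 1\<close>. The additional 1 makes \<open>exp (- P)\<close> times
      its size smaller than 1, so a bin of size \<open>L\<close> leaves no message
      uncovered.\<close>
    define P where "P = real n * R2 + 1"
    have P1: "1 \<le> P" using R by (simp add: P_def)
    have DP: "144 * P \<le> D" using elim(2) by (simp add: D_def P_def)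
    have k2D: "k2 \<le> D" unfolding k2_def D_def by (rule nat_floor_le) simp
    define L where "L = nat \<lceil>8 * real k2 * P\<rceil>"
    define N where "N = nat \<lfloor>2 powr (real n * (R1 - 3 * \<delta>))\<rfloor>"
    have L1: "8 * real k2 * P \<le> L" unfolding L_def by (rule real_nat_ceiling_ge)
    have "1 \<le> real k2 * P" using k2pos P1 mult_mono[of 1 "real k2" 1 P] by simp
    moreover have "0 \<le> 8 * real k2 * P" using P1 by simp
    ultimately have "L \<le> 9 * (k2 * P)" unfolding L_def by linarith
    also have "\<dots> \<le> 9 * (D * P)" using k2D P1 by (intro mult_left_mono mult_right_mono) auto
    finally have L2: "L \<le> 9 * D * P" by simp
    have "real N * real L * (8 * k2) \<le> card M1"
    proof -
      have "real N * real L * (8 * k2) \<le> 2 powr (real n * (R1 - 3 * \<delta>)) * (9 * D * P) * (8 * D)"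
        unfolding N_def using L2 k2D P1 by (intro mult_mono nat_floor_le) (auto simp: D_def)
      also have "\<dots> = 2 powr (real n * (R1 - 3 * \<delta>)) * D * D * (72 * P)" by (simp add: ac_simps)
      also have "\<dots> \<le> 2 powr (real n * (R1 - 3 * \<delta>)) * D * D * (D / 2)"
        using DP by (intro mult_left_mono) (auto simp: D_def)
      also have "\<dots> = 2 powr (real n * R1) / 2"
        by (simp add: D_def powr_add[symmetric] algebra_simps)
      finally show ?thesis using cM1 by linarith
    qed
    then have NL: "real N * real L \<le> 1 / (8 * real k2) * card M1" using k2pos by (simp add: field_simps)
    have EL: "exp (- (1 / (8 * real k2) * real L)) * card M2 < 1"
    proof -
      have "P \<le> 1 / (8 * real k2) * real L" using L1 k2pos by (simp add: field_simps)
      then have "exp (- (1 / (8 * real k2) * real L)) * card M2 \<le> exp (- P) * 2 powr (real n * R2)"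
        using cM2 by (intro mult_mono) auto
      also have "\<dots> = exp (real n * R2 * ln 2 - P)" by (simp add: powr_def exp_add[symmetric] ac_simps)
      also have "\<dots> < 1"
      proof -
        have "real n * R2 * ln 2 \<le> real n * R2 * 1" using R ln_2_less_1 by (intro mult_left_mono) auto
        then show ?thesis by (simp add: P_def)
      qed
      finally show ?thesis .
    qed
    have neM: "M1 \<noteq> {}" "M2 \<noteq> {}" using Mpos by auto
    obtain T where T: "T \<subseteq> M2" "card M2 \<le> 4 * card T" "coop_code W n {..<N} T (L * k1) 1 e"
      using transfer_code[OF gp _ _ _ neM k2pos NL EL] e by (auto simp: M1_def M2_def)
    have finT: "finite T" using T(1) finite_subset by (auto simp: M2_def)
    have "coop_code W n {..<N} {..<card T} (L * k1) 1 e"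
      by (rule coop_code_shrink[OF T(3)]) (use finT in auto)
    moreover have "nat \<lfloor>2 powr (real n * (max 0 (R2 - \<delta>)))\<rfloor> \<le> card T"
    proof (cases "R2 \<le> \<delta>")
      case True
      then show ?thesis using T(2) Mpos by simp
    next
      case False
      have "144 \<le> D" using P1 DP by linarith
      then have "2 powr (real n * (R2 - \<delta>)) * 8 \<le> 2 powr (real n * (R2 - \<delta>)) * D" by (intro mult_left_mono) auto
      also have "\<dots> = 2 powr (real n * R2)" by (simp add: D_def powr_add[symmetric] algebra_simps)
      also have "\<dots> \<le> 2 * real (card M2)" using cM1 by simp
      also have "\<dots> \<le> 8 * real (card T)" using T(2) by linarith
      finally have "2 powr (real n * (R2 - \<delta>)) \<le> card T" by simp
      then have "nat \<lfloor>2 powr (real n * (R2 - \<delta>))\<rfloor> \<le> card T" by linarith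
      then show ?thesis using False by (simp add: max_def)
    qed
    moreover have "L * k1 \<le> nat \<lfloor>2 powr (real n * (a + 2 * \<delta>))\<rfloor>"
    proof -
      have "real (L * k1) \<le> (9 * D * P) * 2 powr (real n * a)"
        unfolding of_nat_mult k1_def using L2 P1 by (intro mult_mono nat_floor_le) (auto simp: D_def)
      also have "\<dots> \<le> (D * D) * 2 powr (real n * a)"
      proof (intro mult_right_mono)
        have "D * (9 * P) \<le> D * D" using DP P1 by (intro mult_left_mono) (auto simp: D_def)
        then show "9 * D * P \<le> D * D" by (simp add: ac_simps)
      qed simp
      also have "\<dots> = 2 powr (real n * (a + 2 * \<delta>))" by (simp add: D_def powr_add[symmetric] algebra_simps)
      finally show ?thesis by (rule le_nat_floor)
    qed
    ultimately show ?case unfolding N_def by (intro exI[of _ "nat \<lfloor>2 powr (real n * (R1 - 3 * \<delta>))\<rfloor>"] exI[of _ "card T"] exI[of _ "L * k1"] exI[of _ 1]) auto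
  qed
qed (use R1 in auto)

lemma transfer_zero_rate:
  assumes a: "achievable_informed W (a, \<delta>) (R1, R2)"
  shows "achievable_informed W (a, 0) (0, R2)"
proof (rule achievable_informedI)
  fix e :: real assume e: "e > 0"
  have R: "0 \<le> R1" "0 \<le> R2" using a by (auto simp: achievable_informed_def)
  from achievable_informedD[OF a e]
  show "\<forall>\<^sub>F n in sequentially. \<exists>m1 m2 k1 k2.
       coop_code W n {..<m1::nat} {..<m2::nat} k1 k2 e \<and>
       nat \<lfloor>2 powr (real n * 0)\<rfloor> \<le> m1 \<and> nat \<lfloor>2 powr (real n * R2)\<rfloor> \<le> m2 \<and>
       k1 \<le> nat \<lfloor>2 powr (real n * a)\<rfloor> \<and> k2 \<le> nat \<lfloor>2 powr (real n * 0)\<rfloor>"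
  proof eventually_elim
    case (elim n)
    have 1: "1 \<le> nat \<lfloor>2 powr (real n * R1)\<rfloor>" using R by (intro nat_floor_ge_1 two_powr_ge_1)
    let ?M2 = "{..<nat \<lfloor>2 powr (real n * R2)\<rfloor>}"
    have "coop_code W n {..<1::nat} ?M2 (nat \<lfloor>2 powr (real n * a)\<rfloor>) (nat \<lfloor>2 powr (real n * \<delta>)\<rfloor>) e"
      by (rule coop_code_shrink[OF elim]) (use 1 in auto)
    then have "coop_code W n {..<1::nat} ?M2 (nat \<lfloor>2 powr (real n * a)\<rfloor>) 1 e"
      unfolding coop_code_def by (fastforce simp: lessThan_Suc)
    then show ?case by (intro exI[of _ "1::nat"] exI[of _ "nat \<lfloor>2 powr (real n * R2)\<rfloor>"] exI[of _ "nat \<lfloor>2 powr (real n * a)\<rfloor>"] exI[of _ "1::nat"]) auto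
  qed
qed (use a in \<open>auto simp: achievable_informed_def\<close>)

lemma achievable_informed_transfer:
  fixes W :: "'a \<Rightarrow> 'b \<Rightarrow> 'c pmf"
  assumes a: "achievable_informed W (a, \<delta>) (R1, R2)" and a0: "0 \<le> a" and \<delta>: "0 < \<delta>"
  shows "\<exists>R1' R2'. achievable_informed W (a + 2 * \<delta>, 0) (R1', R2') \<and> R1 + R2 \<le> R1' + R2' + 4 * \<delta>"
proof (cases "3 * \<delta> \<le> R1")
  case True
  then show ?thesis using transfer_large_rate[OF a a0 \<delta> True] by (intro exI[of _ "R1 - 3 * \<delta>"] exI[of _ "max 0 (R2 - \<delta>)"]) auto
next
  case False
  have "achievable_informed W (a + 2 * \<delta>, 0) (0, R2)" using transfer_zero_rate[OF a] by (rule achievable_informed_mono) (use \<delta> in auto)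
  then show ?thesis using False \<delta> by (intro exI[of _ 0] exI[of _ R2]) auto
qed

section \<open>Random coding for independent inputs\<close>

lemma prob_bind_pmf:
  "measure_pmf.prob (bind_pmf p f) A = measure_pmf.expectation p (\<lambda>x. measure_pmf.prob (f x) A)"
proof -
  have "ennreal (measure_pmf.prob (bind_pmf p f) A) = (\<integral>\<^sup>+x. ennreal (measure_pmf.prob (f x) A) \<partial>measure_pmf p)"
    by (simp add: measure_pmf.emeasure_eq_measure[symmetric])
  also have "\<dots> = ennreal (measure_pmf.expectation p (\<lambda>x. measure_pmf.prob (f x) A))"
    by (intro nn_integral_eq_integral measure_pmf.integrable_const_bound[of _ 1]) auto
  finally show ?thesis by (subst (asm) ennreal_inj) (auto intro!: Bochner_Integration.integral_nonneg)
qed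

lemma prob_bind_pmf_le:
  assumes "\<And>x. x \<in> set_pmf p \<Longrightarrow> measure_pmf.prob (f x) A \<le> c"
  shows "measure_pmf.prob (bind_pmf p f) A \<le> c"
  unfolding prob_bind_pmf using assms
  by (intro measure_pmf.integral_le_const measure_pmf.integrable_const_bound[of _ 1] AE_pmfI) auto

text \<open>Change of measure: on this event \<open>r\<close> is at most \<open>p / K\<close>, and
  \<open>p\<close> has total mass at most 1.\<close>

lemma prob_likelihood_ratio:
  assumes fin: "finite (set_pmf r)" and K: "0 < K"
  shows "measure_pmf.prob r {y. K * pmf r y \<le> pmf p y} \<le> 1 / K"
proof -
  let ?A = "{y. K * pmf r y \<le> pmf p y} \<inter> set_pmf r"
  have finA: "finite ?A" using fin by simp
  have "measure_pmf.prob r {y. K * pmf r y \<le> pmf p y} = measure_pmf.prob r ?A" by (simp add: measure_Int_set_pmf)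
  also have "\<dots> = (\<Sum>y\<in>?A. pmf r y)" using finA by (simp add: measure_measure_pmf_finite)
  also have "\<dots> \<le> (\<Sum>y\<in>?A. pmf p y / K)" using K by (intro sum_mono) (auto simp: field_simps)
  also have "\<dots> = measure_pmf.prob p ?A / K" using finA by (simp add: measure_measure_pmf_finite sum_divide_distrib)
  also have "\<dots> \<le> 1 / K" using K by (intro divide_right_mono) auto
  finally show ?thesis .
qed

text \<open>\<open>\<phi>\<close> is the moment generating function of \<open>- Z\<close>. It equals
  1 at 0 with derivative minus the mean of \<open>Z\<close>, hence is below 1 at some small positive
  \<open>s\<close>, and the exponential Markov bound at this \<open>s\<close> gives the
  power.\<close>

lemma chernoff:
  fixes r :: "'z::finite pmf" and Z :: "'z \<Rightarrow> real"
  assumes "0 < measure_pmf.expectation r Z"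
  shows "\<exists>\<rho>. 0 \<le> \<rho> \<and> \<rho> < 1 \<and>
    (\<forall>n. measure_pmf.prob (Pi_pmf {1..n} d (\<lambda>_. r)) {z. (\<Sum>t=1..n. Z (z t)) \<le> 0} \<le> \<rho> ^ n)"
proof -
  define \<phi> where "\<phi> s = (\<Sum>z\<in>UNIV. pmf r z * exp (- (s * Z z)))" for s
  have E: "measure_pmf.expectation r f = (\<Sum>z\<in>UNIV. pmf r z * f z)" for f :: "'z \<Rightarrow> real"
    by (subst integral_measure_pmf[of UNIV]) auto
  have "(\<phi> has_real_derivative - measure_pmf.expectation r Z) (at 0)"
    unfolding \<phi>_def E by (auto intro!: derivative_eq_intros simp: sum_negf[symmetric] mult.commute)
  then obtain \<delta> where \<delta>: "\<delta> > 0" "\<And>h. h > 0 \<Longrightarrow> h < \<delta> \<Longrightarrow> \<phi> (0 + h) < \<phi> 0"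
    using DERIV_neg_dec_right[of \<phi> "- measure_pmf.expectation r Z" 0] assms by auto
  define s where "s = \<delta> / 2"
  have s: "0 < s" "s < \<delta>" using \<delta> by (auto simp: s_def)
  have "\<phi> 0 = 1" by (simp add: \<phi>_def sum_pmf_eq_1)
  then have "\<phi> s < 1" using \<delta>(2)[OF s] by simp
  moreover have "0 \<le> \<phi> s" by (auto simp: \<phi>_def intro!: sum_nonneg)
  moreover have "measure_pmf.prob (Pi_pmf {1..n} d (\<lambda>_. r)) {z. (\<Sum>t=1..n. Z (z t)) \<le> 0} \<le> \<phi> s ^ n" for n
  proof -
    let ?P = "Pi_pmf {1..n} d (\<lambda>_. r)" and ?A = "{z. (\<Sum>t=1..n. Z (z t)) \<le> 0}"
    have "measure_pmf.prob ?P ?A = measure_pmf.expectation ?P (indicator ?A)" by simp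
    also have "\<dots> \<le> measure_pmf.expectation ?P (\<lambda>z. \<Prod>t=1..n. exp (- (s * Z (z t))))"
    proof (intro integral_mono_AE AE_pmfI integrable_measure_pmf_finite)
      fix z
      have "(\<Prod>t=1..n. exp (- (s * Z (z t)))) = exp (- (s * (\<Sum>t=1..n. Z (z t))))"
        by (simp add: exp_sum[symmetric] sum_negf sum_distrib_left)
      moreover have "1 \<le> exp (- (s * (\<Sum>t=1..n. Z (z t))))" if "z \<in> ?A"
        using that s by (simp add: mult_nonneg_nonpos)
      ultimately show "indicator ?A z \<le> (\<Prod>t=1..n. exp (- (s * Z (z t))))"
        by (auto simp: indicator_def)
    qed auto
    also have "\<dots> = (\<Prod>t=1..n. measure_pmf.expectation r (\<lambda>z. exp (- (s * Z z))))"
      by (rule expectation_prod_Pi_pmf) (auto intro: integrable_measure_pmf_finite)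
    also have "\<dots> = \<phi> s ^ n" by (simp add: E \<phi>_def)
    finally show ?thesis .
  qed
  ultimately show ?thesis by blast
qed

lemma expectation_le_imp_ex:
  fixes f :: "'z \<Rightarrow> real"
  assumes fin: "finite (set_pmf p)" and le: "measure_pmf.expectation p f \<le> c"
  shows "\<exists>x\<in>set_pmf p. f x \<le> c"
proof (rule ccontr)
  assume "\<not> ?thesis"
  then have gt: "\<And>x. x \<in> set_pmf p \<Longrightarrow> c < f x" by (auto simp: not_le)
  have "c = (\<Sum>x\<in>set_pmf p. pmf p x * c)"
    using fin by (simp add: sum_distrib_right[symmetric] sum_pmf_eq_1)
  also have "\<dots> < (\<Sum>x\<in>set_pmf p. pmf p x * f x)"
    using fin gt by (intro sum_strict_mono) (auto simp: set_pmf_not_empty pmf_positive)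
  also have "\<dots> = measure_pmf.expectation p f" by (subst integral_measure_pmf[OF fin]) auto
  finally show False using le by simp
qed

lemma map_two_components_Pi_pmf:
  assumes "finite I" "i \<in> I" "j \<in> I" "i \<noteq> j"
  shows "map_pmf (\<lambda>c. (c i, c j)) (Pi_pmf I d p) = pair_pmf (p i) (p j)"
proof -
  have I: "I = insert i (I - {i})" using assms by auto
  have "map_pmf (\<lambda>c. (c i, c j)) (Pi_pmf I d p)
    = map_pmf (\<lambda>(y, f). (y, f j)) (pair_pmf (p i) (Pi_pmf (I - {i}) d p))"
    using assms by (subst I, subst Pi_pmf_insert) (auto simp: pmf.map_comp o_def case_prod_unfold intro!: map_pmf_cong)
  also have "\<dots> = pair_pmf (p i) (map_pmf (\<lambda>f. f j) (Pi_pmf (I - {i}) d p))"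
    using map_pair[of "\<lambda>x. x" "\<lambda>f. f j" "p i" "Pi_pmf (I - {i}) d p"] by simp
  also have "map_pmf (\<lambda>f. f j) (Pi_pmf (I - {i}) d p) = p j" using assms by (simp add: Pi_pmf_component)
  finally show ?thesis .
qed

text \<open>Translates failure of a likelihood-ratio test with threshold
  \<open>2 powr (n * \<gamma>)\<close> into a nonpositive sum of per-letter terms, the form that
  \<open>chernoff\<close> bounds.\<close>

lemma log_likelihood_sum:
  assumes y: "\<And>t. t \<notin> {1..n} \<Longrightarrow> y t = d"
    and pos: "\<And>t. t \<in> {1..n} \<Longrightarrow> 0 < pmf (p t) (y t)" "\<And>t. t \<in> {1..n} \<Longrightarrow> 0 < pmf (q t) (y t)"
    and less: "\<not> 2 powr (real n * \<gamma>) * pmf (Pi_pmf {1..n} d q) y \<le> pmf (Pi_pmf {1..n} d p) y"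
  shows "(\<Sum>t=1..n. log 2 (pmf (p t) (y t) / pmf (q t) (y t)) - \<gamma>) \<le> 0"
proof -
  let ?p = "\<Prod>t=1..n. pmf (p t) (y t)" and ?q = "\<Prod>t=1..n. pmf (q t) (y t)"
  have eq: "pmf (Pi_pmf {1..n} d p) y = ?p" "pmf (Pi_pmf {1..n} d q) y = ?q"
    using y by (auto intro!: pmf_Pi')
  have pp: "0 < ?p" "0 < ?q" using pos by (auto intro!: prod_pos)
  have ne: "pmf (p t) (y t) \<noteq> 0" "pmf (q t) (y t) \<noteq> 0" if "t \<in> {1..n}" for t
    using pos[OF that] by auto
  have "ln ?p = (\<Sum>t=1..n. ln (pmf (p t) (y t)))" "ln ?q = (\<Sum>t=1..n. ln (pmf (q t) (y t)))"
    by (rule ln_prod; simp add: ne)+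
  then have lp: "log 2 ?p = (\<Sum>t=1..n. log 2 (pmf (p t) (y t)))" and lq: "log 2 ?q = (\<Sum>t=1..n. log 2 (pmf (q t) (y t)))"
    by (simp_all add: log_def sum_divide_distrib)
  have "?p < 2 powr (real n * \<gamma>) * ?q" using less unfolding eq by simp
  then have "log 2 ?p < log 2 (2 powr (real n * \<gamma>) * ?q)" using pp by simp
  also have "\<dots> = n * \<gamma> + log 2 ?q"
    using add_log_eq_powr[of 2 ?q "n * \<gamma>"] pp(2) by linarith
  finally have "(\<Sum>t=1..n. log 2 (pmf (p t) (y t))) - (\<Sum>t=1..n. log 2 (pmf (q t) (y t))) \<le> n * \<gamma>"
    unfolding lp lq by simp
  moreover have "(\<Sum>t=1..n. log 2 (pmf (p t) (y t) / pmf (q t) (y t)) - \<gamma>)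
    = (\<Sum>t=1..n. log 2 (pmf (p t) (y t)) - log 2 (pmf (q t) (y t)) - \<gamma>)"
    using ne by (intro sum.cong refl) (simp add: log_divide)
  ultimately show ?thesis by (simp add: sum_subtractf)
qed

text \<open>
  Decoding is successive: \<open>w2\<close> is found from \<open>y\<close> alone, treating the first input as noise
  (\<open>typical2\<close>, rate \<open>I2\<close>), then \<open>w1\<close> given the second codeword (\<open>typical1\<close>, rate \<open>I1\<close>).
\<close>
locale product_input =
  fixes W :: "'a::finite \<Rightarrow> 'b::finite \<Rightarrow> 'c::finite pmf" and q1 :: "'a pmf" and q2 :: "'b pmf"
begin

definition "out2 b = bind_pmf q1 (\<lambda>a. W a b)"
definition "out = bind_pmf q2 out2"
definition "triple = bind_pmf (pair_pmf q1 q2) (\<lambda>x. map_pmf (Pair x) (case_prod W x))"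
text \<open>For independent inputs X1, X2 of laws \<open>q1\<close>, \<open>q2\<close>,
  \<open>I1\<close> is I(X1; Y | X2) and \<open>I2\<close> is I(X2; Y).\<close>

definition "I1 = measure_pmf.expectation triple (\<lambda>(x, y). log 2 (pmf (case_prod W x) y / pmf (out2 (snd x)) y))"
definition "I2 = measure_pmf.expectation triple (\<lambda>(x, y). log 2 (pmf (out2 (snd x)) y / pmf out y))"

definition "in1 n = Pi_pmf {1..n::nat} undefined (\<lambda>_. q1)"
definition "in2 n = Pi_pmf {1..n::nat} undefined (\<lambda>_. q2)"
definition "out2n n v = Pi_pmf {1..n::nat} undefined (\<lambda>t. out2 (v t))"
definition "outn n = Pi_pmf {1..n::nat} undefined (\<lambda>_. out)"
definition "joint n = bind_pmf (in1 n) (\<lambda>u. bind_pmf (in2 n) (\<lambda>v. map_pmf (\<lambda>y. (u, v, y)) (pair_output W n u v)))"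

lemma out_eq: "out = bind_pmf (pair_pmf q1 q2) (case_prod W)"
  unfolding out_def out2_def pair_pmf_def
  by (simp add: bind_assoc_pmf bind_return_pmf) (rule bind_commute_pmf)

lemma set_out2: "a \<in> set_pmf q1 \<Longrightarrow> set_pmf (W a b) \<subseteq> set_pmf (out2 b)"
  by (auto simp: out2_def)

lemma set_out: "b \<in> set_pmf q2 \<Longrightarrow> set_pmf (out2 b) \<subseteq> set_pmf out"
  by (auto simp: out_def)

text \<open>The chain rule for mutual information: on the support of \<open>triple\<close> the two
  likelihood ratios telescope pointwise.\<close>

lemma I1_plus_I2: "I1 + I2 = info (case_prod W) (pair_pmf q1 q2)"
proof -
  have "I1 + I2 = measure_pmf.expectation triple (\<lambda>z. (case z of (x, y) \<Rightarrow> log 2 (pmf (case_prod W x) y / pmf (out2 (snd x)) y))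
       + (case z of (x, y) \<Rightarrow> log 2 (pmf (out2 (snd x)) y / pmf out y)))"
    unfolding I1_def I2_def
    by (intro Bochner_Integration.integral_add[symmetric] integrable_measure_pmf_finite) auto
  also have "\<dots> = measure_pmf.expectation triple (\<lambda>(x, y). log 2 (pmf (case_prod W x) y / pmf out y))"
  proof (intro integral_cong_AE AE_pmfI)
    fix z assume "z \<in> set_pmf triple"
    then obtain a b y where z: "z = ((a, b), y)" and ab: "a \<in> set_pmf q1" "b \<in> set_pmf q2" "y \<in> set_pmf (W a b)"
      by (auto simp: triple_def)
    then have "y \<in> set_pmf (out2 b)" using set_out2 by blast
    moreover from this have "y \<in> set_pmf out" using set_out ab by blast
    ultimately have "0 < pmf (W a b) y" "0 < pmf (out2 b) y" "0 < pmf out y"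
      using ab by (auto intro!: pmf_positive)
    then show "(case z of (x, y) \<Rightarrow> log 2 (pmf (case_prod W x) y / pmf (out2 (snd x)) y))
       + (case z of (x, y) \<Rightarrow> log 2 (pmf (out2 (snd x)) y / pmf out y)) = (case z of (x, y) \<Rightarrow> log 2 (pmf (case_prod W x) y / pmf out y))"
      by (simp add: z log_divide)
  qed auto
  also have "\<dots> = (\<Sum>z\<in>UNIV \<times> UNIV. pmf triple z * (case z of (x, y) \<Rightarrow> log 2 (pmf (case_prod W x) y / pmf out y)))"
    by (subst integral_measure_pmf[of UNIV]) auto
  also have "\<dots> = (\<Sum>x\<in>UNIV. \<Sum>y\<in>UNIV. pmf (pair_pmf q1 q2) x * pmf (case_prod W x) y * log 2 (pmf (case_prod W x) y / pmf out y))"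
    unfolding sum.cartesian_product triple_def by (intro sum.cong refl) (clarsimp simp: pmf_bind_Pair)
  also have "\<dots> = info (case_prod W) (pair_pmf q1 q2)"
    unfolding info_sum kl_div_def out_eq[symmetric]
    by (subst integral_measure_pmf[of UNIV]) (auto simp: sum_distrib_left mult.assoc)
  finally show ?thesis .
qed

lemma out2n_eq: "bind_pmf (in1 n) (\<lambda>u. pair_output W n u v) = out2n n v"
  unfolding in1_def pair_output_def out2n_def out2_def by (rule Pi_pmf_bind[symmetric]) simp

lemma outn_eq: "bind_pmf (in2 n) (out2n n) = outn n"
  unfolding in2_def out2n_def outn_def out_def by (rule Pi_pmf_bind[symmetric]) simp

text \<open>Drawing whole input blocks and then the output amounts to independent copies of
  \<open>triple\<close>, one per position. Through this, \<open>chernoff\<close> applies to the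
  block experiment.\<close>

lemma joint_eq:
  "Pi_pmf {1..n} d (\<lambda>_. triple) = map_pmf (\<lambda>(u, v, y) t. if t \<in> {1..n} then ((u t, v t), y t) else d) (joint n)"
proof -
  have "triple = bind_pmf q1 (\<lambda>a. bind_pmf q2 (\<lambda>b. bind_pmf (W a b) (\<lambda>y. return_pmf ((a, b), y))))"
    unfolding triple_def pair_pmf_def by (simp add: bind_assoc_pmf bind_return_pmf map_pmf_def)
  then have "Pi_pmf {1..n} d (\<lambda>_. triple) =
     Pi_pmf {1..n} d (\<lambda>_. bind_pmf q1 (\<lambda>a. bind_pmf q2 (\<lambda>b. bind_pmf (W a b) (\<lambda>y. return_pmf ((a, b), y)))))" by simp
  also have "\<dots> = bind_pmf (in1 n) (\<lambda>u. Pi_pmf {1..n} d (\<lambda>t. bind_pmf q2 (\<lambda>b. bind_pmf (W (u t) b) (\<lambda>y. return_pmf ((u t, b), y)))))"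
    unfolding in1_def by (rule Pi_pmf_bind) simp
  also have "\<dots> = bind_pmf (in1 n) (\<lambda>u. bind_pmf (in2 n) (\<lambda>v. Pi_pmf {1..n} d (\<lambda>t. bind_pmf (W (u t) (v t)) (\<lambda>y. return_pmf ((u t, v t), y)))))"
    unfolding in2_def by (intro bind_pmf_cong refl Pi_pmf_bind) simp
  also have "\<dots> = bind_pmf (in1 n) (\<lambda>u. bind_pmf (in2 n) (\<lambda>v. bind_pmf (pair_output W n u v) (\<lambda>y. Pi_pmf {1..n} d (\<lambda>t. return_pmf ((u t, v t), y t)))))"
    unfolding pair_output_def by (intro bind_pmf_cong refl Pi_pmf_bind) simp
  also have "\<dots> = map_pmf (\<lambda>(u, v, y) t. if t \<in> {1..n} then ((u t, v t), y t) else d) (joint n)"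
    unfolding joint_def by (simp add: map_bind_pmf pmf.map_comp o_def map_pmf_def[of _ "pair_output W n _ _"])
  finally show ?thesis .
qed

lemma set_joint:
  assumes "(u, v, y) \<in> set_pmf (joint n)"
  shows "t \<in> {1..n} \<Longrightarrow> u t \<in> set_pmf q1" "t \<in> {1..n} \<Longrightarrow> v t \<in> set_pmf q2"
    "t \<in> {1..n} \<Longrightarrow> y t \<in> set_pmf (W (u t) (v t))" "t \<notin> {1..n} \<Longrightarrow> y t = undefined"
  using assms by (auto simp: joint_def in1_def in2_def pair_output_def set_Pi_pmf PiE_dflt_def)

text \<open>Typicality is a likelihood-ratio test, so a wrong codeword is bounded directly by a
  change of measure. \<open>typical1\<close> tests the channel law against the output given the
  second codeword only, \<open>typical2\<close> tests that law against the unconditional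
  output.\<close>

definition "typical1 \<gamma> n u v y \<longleftrightarrow> 2 powr (real n * \<gamma>) * pmf (out2n n v) y \<le> pmf (pair_output W n u v) y"
definition "typical2 \<gamma> n v y \<longleftrightarrow> 2 powr (real n * \<gamma>) * pmf (outn n) y \<le> pmf (out2n n v) y"

lemma joint_chernoff:
  fixes f :: "('a \<times> 'b) \<times> 'c \<Rightarrow> real"
  assumes "\<gamma> < measure_pmf.expectation triple f"
  shows "\<exists>\<rho>. 0 \<le> \<rho> \<and> \<rho> < 1 \<and> (\<forall>n. measure_pmf.prob (joint n) {(u, v, y). (\<Sum>t=1..n. f ((u t, v t), y t) - \<gamma>) \<le> 0} \<le> \<rho> ^ n)"
proof -
  have "measure_pmf.expectation triple (\<lambda>z. f z - \<gamma>) = measure_pmf.expectation triple f - \<gamma>"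
    by (subst Bochner_Integration.integral_diff) (auto intro!: integrable_measure_pmf_finite)
  then have "0 < measure_pmf.expectation triple (\<lambda>z. f z - \<gamma>)" using assms by simp
  from chernoff[OF this, of undefined] obtain \<rho> where \<rho>: "0 \<le> \<rho>" "\<rho> < 1"
    and b: "\<And>n. measure_pmf.prob (Pi_pmf {1..n} undefined (\<lambda>_. triple)) {z. (\<Sum>t=1..n. f (z t) - \<gamma>) \<le> 0} \<le> \<rho> ^ n" by blast
  have "measure_pmf.prob (joint n) {(u, v, y). (\<Sum>t=1..n. f ((u t, v t), y t) - \<gamma>) \<le> 0} \<le> \<rho> ^ n" for n
  proof -
    have "(\<lambda>(u, v, y) t. if t \<in> {1..n} then ((u t, v t), y t) else undefined) -` {z. (\<Sum>t=1..n. f (z t) - \<gamma>) \<le> 0}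
       = {(u, v, y). (\<Sum>t=1..n. f ((u t, v t), y t) - \<gamma>) \<le> 0}" by auto
    then show ?thesis using b[of n] unfolding joint_eq by simp
  qed
  then show ?thesis using \<rho> by blast
qed

lemma typical1_error:
  assumes "\<gamma> < I1"
  shows "\<exists>\<rho>. 0 \<le> \<rho> \<and> \<rho> < 1 \<and> (\<forall>n. measure_pmf.prob (joint n) {(u, v, y). \<not> typical1 \<gamma> n u v y} \<le> \<rho> ^ n)"
proof -
  obtain \<rho> where \<rho>: "0 \<le> \<rho>" "\<rho> < 1" and b: "\<And>n. measure_pmf.prob (joint n) {(u, v, y). (\<Sum>t=1..n. (case ((u t, v t), y t) of (x, y) \<Rightarrow> log 2 (pmf (case_prod W x) y / pmf (out2 (snd x)) y)) - \<gamma>) \<le> 0} \<le> \<rho> ^ n"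
    using joint_chernoff[OF assms[unfolded I1_def]] by blast
  have "measure_pmf.prob (joint n) {(u, v, y). \<not> typical1 \<gamma> n u v y} \<le> \<rho> ^ n" for n
  proof (rule order_trans[OF measure_pmf.finite_measure_mono_AE b])
    show "AE z in measure_pmf (joint n). z \<in> {(u, v, y). \<not> typical1 \<gamma> n u v y} \<longrightarrow>
       z \<in> {(u, v, y). (\<Sum>t=1..n. (case ((u t, v t), y t) of (x, y) \<Rightarrow> log 2 (pmf (case_prod W x) y / pmf (out2 (snd x)) y)) - \<gamma>) \<le> 0}"
    proof (rule AE_pmfI, rule impI)
      fix z assume z: "z \<in> set_pmf (joint n)" "z \<in> {(u, v, y). \<not> typical1 \<gamma> n u v y}"
      obtain u v y where uvy: "z = (u, v, y)" by (cases z)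
      have s: "(u, v, y) \<in> set_pmf (joint n)" and nt: "\<not> typical1 \<gamma> n u v y" using z uvy by auto
      have "(\<Sum>t=1..n. log 2 (pmf (W (u t) (v t)) (y t) / pmf (out2 (v t)) (y t)) - \<gamma>) \<le> 0"
      proof (rule log_likelihood_sum[where d = undefined and p = "\<lambda>t. W (u t) (v t)" and q = "\<lambda>t. out2 (v t)"])
        show "\<not> 2 powr (real n * \<gamma>) * pmf (Pi_pmf {1..n} undefined (\<lambda>t. out2 (v t))) y \<le> pmf (Pi_pmf {1..n} undefined (\<lambda>t. W (u t) (v t))) y"
          using nt by (simp add: typical1_def out2n_def pair_output_def)
        show "0 < pmf (W (u t) (v t)) (y t)" if "t \<in> {1..n}" for t using set_joint(3)[OF s that] by (rule pmf_positive)
        show "0 < pmf (out2 (v t)) (y t)" if "t \<in> {1..n}" for t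
          using set_joint(3)[OF s that] set_out2[OF set_joint(1)[OF s that]] by (intro pmf_positive) blast
      qed (use set_joint[OF s] in auto)
      then show "z \<in> {(u, v, y). (\<Sum>t=1..n. (case ((u t, v t), y t) of (x, y) \<Rightarrow> log 2 (pmf (case_prod W x) y / pmf (out2 (snd x)) y)) - \<gamma>) \<le> 0}" by (simp add: uvy)
    qed
  qed auto
  then show ?thesis using \<rho> by blast
qed

lemma typical2_error:
  assumes "\<gamma> < I2"
  shows "\<exists>\<rho>. 0 \<le> \<rho> \<and> \<rho> < 1 \<and> (\<forall>n. measure_pmf.prob (joint n) {(u, v, y). \<not> typical2 \<gamma> n v y} \<le> \<rho> ^ n)"
proof -
  obtain \<rho> where \<rho>: "0 \<le> \<rho>" "\<rho> < 1" and b: "\<And>n. measure_pmf.prob (joint n) {(u, v, y). (\<Sum>t=1..n. (case ((u t, v t), y t) of (x, y) \<Rightarrow> log 2 (pmf (out2 (snd x)) y / pmf out y)) - \<gamma>) \<le> 0} \<le> \<rho> ^ n"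
    using joint_chernoff[OF assms[unfolded I2_def]] by blast
  have "measure_pmf.prob (joint n) {(u, v, y). \<not> typical2 \<gamma> n v y} \<le> \<rho> ^ n" for n
  proof (rule order_trans[OF measure_pmf.finite_measure_mono_AE b])
    show "AE z in measure_pmf (joint n). z \<in> {(u, v, y). \<not> typical2 \<gamma> n v y} \<longrightarrow>
       z \<in> {(u, v, y). (\<Sum>t=1..n. (case ((u t, v t), y t) of (x, y) \<Rightarrow> log 2 (pmf (out2 (snd x)) y / pmf out y)) - \<gamma>) \<le> 0}"
    proof (rule AE_pmfI, rule impI)
      fix z assume z: "z \<in> set_pmf (joint n)" "z \<in> {(u, v, y). \<not> typical2 \<gamma> n v y}"
      obtain u v y where uvy: "z = (u, v, y)" by (cases z)
      have s: "(u, v, y) \<in> set_pmf (joint n)" and nt: "\<not> typical2 \<gamma> n v y" using z uvy by auto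
      have "(\<Sum>t=1..n. log 2 (pmf (out2 (v t)) (y t) / pmf out (y t)) - \<gamma>) \<le> 0"
      proof (rule log_likelihood_sum[where d = undefined and p = "\<lambda>t. out2 (v t)" and q = "\<lambda>t. out"])
        show "\<not> 2 powr (real n * \<gamma>) * pmf (Pi_pmf {1..n} undefined (\<lambda>t. out)) y \<le> pmf (Pi_pmf {1..n} undefined (\<lambda>t. out2 (v t))) y"
          using nt by (simp add: typical2_def out2n_def outn_def)
        have m: "y t \<in> set_pmf (out2 (v t))" if "t \<in> {1..n}" for t using set_joint[OF s] set_out2 that by blast
        show "0 < pmf (out2 (v t)) (y t)" if "t \<in> {1..n}" for t using m[OF that] by (rule pmf_positive)
        show "0 < pmf out (y t)" if "t \<in> {1..n}" for t using m[OF that] set_out set_joint(2)[OF s that] by (intro pmf_positive) blast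
      qed (use set_joint[OF s] in auto)
      then show "z \<in> {(u, v, y). (\<Sum>t=1..n. (case ((u t, v t), y t) of (x, y) \<Rightarrow> log 2 (pmf (out2 (snd x)) y / pmf out y)) - \<gamma>) \<le> 0}" by (simp add: uvy)
    qed
  qed auto
  then show ?thesis using \<rho> by blast
qed

section \<open>Random codebooks and the union bound over error events\<close>

definition "codebooks n N1 N2 = pair_pmf (Pi_pmf {..<N1::nat} undefined (\<lambda>_. in1 n)) (Pi_pmf {..<N2::nat} undefined (\<lambda>_. in2 n))"
text \<open>The codebooks are kept together with the output, so that errors of a decoder depending
  on the codebooks are events of a single law.\<close>

definition "transmission n N1 N2 w1 w2 = bind_pmf (codebooks n N1 N2) (\<lambda>c. map_pmf (Pair c) (pair_output W n (fst c w1) (snd c w2)))"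

lemma prob_transmission:
  "measure_pmf.prob (transmission n N1 N2 w1 w2) E =
     measure_pmf.expectation (codebooks n N1 N2) (\<lambda>c. measure_pmf.prob (pair_output W n (fst c w1) (snd c w2)) {y. (c, y) \<in> E})"
  unfolding transmission_def prob_bind_pmf by (simp add: vimage_def)

lemma finite_codebooks: "finite (set_pmf (codebooks n N1 N2))"
  unfolding codebooks_def in1_def in2_def by (auto intro!: finite_set_Pi_pmfI)

lemma map_codebooks:
  "map_pmf f (transmission n N1 N2 w1 w2) = bind_pmf (Pi_pmf {..<N1} undefined (\<lambda>_. in1 n)) (\<lambda>c1. bind_pmf (Pi_pmf {..<N2} undefined (\<lambda>_. in2 n))
     (\<lambda>c2. map_pmf (\<lambda>y. f ((c1, c2), y)) (pair_output W n (c1 w1) (c2 w2))))"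
  unfolding transmission_def codebooks_def pair_pmf_def
  by (simp add: map_bind_pmf bind_assoc_pmf bind_return_pmf pmf.map_comp o_def)

lemma transmission_joint:
  assumes "w1 < N1" "w2 < N2"
  shows "map_pmf (\<lambda>(c, y). (fst c w1, snd c w2, y)) (transmission n N1 N2 w1 w2) = joint n"
proof -
  let ?C1 = "Pi_pmf {..<N1} undefined (\<lambda>_. in1 n)" and ?C2 = "Pi_pmf {..<N2} undefined (\<lambda>_. in2 n)"
  have 1: "map_pmf (\<lambda>c. c w1) ?C1 = in1 n" using assms by (simp add: Pi_pmf_component)
  have 2: "map_pmf (\<lambda>c. c w2) ?C2 = in2 n" using assms by (simp add: Pi_pmf_component)
  have "map_pmf (\<lambda>(c, y). (fst c w1, snd c w2, y)) (transmission n N1 N2 w1 w2) =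
    bind_pmf (map_pmf (\<lambda>c. c w1) ?C1) (\<lambda>u. bind_pmf (map_pmf (\<lambda>c. c w2) ?C2) (\<lambda>v. map_pmf (\<lambda>y. (u, v, y)) (pair_output W n u v)))"
    unfolding map_codebooks by (simp add: bind_map_pmf)
  then show ?thesis unfolding joint_def 1 2 .
qed

text \<open>The codeword of \<open>w\<close> is independent of the output, whose law, averaged over
  the transmitted codewords, is \<open>outn\<close>. Reordering the independent draws exposes this,
  and \<open>prob_likelihood_ratio\<close> does the rest.\<close>

lemma competitor2_error:
  assumes "w1 < N1" "w2 < N2" "w < N2" "w \<noteq> w2"
  shows "measure_pmf.prob (transmission n N1 N2 w1 w2) {(c, y). typical2 \<gamma> n (snd c w) y} \<le> 2 powr (- (real n * \<gamma>))"
proof -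
  let ?C2 = "Pi_pmf {..<N2} undefined (\<lambda>_. in2 n)"
  have 1: "map_pmf (\<lambda>c. c w1) (Pi_pmf {..<N1} undefined (\<lambda>_. in1 n)) = in1 n" using assms by (simp add: Pi_pmf_component)
  have 2: "map_pmf (\<lambda>c. (c w, c w2)) ?C2 = pair_pmf (in2 n) (in2 n)"
    using assms by (intro map_two_components_Pi_pmf) auto
  have "map_pmf (\<lambda>(c, y). (snd c w, y)) (transmission n N1 N2 w1 w2) =
     bind_pmf (Pi_pmf {..<N1} undefined (\<lambda>_. in1 n)) (\<lambda>c1. bind_pmf ?C2 (\<lambda>c2. map_pmf (Pair (c2 w)) (pair_output W n (c1 w1) (c2 w2))))"
    unfolding map_codebooks by simp
  also have "\<dots> = bind_pmf (map_pmf (\<lambda>c. c w1) (Pi_pmf {..<N1} undefined (\<lambda>_. in1 n)))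
      (\<lambda>u. bind_pmf (map_pmf (\<lambda>c. (c w, c w2)) ?C2) (\<lambda>(v', v). map_pmf (Pair v') (pair_output W n u v)))"
    by (simp add: bind_map_pmf)
  also have "\<dots> = bind_pmf (in1 n) (\<lambda>u. bind_pmf (in2 n) (\<lambda>v'. bind_pmf (in2 n) (\<lambda>v. map_pmf (Pair v') (pair_output W n u v))))"
    unfolding 1 2 pair_pmf_def by (simp add: bind_assoc_pmf bind_return_pmf)
  also have "\<dots> = bind_pmf (in2 n) (\<lambda>v'. bind_pmf (in1 n) (\<lambda>u. bind_pmf (in2 n) (\<lambda>v. map_pmf (Pair v') (pair_output W n u v))))"
    by (rule bind_commute_pmf)
  also have "\<dots> = bind_pmf (in2 n) (\<lambda>v'. bind_pmf (in2 n) (\<lambda>v. bind_pmf (in1 n) (\<lambda>u. map_pmf (Pair v') (pair_output W n u v))))"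
    by (intro bind_pmf_cong refl bind_commute_pmf)
  also have "\<dots> = bind_pmf (in2 n) (\<lambda>v'. map_pmf (Pair v') (outn n))"
    by (simp only: map_bind_pmf[symmetric] out2n_eq outn_eq)
  finally have eq: "map_pmf (\<lambda>(c, y). (snd c w, y)) (transmission n N1 N2 w1 w2) = bind_pmf (in2 n) (\<lambda>v'. map_pmf (Pair v') (outn n))" .
  have "measure_pmf.prob (transmission n N1 N2 w1 w2) {(c, y). typical2 \<gamma> n (snd c w) y} =
    measure_pmf.prob (map_pmf (\<lambda>(c, y). (snd c w, y)) (transmission n N1 N2 w1 w2)) {(v, y). typical2 \<gamma> n v y}"
    by (simp add: vimage_def case_prod_unfold)
  also have "\<dots> \<le> 2 powr (- (real n * \<gamma>))"
    unfolding eq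
  proof (rule prob_bind_pmf_le)
    fix v
    have "measure_pmf.prob (map_pmf (Pair v) (outn n)) {(v, y). typical2 \<gamma> n v y} = measure_pmf.prob (outn n) {y. 2 powr (real n * \<gamma>) * pmf (outn n) y \<le> pmf (out2n n v) y}"
      by (simp add: vimage_def typical2_def)
    also have "\<dots> \<le> 1 / 2 powr (real n * \<gamma>)"
      by (rule prob_likelihood_ratio) (auto simp: outn_def)
    finally show "measure_pmf.prob (map_pmf (Pair v) (outn n)) {(v, y). typical2 \<gamma> n v y} \<le> 2 powr (- (real n * \<gamma>))"
      by (simp add: powr_minus inverse_eq_divide)
  qed
  finally show ?thesis .
qed

text \<open>Here the true second codeword \<open>v\<close> is held fixed: given \<open>v\<close>,
  the output averaged over the transmitted first codeword has law \<open>out2n n v\<close>,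
  independently of the competing codeword.\<close>

lemma competitor1_error:
  assumes "w1 < N1" "w2 < N2" "w < N1" "w \<noteq> w1"
  shows "measure_pmf.prob (transmission n N1 N2 w1 w2) {(c, y). typical1 \<gamma> n (fst c w) (snd c w2) y} \<le> 2 powr (- (real n * \<gamma>))"
proof -
  let ?C1 = "Pi_pmf {..<N1} undefined (\<lambda>_. in1 n)"
  have 1: "map_pmf (\<lambda>c. c w2) (Pi_pmf {..<N2} undefined (\<lambda>_. in2 n)) = in2 n" using assms by (simp add: Pi_pmf_component)
  have 2: "map_pmf (\<lambda>c. (c w, c w1)) ?C1 = pair_pmf (in1 n) (in1 n)"
    using assms by (intro map_two_components_Pi_pmf) auto
  have "map_pmf (\<lambda>(c, y). (fst c w, snd c w2, y)) (transmission n N1 N2 w1 w2) =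
     bind_pmf ?C1 (\<lambda>c1. bind_pmf (Pi_pmf {..<N2} undefined (\<lambda>_. in2 n)) (\<lambda>c2. map_pmf (\<lambda>y. (c1 w, c2 w2, y)) (pair_output W n (c1 w1) (c2 w2))))"
    unfolding map_codebooks by simp
  also have "\<dots> = bind_pmf (map_pmf (\<lambda>c. (c w, c w1)) ?C1)
      (\<lambda>(u', u). bind_pmf (map_pmf (\<lambda>c. c w2) (Pi_pmf {..<N2} undefined (\<lambda>_. in2 n))) (\<lambda>v. map_pmf (\<lambda>y. (u', v, y)) (pair_output W n u v)))"
    by (simp add: bind_map_pmf)
  also have "\<dots> = bind_pmf (in1 n) (\<lambda>u'. bind_pmf (in1 n) (\<lambda>u. bind_pmf (in2 n) (\<lambda>v. map_pmf (\<lambda>y. (u', v, y)) (pair_output W n u v))))"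
    unfolding 1 2 pair_pmf_def by (simp add: bind_assoc_pmf bind_return_pmf)
  also have "\<dots> = bind_pmf (in1 n) (\<lambda>u'. bind_pmf (in2 n) (\<lambda>v. bind_pmf (in1 n) (\<lambda>u. map_pmf (\<lambda>y. (u', v, y)) (pair_output W n u v))))"
    by (intro bind_pmf_cong refl bind_commute_pmf)
  also have "\<dots> = bind_pmf (in1 n) (\<lambda>u'. bind_pmf (in2 n) (\<lambda>v. map_pmf (\<lambda>y. (u', v, y)) (out2n n v)))"
    by (simp only: map_bind_pmf[symmetric] out2n_eq)
  finally have eq: "map_pmf (\<lambda>(c, y). (fst c w, snd c w2, y)) (transmission n N1 N2 w1 w2) = bind_pmf (in1 n) (\<lambda>u'. bind_pmf (in2 n) (\<lambda>v. map_pmf (\<lambda>y. (u', v, y)) (out2n n v)))" .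
  have "measure_pmf.prob (transmission n N1 N2 w1 w2) {(c, y). typical1 \<gamma> n (fst c w) (snd c w2) y} =
    measure_pmf.prob (map_pmf (\<lambda>(c, y). (fst c w, snd c w2, y)) (transmission n N1 N2 w1 w2)) {(u, v, y). typical1 \<gamma> n u v y}"
    by (simp add: vimage_def case_prod_unfold)
  also have "\<dots> \<le> 2 powr (- (real n * \<gamma>))"
    unfolding eq
  proof (intro prob_bind_pmf_le)
    fix u v
    have "measure_pmf.prob (map_pmf (\<lambda>y. (u, v, y)) (out2n n v)) {(u, v, y). typical1 \<gamma> n u v y} = measure_pmf.prob (out2n n v) {y. 2 powr (real n * \<gamma>) * pmf (out2n n v) y \<le> pmf (pair_output W n u v) y}"
      by (simp add: vimage_def typical1_def)
    also have "\<dots> \<le> 1 / 2 powr (real n * \<gamma>)"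
      by (rule prob_likelihood_ratio) (auto simp: out2n_def)
    finally show "measure_pmf.prob (map_pmf (\<lambda>y. (u, v, y)) (out2n n v)) {(u, v, y). typical1 \<gamma> n u v y} \<le> 2 powr (- (real n * \<gamma>))"
      by (simp add: powr_minus inverse_eq_divide)
  qed
  finally show ?thesis .
qed

text \<open>A union bound, averaged over codebooks: one of the two true tests fails, a wrong second
  message passes \<open>typical2\<close>, or a wrong first message passes \<open>typical1\<close>
  with the true second codeword. Some codebook pair is no worse than the average.\<close>

lemma random_code:
  assumes N: "1 \<le> N1" "1 \<le> N2"
    and r1: "measure_pmf.prob (joint n) {(u, v, y). \<not> typical1 \<gamma>1 n u v y} \<le> r1"
    and r2: "measure_pmf.prob (joint n) {(u, v, y). \<not> typical2 \<gamma>2 n v y} \<le> r2"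
  shows "coop_code W n {..<N1} {..<N2} 1 1
    (r1 + r2 + (real N2 - 1) * 2 powr (- (real n * \<gamma>2)) + (real N1 - 1) * 2 powr (- (real n * \<gamma>1)))"
proof -
  define b where "b = r1 + r2 + (real N2 - 1) * 2 powr (- (real n * \<gamma>2)) + (real N1 - 1) * 2 powr (- (real n * \<gamma>1))"
  \<comment> \<open>Outside the error events of the union bound exactly one candidate passes, so
    \<open>THE\<close> returns the true message; on those events its value is immaterial.\<close>
  define g2 where "g2 c y = (THE w. w < N2 \<and> typical2 \<gamma>2 n (snd c w) y)" for c :: "(nat \<Rightarrow> nat \<Rightarrow> 'a) \<times> (nat \<Rightarrow> nat \<Rightarrow> 'b)" and y
  define g where "g c y = (THE w. w < N1 \<and> typical1 \<gamma>1 n (fst c w) (snd c (g2 c y)) y, g2 c y)" for c y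
  have bound: "measure_pmf.expectation (codebooks n N1 N2) (\<lambda>c. measure_pmf.prob (pair_output W n (fst c w1) (snd c w2)) {y. g c y \<noteq> (w1, w2)}) \<le> b"
    if w: "w1 < N1" "w2 < N2" for w1 w2
  proof -
    let ?T = "transmission n N1 N2 w1 w2"
    let ?A1 = "{(c, y). \<not> typical1 \<gamma>1 n (fst c w1) (snd c w2) y}" and ?A2 = "{(c, y). \<not> typical2 \<gamma>2 n (snd c w2) y}"
    let ?B2 = "\<lambda>w. {(c, y). typical2 \<gamma>2 n (snd c w) y}" and ?B1 = "\<lambda>w. {(c, y). typical1 \<gamma>1 n (fst c w) (snd c w2) y}"
    have "measure_pmf.expectation (codebooks n N1 N2) (\<lambda>c. measure_pmf.prob (pair_output W n (fst c w1) (snd c w2)) {y. g c y \<noteq> (w1, w2)})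
      = measure_pmf.prob ?T {(c, y). g c y \<noteq> (w1, w2)}"
      unfolding prob_transmission by simp
    also have "\<dots> \<le> measure_pmf.prob ?T ((?A1 \<union> ?A2) \<union> ((\<Union>w\<in>{..<N2} - {w2}. ?B2 w) \<union> (\<Union>w\<in>{..<N1} - {w1}. ?B1 w)))"
    proof (rule measure_pmf.finite_measure_mono)
      show "{(c, y). g c y \<noteq> (w1, w2)} \<subseteq> (?A1 \<union> ?A2) \<union> ((\<Union>w\<in>{..<N2} - {w2}. ?B2 w) \<union> (\<Union>w\<in>{..<N1} - {w1}. ?B1 w))"
      proof (rule subsetI, rule ccontr)
        fix z assume z: "z \<in> {(c, y). g c y \<noteq> (w1, w2)}" and nz: "z \<notin> (?A1 \<union> ?A2) \<union> ((\<Union>w\<in>{..<N2} - {w2}. ?B2 w) \<union> (\<Union>w\<in>{..<N1} - {w1}. ?B1 w))"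
        obtain c y where cy: "z = (c, y)" by (cases z)
        have t: "typical1 \<gamma>1 n (fst c w1) (snd c w2) y" "typical2 \<gamma>2 n (snd c w2) y"
          and c2: "\<And>w. w < N2 \<Longrightarrow> typical2 \<gamma>2 n (snd c w) y \<Longrightarrow> w = w2"
          and c1: "\<And>w. w < N1 \<Longrightarrow> typical1 \<gamma>1 n (fst c w) (snd c w2) y \<Longrightarrow> w = w1"
          using nz unfolding cy by auto
        have "g2 c y = w2" unfolding g2_def by (rule the_equality) (use t w c2 in blast)+
        moreover have "(THE w. w < N1 \<and> typical1 \<gamma>1 n (fst c w) (snd c w2) y) = w1" by (rule the_equality) (use t w c1 in blast)+
        ultimately have "g c y = (w1, w2)" by (simp add: g_def)
        then show False using z cy by simp
      qed
    qed simp
    also have "\<dots> \<le> (measure_pmf.prob ?T ?A1 + measure_pmf.prob ?T ?A2)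
        + ((\<Sum>w\<in>{..<N2} - {w2}. measure_pmf.prob ?T (?B2 w)) + (\<Sum>w\<in>{..<N1} - {w1}. measure_pmf.prob ?T (?B1 w)))"
      by (rule order_trans[OF measure_Un_le], simp, simp, rule add_mono,
          rule measure_Un_le, simp, simp,
          rule order_trans[OF measure_Un_le], simp, simp, rule add_mono)
        (rule measure_UNION_le; simp)+
    also have "\<dots> \<le> (r1 + r2) + ((\<Sum>w\<in>{..<N2} - {w2}. 2 powr (- (real n * \<gamma>2))) + (\<Sum>w\<in>{..<N1} - {w1}. 2 powr (- (real n * \<gamma>1))))"
    proof (intro add_mono sum_mono)
      have "measure_pmf.prob ?T ?A1 = measure_pmf.prob (map_pmf (\<lambda>(c, y). (fst c w1, snd c w2, y)) ?T) {(u, v, y). \<not> typical1 \<gamma>1 n u v y}"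
        by (simp add: vimage_def case_prod_unfold)
      then show "measure_pmf.prob ?T ?A1 \<le> r1" using r1 unfolding transmission_joint[OF w] by simp
      have "measure_pmf.prob ?T ?A2 = measure_pmf.prob (map_pmf (\<lambda>(c, y). (fst c w1, snd c w2, y)) ?T) {(u, v, y). \<not> typical2 \<gamma>2 n v y}"
        by (simp add: vimage_def case_prod_unfold)
      then show "measure_pmf.prob ?T ?A2 \<le> r2" using r2 unfolding transmission_joint[OF w] by simp
    qed (use w in \<open>auto intro!: competitor1_error competitor2_error\<close>)
    also have "\<dots> = b" using w by (simp add: b_def of_nat_diff)
    finally show ?thesis .
  qed
  have "measure_pmf.expectation (codebooks n N1 N2) (\<lambda>c. \<Sum>w1<N1. \<Sum>w2<N2. measure_pmf.prob (pair_output W n (fst c w1) (snd c w2)) {y. g c y \<noteq> (w1, w2)})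
    = (\<Sum>w1<N1. \<Sum>w2<N2. measure_pmf.expectation (codebooks n N1 N2) (\<lambda>c. measure_pmf.prob (pair_output W n (fst c w1) (snd c w2)) {y. g c y \<noteq> (w1, w2)}))"
    by (simp add: Bochner_Integration.integral_sum[OF integrable_measure_pmf_finite[OF finite_codebooks]])
  also have "\<dots> \<le> (\<Sum>w1<N1. \<Sum>w2<N2. b)" by (intro sum_mono bound) auto
  finally obtain c where c: "(\<Sum>w1<N1. \<Sum>w2<N2. measure_pmf.prob (pair_output W n (fst c w1) (snd c w2)) {y. g c y \<noteq> (w1, w2)}) \<le> (\<Sum>w1<N1. \<Sum>w2<N2. b)"
    using expectation_le_imp_ex[OF finite_codebooks] by blast
  have one: "card ((\<lambda>_. x) ` A) \<le> 1" for x :: 'y and A :: "'z set"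
    using card_mono[of "{x}" "(\<lambda>_. x) ` A"] by auto
  show ?thesis unfolding b_def[symmetric]
    by (rule coop_codeI[where ?x1.0 = "\<lambda>w1 w2. fst c w1" and ?x2.0 = "\<lambda>w1 w2. snd c w2" and g = "g c"])
      (use c one in \<open>auto simp: ac_simps\<close>)
qed

text \<open>The test thresholds lie \<open>\<eta>\<close> below \<open>I1\<close> and
  \<open>I2\<close>, the rates another \<open>\<eta>\<close> lower, so failures of the true tests
  and the union bounds over wrong messages both decay exponentially.\<close>

lemma independent_inputs_achievable:
  assumes \<eta>: "0 < \<eta>"
  shows "achievable_informed W (0, 0) (max 0 (I1 - 2 * \<eta>), max 0 (I2 - 2 * \<eta>))"
proof (rule achievable_informedI)
  obtain \<rho>1 where \<rho>1: "0 \<le> \<rho>1" "\<rho>1 < 1" and b1: "\<And>n. measure_pmf.prob (joint n) {(u, v, y). \<not> typical1 (I1 - \<eta>) n u v y} \<le> \<rho>1 ^ n"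
    using typical1_error[of "I1 - \<eta>"] \<eta> by auto
  obtain \<rho>2 where \<rho>2: "0 \<le> \<rho>2" "\<rho>2 < 1" and b2: "\<And>n. measure_pmf.prob (joint n) {(u, v, y). \<not> typical2 (I2 - \<eta>) n v y} \<le> \<rho>2 ^ n"
    using typical2_error[of "I2 - \<eta>"] \<eta> by auto
  fix e :: real assume "e > 0"
  have "(\<lambda>n. 2 powr (- (real n * \<eta>))) \<longlonglongrightarrow> 0" using \<eta> by real_asymp
  then have "(\<lambda>n. \<rho>1 ^ n + \<rho>2 ^ n + 2 powr (- (real n * \<eta>)) + 2 powr (- (real n * \<eta>))) \<longlonglongrightarrow> 0 + 0 + 0 + 0"
    using \<rho>1 \<rho>2 by (intro tendsto_add LIMSEQ_realpow_zero) auto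
  then have "\<forall>\<^sub>F n in sequentially. \<rho>1 ^ n + \<rho>2 ^ n + 2 powr (- (real n * \<eta>)) + 2 powr (- (real n * \<eta>)) < e"
    using \<open>e > 0\<close> by (intro order_tendstoD(2)) auto
  then show "\<forall>\<^sub>F n in sequentially. \<exists>m1 m2 k1 k2.
       coop_code W n {..<m1::nat} {..<m2::nat} k1 k2 e \<and>
       nat \<lfloor>2 powr (real n * max 0 (I1 - 2 * \<eta>))\<rfloor> \<le> m1 \<and> nat \<lfloor>2 powr (real n * max 0 (I2 - 2 * \<eta>))\<rfloor> \<le> m2 \<and>
       k1 \<le> nat \<lfloor>2 powr (real n * 0)\<rfloor> \<and> k2 \<le> nat \<lfloor>2 powr (real n * 0)\<rfloor>"
  proof eventually_elim
    case (elim n)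
    \<comment> \<open>If the rate is cut off at 0 there is a single message and the factor vanishes.
      Without the \<open>- 1\<close> this case would leave
      \<open>2 powr (- (n * (I - \<eta>)))\<close>, which need not be small.\<close>
    have few: "(real (nat \<lfloor>2 powr (real n * max 0 (I - 2 * \<eta>))\<rfloor>) - 1) * 2 powr (- (real n * (I - \<eta>))) \<le> 2 powr (- (real n * \<eta>))" for I
    proof (cases "I \<le> 2 * \<eta>")
      case False
      have "(real (nat \<lfloor>2 powr (real n * max 0 (I - 2 * \<eta>))\<rfloor>) - 1) * 2 powr (- (real n * (I - \<eta>))) \<le> 2 powr (real n * (I - 2 * \<eta>)) * 2 powr (- (real n * (I - \<eta>)))"
      proof (rule mult_right_mono)
        have "max 0 (I - 2 * \<eta>) = I - 2 * \<eta>" using False by simp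
        then show "real (nat \<lfloor>2 powr (real n * max 0 (I - 2 * \<eta>))\<rfloor>) - 1 \<le> 2 powr (real n * (I - 2 * \<eta>))"
          using nat_floor_le[OF powr_ge_zero[of 2 "real n * (I - 2 * \<eta>)"]] by (simp only:)
      qed simp
      also have "\<dots> = 2 powr (- (real n * \<eta>))" by (simp add: powr_add[symmetric] algebra_simps)
      finally show ?thesis .
    qed simp
    let ?N1 = "nat \<lfloor>2 powr (real n * max 0 (I1 - 2 * \<eta>))\<rfloor>" and ?N2 = "nat \<lfloor>2 powr (real n * max 0 (I2 - 2 * \<eta>))\<rfloor>"
    have "1 \<le> ?N1" "1 \<le> ?N2" by (intro nat_floor_ge_1 two_powr_ge_1; simp)+
    from random_code[OF this b1 b2]
    have "coop_code W n {..<?N1} {..<?N2} 1 1 (\<rho>1 ^ n + \<rho>2 ^ n + (real ?N2 - 1) * 2 powr (- (real n * (I2 - \<eta>))) + (real ?N1 - 1) * 2 powr (- (real n * (I1 - \<eta>))))" .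
    then have "coop_code W n {..<?N1} {..<?N2} 1 1 e"
      by (rule coop_code_error_mono) (use few[of I1] few[of I2] elim in linarith)
    then show ?case by (intro exI[of _ ?N1] exI[of _ ?N2] exI[of _ "1::nat"]) auto
  qed
qed auto

end

lemma info_pair_achievable:
  fixes W :: "'a::finite \<Rightarrow> 'b::finite \<Rightarrow> 'c::finite pmf"
  assumes "0 < \<eta>"
  shows "\<exists>R1 R2. achievable_informed W (0, 0) (R1, R2) \<and> info (case_prod W) (pair_pmf q1 q2) - \<eta> \<le> R1 + R2"
proof -
  interpret product_input W q1 q2 .
  have "0 < \<eta> / 4" using assms by simp
  from independent_inputs_achievable[OF this] show ?thesis
    using I1_plus_I2 by (intro exI[of _ "max 0 (I1 - 2 * (\<eta> / 4))"] exI[of _ "max 0 (I2 - 2 * (\<eta> / 4))"]) auto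
qed

section \<open>Continuity\<close>

definition achievable_informed_sup :: "('a \<Rightarrow> 'b \<Rightarrow> 'c pmf) \<Rightarrow> real \<times> real \<Rightarrow> real" where
  "achievable_informed_sup W C = (SUP R\<in>{R. achievable_informed W C R}. fst R + snd R)"

lemma achievable_informed_nonempty:
  fixes W :: "'a::finite \<Rightarrow> 'b::finite \<Rightarrow> 'c::finite pmf"
  assumes "0 \<le> a" "0 \<le> b"
  shows "\<exists>R1 R2. achievable_informed W (a, b) (R1, R2)"
  using info_pair_achievable[of 1 W "return_pmf undefined" "return_pmf undefined"] achievable_informed_mono[of W 0 0 _ a b] assms by auto

lemma achievable_informed_bdd_above:
  fixes W :: "'a::finite \<Rightarrow> 'b::finite \<Rightarrow> 'c::finite pmf"
  shows "bdd_above ((\<lambda>R. fst R + snd R) ` {R. achievable_informed W (a, b) R})"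
  by (rule bdd_aboveI2[of _ _ "max_mutual_information W"]) (auto intro: achievable_informed_le_max_mutual_information)

lemma achievable_informed_sup_upper:
  fixes W :: "'a::finite \<Rightarrow> 'b::finite \<Rightarrow> 'c::finite pmf"
  assumes "achievable_informed W (a, b) (R1, R2)"
  shows "R1 + R2 \<le> achievable_informed_sup W (a, b)"
  unfolding achievable_informed_sup_def using cSUP_upper[OF _ achievable_informed_bdd_above, of "(R1, R2)" W a b] assms by simp

lemma achievable_informed_sup_least:
  fixes W :: "'a::finite \<Rightarrow> 'b::finite \<Rightarrow> 'c::finite pmf"
  assumes "0 \<le> a" "0 \<le> b" "\<And>R1 R2. achievable_informed W (a, b) (R1, R2) \<Longrightarrow> R1 + R2 \<le> x"
  shows "achievable_informed_sup W (a, b) \<le> x"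
  unfolding achievable_informed_sup_def using achievable_informed_nonempty[OF assms(1,2)] assms(3) by (intro cSUP_least) auto

text \<open>The hypothesis on the input capacities acts here: nonnegative rates with sum at most the
  maximal mutual information stay below both input capacities, so informed codes can be realised.
  The closure does not change the supremum because the sum is continuous.\<close>

lemma sum_capacity_avg_eq_achievable_informed_sup:
  fixes W :: "'a::finite \<Rightarrow> 'b::finite \<Rightarrow> 'c::finite pmf"
  assumes Cin: "min (fst Cin) (snd Cin) > max_mutual_information W" and ab: "0 \<le> a" "0 \<le> b"
  shows "sum_capacity_avg W Cin (a, b) = achievable_informed_sup W (a, b)"
proof -
  let ?h = "\<lambda>R :: real \<times> real. fst R + snd R" and ?S = "{R. achievable_informed W (a, b) R}"
  have "achievable_avg W Cin (a, b) R \<longleftrightarrow> achievable_informed W (a, b) R" for R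
  proof
    assume R: "achievable_informed W (a, b) R"
    then have "fst R + snd R \<le> max_mutual_information W" "0 \<le> fst R" "0 \<le> snd R"
      using achievable_informed_le_max_mutual_information[of W a b "fst R" "snd R"] by (auto simp: achievable_informed_def)
    then show "achievable_avg W Cin (a, b) R" using R Cin ab by (intro achievable_informed_imp_achievable_avg) auto
  qed (rule achievable_avg_imp_achievable_informed)
  then have eq: "capacity_region_avg W Cin (a, b) = closure ?S" by (simp add: capacity_region_avg_def)
  have ne: "?S \<noteq> {}" using achievable_informed_nonempty[OF ab] by blast
  have "closed {R. ?h R \<le> achievable_informed_sup W (a, b)}" by (intro closed_Collect_le continuous_intros)
  moreover have "?S \<subseteq> {R. ?h R \<le> achievable_informed_sup W (a, b)}" using achievable_informed_sup_upper by (auto simp: split_paired_all)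
  ultimately have le: "closure ?S \<subseteq> {R. ?h R \<le> achievable_informed_sup W (a, b)}" by (rule closure_minimal[rotated])
  show ?thesis unfolding sum_capacity_avg_def eq
  proof (rule antisym)
    show "(SUP R\<in>closure ?S. ?h R) \<le> achievable_informed_sup W (a, b)" using ne le by (intro cSUP_least) auto
    show "achievable_informed_sup W (a, b) \<le> (SUP R\<in>closure ?S. ?h R)" unfolding achievable_informed_sup_def
      using ne le closure_subset[of ?S] by (intro cSUP_subset_mono bdd_aboveI2[where M = "achievable_informed_sup W (a, b)"]) auto
  qed
qed

lemma achievable_informed_sup_mono:
  fixes W :: "'a::finite \<Rightarrow> 'b::finite \<Rightarrow> 'c::finite pmf"
  assumes "0 \<le> a" "0 \<le> b" "a \<le> a'" "b \<le> b'"
  shows "achievable_informed_sup W (a, b) \<le> achievable_informed_sup W (a', b')"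
  using assms by (intro achievable_informed_sup_least achievable_informed_sup_upper achievable_informed_mono[of W a b _ a' b']) auto

lemma achievable_informed_sup_nonneg:
  fixes W :: "'a::finite \<Rightarrow> 'b::finite \<Rightarrow> 'c::finite pmf"
  assumes "0 \<le> a" "0 \<le> b"
  shows "0 \<le> achievable_informed_sup W (a, b)"
proof -
  obtain R1 R2 where R: "achievable_informed W (a, b) (R1, R2)" using achievable_informed_nonempty[OF assms] by blast
  then show ?thesis using achievable_informed_sup_upper[OF R] achievable_informed_nonneg[OF R] by linarith
qed

lemma achievable_informed_sup_scale:
  fixes W :: "'a::finite \<Rightarrow> 'b::finite \<Rightarrow> 'c::finite pmf"
  assumes ab: "0 \<le> a" "0 \<le> b" and l: "1 \<le> l"
  shows "achievable_informed_sup W (l * a, l * b) \<le> l * achievable_informed_sup W (a, b)"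
proof (rule achievable_informed_sup_least)
  fix R1 R2 assume R: "achievable_informed W (l * a, l * b) (R1, R2)"
  show "R1 + R2 \<le> l * achievable_informed_sup W (a, b)"
  proof (rule field_le_epsilon)
    fix e :: real assume "0 < e"
    define \<theta> where "\<theta> = e / (2 * l)"
    have \<theta>: "0 < \<theta>" using \<open>0 < e\<close> l by (simp add: \<theta>_def)
    have "(R1 / l - \<theta>) + (R2 / l - \<theta>) \<le> achievable_informed_sup W (a, b)"
      using achievable_informed_sup_upper[OF achievable_informed_scale[OF R l ab \<theta>]] by linarith
    then have "l * ((R1 / l - \<theta>) + (R2 / l - \<theta>)) \<le> l * achievable_informed_sup W (a, b)" using l by (intro mult_left_mono) auto
    moreover have "l * ((R1 / l - \<theta>) + (R2 / l - \<theta>)) = R1 + R2 - e" using l by (simp add: \<theta>_def field_simps)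
    ultimately show "R1 + R2 \<le> l * achievable_informed_sup W (a, b) + e" by linarith
  qed
qed (use assms in auto)

lemma achievable_informed_sup_transfer:
  fixes W :: "'a::finite \<Rightarrow> 'b::finite \<Rightarrow> 'c::finite pmf"
  assumes "0 \<le> a" "0 < \<delta>"
  shows "achievable_informed_sup W (a, \<delta>) \<le> achievable_informed_sup W (a + 2 * \<delta>, 0) + 4 * \<delta>"
proof (rule achievable_informed_sup_least)
  fix R1 R2 assume "achievable_informed W (a, \<delta>) (R1, R2)"
  from achievable_informed_transfer[OF this assms] obtain R1' R2' where "achievable_informed W (a + 2 * \<delta>, 0) (R1', R2')" "R1 + R2 \<le> R1' + R2' + 4 * \<delta>"
    by blast
  then show "R1 + R2 \<le> achievable_informed_sup W (a + 2 * \<delta>, 0) + 4 * \<delta>" using achievable_informed_sup_upper[of W "a + 2 * \<delta>" 0 R1' R2'] by linarith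
qed (use assms in auto)

lemma achievable_informed_sup_swap_le:
  fixes W :: "'a::finite \<Rightarrow> 'b::finite \<Rightarrow> 'c::finite pmf"
  assumes "0 \<le> a" "0 \<le> b"
  shows "achievable_informed_sup W (a, b) \<le> achievable_informed_sup (\<lambda>y x. W x y) (b, a)"
proof (rule achievable_informed_sup_least)
  fix R1 R2 assume "achievable_informed W (a, b) (R1, R2)"
  from achievable_informed_sup_upper[OF achievable_informed_swap[OF this]] show "R1 + R2 \<le> achievable_informed_sup (\<lambda>y x. W x y) (b, a)" by simp
qed fact+

lemma achievable_informed_sup_swap:
  fixes W :: "'a::finite \<Rightarrow> 'b::finite \<Rightarrow> 'c::finite pmf"
  assumes "0 \<le> a" "0 \<le> b"
  shows "achievable_informed_sup (\<lambda>y x. W x y) (b, a) = achievable_informed_sup W (a, b)"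
  using achievable_informed_sup_swap_le[OF assms, of W] achievable_informed_sup_swap_le[OF assms(2,1), of "\<lambda>y x. W x y"] by simp

text \<open>The excess over \<open>C0\<close> splits into four parts of at most
  \<open>\<eta> / 4\<close>: \<open>\<gamma> * C0\<close>, the smoothing cost
  \<open>(1 + \<gamma>) * (\<eta> / 8)\<close>, \<open>\<beta> * X\<close> and
  \<open>s * (a + b)\<close>. The order of choices matters: \<open>X\<close> depends on
  \<open>\<tau>\<close>, \<open>\<beta>\<close> on \<open>X\<close>, \<open>s\<close> on
  \<open>\<beta>\<close> and \<open>\<gamma>\<close>, and \<open>\<kappa>\<close> comes
  last.\<close>

lemma achievable_informed_sup_near_zero:
  fixes W :: "'a::finite \<Rightarrow> 'b::finite \<Rightarrow> 'c::finite pmf"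
  assumes \<eta>: "0 < \<eta>"
  shows "\<exists>\<kappa>>0. \<forall>a b. 0 \<le> a \<longrightarrow> a \<le> \<kappa> \<longrightarrow> 0 \<le> b \<longrightarrow> b \<le> \<kappa> \<longrightarrow> achievable_informed_sup W (a, b) \<le> achievable_informed_sup W (0, 0) + \<eta>"
proof -
  define C0 where "C0 = achievable_informed_sup W (0, 0)"
  have C0: "0 \<le> C0" unfolding C0_def by (rule achievable_informed_sup_nonneg) auto
  have I: "info (case_prod W) (pair_pmf p1 p2) \<le> C0" for p1 p2
  proof (rule field_le_epsilon)
    fix e :: real assume "0 < e"
    from info_pair_achievable[OF this, of W p1 p2] show "info (case_prod W) (pair_pmf p1 p2) \<le> C0 + e"
      unfolding C0_def using achievable_informed_sup_upper by force
  qed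
  have cancel: "\<eta> / (4 * D) * D = \<eta> / 4" if "D \<noteq> 0" for D using that by simp
  have cancel': "D * (2 * (\<eta> / (8 * D))) = \<eta> / 4" if "D \<noteq> 0" for D using that by simp
  define N where "N = real CARD('a \<times> 'b)"
  have "1 \<le> CARD('a \<times> 'b)" by (simp add: Suc_leI del: card_prod)
  then have N: "1 \<le> N" unfolding N_def by linarith
  define \<gamma> where "\<gamma> = min 1 (\<eta> / (4 * (C0 + 1)))"
  define \<tau> where "\<tau> = 1 - 2 powr (- (\<eta> / 8))"
  define X where "X = N * log 2 (N / \<tau>)"
  define \<beta> where "\<beta> = min (1 / 2) (\<eta> / (4 * (X + 1)))"
  define s where "s = ln (1 / \<beta>) / ln (1 + \<gamma>)"
  define \<kappa> where "\<kappa> = \<eta> / (8 * (s + 1))"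
  have \<gamma>: "0 < \<gamma>" "\<gamma> \<le> 1" using \<eta> C0 by (auto simp: \<gamma>_def)
  have "\<gamma> * C0 \<le> \<gamma> * (C0 + 1)" using \<gamma> by (intro mult_left_mono) auto
  also have "\<dots> \<le> \<eta> / (4 * (C0 + 1)) * (C0 + 1)" using C0 by (intro mult_right_mono) (auto simp: \<gamma>_def)
  also have "\<dots> = \<eta> / 4" using C0 by (intro cancel) linarith
  finally have \<gamma>C: "\<gamma> * C0 \<le> \<eta> / 4" .
  have "2 powr (- (\<eta> / 8)) < 2 powr 0" using \<eta> by (intro powr_less_mono) auto
  then have \<tau>: "0 < \<tau>" "\<tau> < 1" by (auto simp: \<tau>_def)
  have log\<tau>: "log 2 (1 - \<tau>) = - (\<eta> / 8)" by (simp add: \<tau>_def)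
  have "1 \<le> N / \<tau>" using N \<tau> by simp
  then have X: "0 \<le> X" using N by (simp add: X_def)
  have \<beta>: "0 < \<beta>" "\<beta> < 1" using \<eta> X by (auto simp: \<beta>_def)
  have "\<beta> * X \<le> \<beta> * (X + 1)" using \<beta> by (intro mult_left_mono) auto
  also have "\<dots> \<le> \<eta> / (4 * (X + 1)) * (X + 1)" using X by (intro mult_right_mono) (auto simp: \<beta>_def)
  also have "\<dots> = \<eta> / 4" using X by (intro cancel) linarith
  finally have \<beta>X: "\<beta> * X \<le> \<eta> / 4" .
  have s: "0 \<le> s" using \<beta> \<gamma> by (simp add: s_def)
  have \<kappa>: "0 < \<kappa>" using s \<eta> by (simp add: \<kappa>_def)
  have "achievable_informed_sup W (a, b) \<le> C0 + \<eta>" if ab: "0 \<le> a" "a \<le> \<kappa>" "0 \<le> b" "b \<le> \<kappa>" for a b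
  proof (rule achievable_informed_sup_least[OF ab(1,3)])
    fix R1 R2 assume R: "achievable_informed W (a, b) (R1, R2)"
    have "R1 + R2 \<le> (1 + \<gamma>) * (C0 - log 2 (1 - \<tau>)) + \<beta> * X + s * (a + b)"
      using small_cooperation_converse[OF R ab(1,3) I \<gamma>(1) \<beta> \<tau>] unfolding X_def N_def s_def .
    also have "\<dots> = C0 + \<gamma> * C0 + (1 + \<gamma>) * (\<eta> / 8) + \<beta> * X + s * (a + b)"
      unfolding log\<tau> by (simp add: algebra_simps)
    also have "\<dots> \<le> C0 + \<eta> / 4 + 2 * (\<eta> / 8) + \<eta> / 4 + \<eta> / 4"
    proof (intro add_mono order_refl \<gamma>C \<beta>X)
      show "(1 + \<gamma>) * (\<eta> / 8) \<le> 2 * (\<eta> / 8)" using \<gamma> \<eta> by (intro mult_right_mono) auto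
      have "s * (a + b) \<le> (s + 1) * (2 * \<kappa>)" using ab s by (intro mult_mono) auto
      also have "\<dots> = \<eta> / 4" unfolding \<kappa>_def using s by (intro cancel') linarith
      finally show "s * (a + b) \<le> \<eta> / 4" .
    qed
    finally show "R1 + R2 \<le> C0 + \<eta>" by simp
  qed
  then show ?thesis using \<kappa> unfolding C0_def by blast
qed

text \<open>Isolates the inequalities behind continuity off the origin, so that they serve both the
  sum capacity and its version with exchanged coordinates, which treats the other axis.\<close>

locale capacity_like =
  fixes f :: "real \<times> real \<Rightarrow> real" and Bd :: real
  assumes mono: "\<And>a b a' b'. 0 \<le> a \<Longrightarrow> 0 \<le> b \<Longrightarrow> a \<le> a' \<Longrightarrow> b \<le> b' \<Longrightarrow> f (a, b) \<le> f (a', b')"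
    and scale: "\<And>l a b. 0 \<le> a \<Longrightarrow> 0 \<le> b \<Longrightarrow> 1 \<le> l \<Longrightarrow> f (l * a, l * b) \<le> l * f (a, b)"
    and bound: "\<And>a b. 0 \<le> a \<Longrightarrow> 0 \<le> b \<Longrightarrow> f (a, b) \<le> Bd"
    and transfer: "\<And>a \<delta>. 0 \<le> a \<Longrightarrow> 0 < \<delta> \<Longrightarrow> f (a, \<delta>) \<le> f (a + 2 * \<delta>, 0) + 4 * \<delta>"
    and Bd: "0 \<le> Bd"
begin

lemma relative_bound:
  assumes "0 \<le> a" "0 \<le> b" "0 \<le> a'" "0 \<le> b'" "0 \<le> r" "a \<le> (1 + r) * a'" "b \<le> (1 + r) * b'"
  shows "f (a, b) \<le> f (a', b') + r * Bd"
proof -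
  have "f (a, b) \<le> f ((1 + r) * a', (1 + r) * b')" using assms by (intro mono) auto
  also have "\<dots> \<le> (1 + r) * f (a', b')" using assms by (intro scale) auto
  also have "\<dots> \<le> f (a', b') + r * Bd" using mult_left_mono[OF bound[OF assms(3,4)] assms(5)] by (simp add: algebra_simps)
  finally show ?thesis .
qed

lemma shrink_factor:
  fixes a a' \<rho> m :: real
  assumes "0 < m" "m \<le> a" "2 * \<rho> \<le> m" "0 < \<rho>" "\<bar>a' - a\<bar> \<le> \<rho>"
  shows "a \<le> (1 + 2 * \<rho> / m) * a'" "a' \<le> (1 + 2 * \<rho> / m) * a"
proof -
  have "m / 2 \<le> a'" using assms by linarith
  then have "2 * \<rho> / m * (m / 2) \<le> 2 * \<rho> / m * a'" using assms by (intro mult_left_mono) auto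
  then show "a \<le> (1 + 2 * \<rho> / m) * a'" using assms by (simp add: algebra_simps)
  have "2 * \<rho> / m * (m / 2) \<le> 2 * \<rho> / m * a" using assms by (intro mult_left_mono) auto
  then show "a' \<le> (1 + 2 * \<rho> / m) * a" using assms by (simp add: algebra_simps)
qed

lemma interior_lipschitz:
  assumes "0 < m" "m \<le> a" "m \<le> b" "2 * \<rho> \<le> m" "0 < \<rho>" "\<bar>a' - a\<bar> \<le> \<rho>" "\<bar>b' - b\<bar> \<le> \<rho>"
  shows "\<bar>f (a', b') - f (a, b)\<bar> \<le> 2 * Bd / m * \<rho>"
proof -
  have nn: "0 \<le> a" "0 \<le> b" "0 \<le> a'" "0 \<le> b'" "0 \<le> 2 * \<rho> / m" using assms by auto
  have "f (a', b') \<le> f (a, b) + 2 * \<rho> / m * Bd"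
    using nn assms by (intro relative_bound shrink_factor) auto
  moreover have "f (a, b) \<le> f (a', b') + 2 * \<rho> / m * Bd"
    using nn assms by (intro relative_bound shrink_factor) auto
  moreover have "2 * \<rho> / m * Bd = 2 * Bd / m * \<rho>" by simp
  ultimately show ?thesis by linarith
qed

text \<open>Nearby points lie below \<open>(a + \<rho>, \<rho>)\<close>; trading the second
  coordinate leads to \<open>(a + 3 * \<rho>, 0)\<close>, a relative change
  \<open>3 * \<rho> / a\<close> of the positive coordinate. The lower estimate uses only the
  relative change from \<open>a\<close> to \<open>a'\<close>, as \<open>b'\<close> is
  nonnegative.\<close>

lemma axis_lipschitz:
  assumes "0 < a" "2 * \<rho> \<le> a" "0 < \<rho>" "\<bar>a' - a\<bar> \<le> \<rho>" "0 \<le> b'" "b' \<le> \<rho>"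
  shows "\<bar>f (a', b') - f (a, 0)\<bar> \<le> (3 * Bd / a + 4) * \<rho>"
proof -
  have a': "0 \<le> a'" using assms by linarith
  have "f (a', b') \<le> f (a + \<rho>, \<rho>)" using assms a' by (intro mono) auto
  also have "\<dots> \<le> f (a + \<rho> + 2 * \<rho>, 0) + 4 * \<rho>" using assms by (intro transfer) auto
  also have "f (a + \<rho> + 2 * \<rho>, 0) \<le> f (a, 0) + 3 * \<rho> / a * Bd"
  proof (rule relative_bound)
    show "0 \<le> a + \<rho> + 2 * \<rho>" "0 \<le> a" "0 \<le> 3 * \<rho> / a" using assms(1,3) by simp_all
    have "(1 + 3 * \<rho> / a) * a = a + 3 * \<rho>" using assms(1) by (simp add: distrib_right)
    then show "a + \<rho> + 2 * \<rho> \<le> (1 + 3 * \<rho> / a) * a" by linarith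
  qed simp_all
  finally have "f (a', b') \<le> f (a, 0) + 3 * \<rho> / a * Bd + 4 * \<rho>" by simp
  moreover have "f (a, 0) \<le> f (a', b') + 2 * \<rho> / a * Bd"
  proof (rule relative_bound)
    show "a \<le> (1 + 2 * \<rho> / a) * a'" using assms by (intro shrink_factor) auto
  qed (use assms a' in auto)
  moreover have "2 * \<rho> / a * Bd \<le> 3 * \<rho> / a * Bd" using assms Bd by (intro mult_right_mono divide_right_mono) auto
  moreover have "3 * \<rho> / a * Bd + 4 * \<rho> = (3 * Bd / a + 4) * \<rho>" by (simp add: algebra_simps)
  ultimately show ?thesis using assms(3) by linarith
qed

end

lemma dist_less_from_lipschitz:
  fixes f :: "real \<times> real \<Rightarrow> real"
  assumes r: "0 < r" and e: "0 < e" and K: "0 \<le> K"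
    and lip: "\<And>\<rho> a' b'. 0 < \<rho> \<Longrightarrow> \<rho> \<le> r \<Longrightarrow> 0 \<le> a' \<Longrightarrow> 0 \<le> b' \<Longrightarrow> \<bar>a' - a\<bar> \<le> \<rho> \<Longrightarrow> \<bar>b' - b\<bar> \<le> \<rho> \<Longrightarrow>
      \<bar>f (a', b') - f (a, b)\<bar> \<le> K * \<rho>"
  shows "\<exists>d>0. \<forall>x'\<in>{0..} \<times> {0..}. dist x' (a, b) < d \<longrightarrow> dist (f x') (f (a, b)) < e"
proof -
  define d where "d = min r (e / (K + 1))"
  have d: "0 < d" using assms by (simp add: d_def)
  have "dist (f x') (f (a, b)) < e" if x': "x' \<in> {0..} \<times> {0..}" "dist x' (a, b) < d" for x'
  proof -
    obtain a' b' where ab: "x' = (a', b')" by (cases x')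
    have "\<bar>a' - a\<bar> \<le> d" "\<bar>b' - b\<bar> \<le> d"
      using x'(2) dist_fst_le[of x' "(a, b)"] dist_snd_le[of x' "(a, b)"] by (auto simp: ab dist_real_def)
    then have "\<bar>f (a', b') - f (a, b)\<bar> \<le> K * d" using x'(1) d by (intro lip) (auto simp: ab d_def)
    also have "\<dots> < (K + 1) * d" using d by (simp add: algebra_simps)
    also have "\<dots> \<le> (K + 1) * (e / (K + 1))" using K by (intro mult_left_mono) (auto simp: d_def)
    also have "\<dots> = e" using K by simp
    finally show ?thesis by (simp add: ab dist_real_def)
  qed
  then show ?thesis using d by blast
qed

lemma continuous_on_quadrant:
  fixes f :: "real \<times> real \<Rightarrow> real"
  assumes c1: "capacity_like f Bd" and c2: "capacity_like (\<lambda>x. f (prod.swap x)) Bd"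
    and zero: "\<And>\<eta>. 0 < \<eta> \<Longrightarrow> \<exists>\<kappa>>0. \<forall>a b. 0 \<le> a \<longrightarrow> a \<le> \<kappa> \<longrightarrow> 0 \<le> b \<longrightarrow> b \<le> \<kappa> \<longrightarrow> f (a, b) \<le> f (0, 0) + \<eta>"
  shows "continuous_on ({0..} \<times> {0..}) f"
  unfolding continuous_on_iff
proof (intro ballI allI impI)
  fix x :: "real \<times> real" and e :: real assume x: "x \<in> {0..} \<times> {0..}" and e: "0 < e"
  obtain a b where ab: "x = (a, b)" "0 \<le> a" "0 \<le> b" using x by auto
  have Bd: "0 \<le> Bd" using c1 by (simp add: capacity_like_def)
  have "a = 0 \<or> 0 < a" "b = 0 \<or> 0 < b" using ab by auto
  then consider "a = 0" "b = 0" | "0 < a" "b = 0" | "a = 0" "0 < b" | "0 < a" "0 < b" by blast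
  then show "\<exists>d>0. \<forall>x'\<in>{0..} \<times> {0..}. dist x' x < d \<longrightarrow> dist (f x') (f x) < e"
  proof cases
    case 1
    obtain \<kappa> where \<kappa>: "0 < \<kappa>" and le: "\<And>a b. 0 \<le> a \<Longrightarrow> a \<le> \<kappa> \<Longrightarrow> 0 \<le> b \<Longrightarrow> b \<le> \<kappa> \<Longrightarrow> f (a, b) \<le> f (0, 0) + e / 2"
      using zero[of "e / 2"] e by auto
    have "dist (f x') (f x) < e" if x': "x' \<in> {0..} \<times> {0..}" "dist x' x < \<kappa>" for x'
    proof -
      obtain a' b' where ab': "x' = (a', b')" "0 \<le> a'" "0 \<le> b'" using x' by auto
      have "a' \<le> \<kappa>" "b' \<le> \<kappa>"
        using x'(2) dist_fst_le[of x' x] dist_snd_le[of x' x] 1 by (auto simp: ab ab' dist_real_def)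
      then have "f x' \<le> f (0, 0) + e / 2" using le ab' by simp
      moreover have "f (0, 0) \<le> f x'" unfolding ab' by (rule capacity_like.mono[OF c1]) (use ab' in auto)
      ultimately show ?thesis using e 1 by (simp add: ab dist_real_def)
    qed
    then show ?thesis using \<kappa> by blast
  next
    case 2
    show ?thesis unfolding ab
    proof (rule dist_less_from_lipschitz[where r = "a / 2" and K = "3 * Bd / a + 4"])
      show "\<bar>f (a', b') - f (a, b)\<bar> \<le> (3 * Bd / a + 4) * \<rho>" if "0 < \<rho>" "\<rho> \<le> a / 2" "0 \<le> a'" "0 \<le> b'" "\<bar>a' - a\<bar> \<le> \<rho>" "\<bar>b' - b\<bar> \<le> \<rho>" for \<rho> a' b'
        using capacity_like.axis_lipschitz[OF c1, of a \<rho> a' b'] that 2 by auto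
    qed (use 2 e Bd in auto)
  next
    case 3
    show ?thesis unfolding ab
    proof (rule dist_less_from_lipschitz[where r = "b / 2" and K = "3 * Bd / b + 4"])
      show "\<bar>f (a', b') - f (a, b)\<bar> \<le> (3 * Bd / b + 4) * \<rho>" if "0 < \<rho>" "\<rho> \<le> b / 2" "0 \<le> a'" "0 \<le> b'" "\<bar>a' - a\<bar> \<le> \<rho>" "\<bar>b' - b\<bar> \<le> \<rho>" for \<rho> a' b'
        using capacity_like.axis_lipschitz[OF c2, of b \<rho> b' a'] that 3 by auto
    qed (use 3 e Bd in auto)
  next
    case 4
    show ?thesis unfolding ab
    proof (rule dist_less_from_lipschitz[where r = "min a b / 2" and K = "2 * Bd / min a b"])
      show "\<bar>f (a', b') - f (a, b)\<bar> \<le> 2 * Bd / min a b * \<rho>" if "0 < \<rho>" "\<rho> \<le> min a b / 2" "0 \<le> a'" "0 \<le> b'" "\<bar>a' - a\<bar> \<le> \<rho>" "\<bar>b' - b\<bar> \<le> \<rho>" for \<rho> a' b'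
        using that 4 by (intro capacity_like.interior_lipschitz[OF c1]) auto
    qed (use 4 e Bd in auto)
  qed
qed

lemma capacity_like_achievable_informed_sup:
  fixes W :: "'a::finite \<Rightarrow> 'b::finite \<Rightarrow> 'c::finite pmf"
  assumes "max_mutual_information W \<le> Bd" "0 \<le> Bd"
  shows "capacity_like (achievable_informed_sup W) Bd"
proof
  show "achievable_informed_sup W (a, b) \<le> Bd" if "0 \<le> a" "0 \<le> b" for a b
    using that assms(1) by (intro achievable_informed_sup_least) (auto dest: achievable_informed_le_max_mutual_information)
qed (use assms in \<open>auto intro: achievable_informed_sup_mono achievable_informed_sup_scale achievable_informed_sup_transfer\<close>)

theorem theorem3:
  fixes W :: "'a::finite \<Rightarrow> 'b::finite \<Rightarrow> 'c::finite pmf"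
    and Cin :: "real \<times> real"
  assumes "Cin \<in> {0..} \<times> {0..}"
    and "min (fst Cin) (snd Cin) > max_mutual_information W"
  shows "continuous_on ({0..} \<times> {0..}) (\<lambda>Cout. sum_capacity_avg W Cin Cout)"
proof -
  let ?W' = "\<lambda>y x. W x y"
  \<comment> \<open>One bound for both orders of the inputs, so that the two instances of
    \<open>capacity_like\<close> share it; the outer maximum makes it nonnegative.\<close>
  define Bd where "Bd = max 0 (max (max_mutual_information W) (max_mutual_information ?W'))"
  have c1: "capacity_like (achievable_informed_sup W) Bd" by (rule capacity_like_achievable_informed_sup) (auto simp: Bd_def)
  have c2': "capacity_like (achievable_informed_sup ?W') Bd" by (rule capacity_like_achievable_informed_sup) (auto simp: Bd_def)
  have "capacity_like (\<lambda>x. achievable_informed_sup W (prod.swap x)) Bd"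
  proof -
    interpret c: capacity_like "achievable_informed_sup ?W'" Bd by (rule c2')
    have eq: "achievable_informed_sup W (prod.swap (a, b)) = achievable_informed_sup ?W' (a, b)" if "0 \<le> a" "0 \<le> b" for a b
      using achievable_informed_sup_swap[OF that(2,1), of W] by simp
    show ?thesis
    proof
      show "achievable_informed_sup W (prod.swap (a, b)) \<le> achievable_informed_sup W (prod.swap (a', b'))"
        if "0 \<le> a" "0 \<le> b" "a \<le> a'" "b \<le> b'" for a b a' b'
        using c.mono[OF that] that by (simp only: eq order_trans[of 0 a a'] order_trans[of 0 b b'])
      show "achievable_informed_sup W (prod.swap (l * a, l * b)) \<le> l * achievable_informed_sup W (prod.swap (a, b))"
        if "0 \<le> a" "0 \<le> b" "1 \<le> l" for l a b
      proof -
        have n: "0 \<le> l * a" "0 \<le> l * b" using that by auto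
        show ?thesis unfolding eq[OF n] eq[OF that(1,2)] by (rule c.scale[OF that])
      qed
      show "achievable_informed_sup W (prod.swap (a, b)) \<le> Bd" if "0 \<le> a" "0 \<le> b" for a b
        using c.bound[OF that] by (simp only: eq[OF that])
      show "achievable_informed_sup W (prod.swap (a, \<delta>)) \<le> achievable_informed_sup W (prod.swap (a + 2 * \<delta>, 0)) + 4 * \<delta>"
        if "0 \<le> a" "0 < \<delta>" for a \<delta>
        using c.transfer[OF that] eq[of a \<delta>] eq[of "a + 2 * \<delta>" 0] that by simp
    qed (rule c.Bd)
  qed
  from continuous_on_quadrant[OF c1 this achievable_informed_sup_near_zero]
  have "continuous_on ({0..} \<times> {0..}) (achievable_informed_sup W)" by blast
  then show ?thesis
    by (rule continuous_on_eq) (use assms(2) in \<open>auto simp: sum_capacity_avg_eq_achievable_informed_sup\<close>)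
qed

end
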